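(* Suppose that $F_0=I$ (the identity tensor) and that (i) $\mathcal D$ and $\mathcal L$ satisfy the Partition Condition (with respect to the origin): $x\cdot n(x)\ge 0$ for all $x\in\mathcal D$ and $x\cdot n(x)\le 0$ for all $x\in\mathcal L$; (ii) $W$ is rank-one convex; (iii) $W(F)>W(R)=W(I)$ for all $F\in\mathrm{Lin}_+\setminus\mathrm{Orth}_+$ and all $R\in\mathrm{Orth}_+$. Then the only classical equilibrium $y$ satisfying the boundary conditions $y(x)=x$ for all $x\in\mathcal D$ and $S(\nabla y)n=S(I)n$ on $\mathcal L$ is $y(x)=x$ on $\Omega$.
   Context: $\Omega\subset\mathbb R^N$ is a compact region with nonempty interior $\operatorname{int}\Omega$ and boundary $\partial\Omega=\mathcal D\cup\mathcal L$, where $\mathcal D$ and $\mathcal L$ are disjoint, piecewise smooth (hyper)surfaces and $\mathcal D$ is nonempty; $n=n(x)$ is the unit outward normal on $\partial\Omega$ (conditions involving $n$ are imposed where $n$ is defined). $\mathrm{Lin}_+$ is the set of real $N\times N$ matrices (tensors) with positive determinant and $\mathrm{Orth}_+$ is the rotation group (orthogonal $N\times N$ matrices with determinant $1$). For matrices, $A\cdot B=\operatorname{tr}(A^TB)$, and $(a\otimes b)_{ij}=a_ib_j$. The stored energy function is $W\in C^2(\mathrm{Lin}_+,\mathbb R)$, with derivative (Piola stress) $S(F)=DW(F)$ for $F\in\mathrm{Lin}_+$. $W$ is rank-one convex if $W(A)-W(F)\ge S(F)\cdot(A-F)$ for all $A,F\in\mathrm{Lin}_+$ with $A-F=a\otimes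 b$ for some $a,b\in\mathbb R^N$. A classical equilibrium is a mapping $y\in C^2(\operatorname{int}\Omega,\mathbb R^N)\cap C^1(\Omega,\mathbb R^N)$ (that is, $C^1$ up to the boundary) with $\nabla y\in\mathrm{Lin}_+$ on $\Omega$ and $\operatorname{div}S(\nabla y)=0$ on $\operatorname{int}\Omega$, where $(\nabla y)_{ij}=\partial y_i/\partial x_j$ and $(\operatorname{div}S)_i=\sum_j\partial S_{ij}/\partial x_j$. *)

theory Defs
  imports "HOL-Analysis.Analysis"
begin

section \<open>Continuous differentiability on open sets\<close>

definition C1_on :: "'a::real_normed_vector set \<Rightarrow> ('a \<Rightarrow> 'b::real_normed_vector) \<Rightarrow> bool" where
  "C1_on U f \<longleftrightarrow> (\<exists>f' :: 'a \<Rightarrow> 'a \<Rightarrow>\<^sub>L 'b.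
     (\<forall>x\<in>U. (f has_derivative blinfun_apply (f' x)) (at x)) \<and> continuous_on U f')"

definition C2_on :: "'a::real_normed_vector set \<Rightarrow> ('a \<Rightarrow> 'b::real_normed_vector) \<Rightarrow> bool" where
  "C2_on U f \<longleftrightarrow> (\<exists>f' :: 'a \<Rightarrow> 'a \<Rightarrow>\<^sub>L 'b.
     (\<forall>x\<in>U. (f has_derivative blinfun_apply (f' x)) (at x)) \<and> C1_on U f')"

section \<open>Piecewise smooth hypersurfaces and regions\<close>

text \<open>Smooth means continuously differentiable. \<open>regular_function U \<rho> g\<close>: \<open>\<rho>\<close> is of class \<open>C\<^sup>1\<close>
  on the open set \<open>U\<close>, with gradient field \<open>g\<close> vanishing nowhere on \<open>U\<close>.\<close>

definition regular_function ::
    "(real^'n) set \<Rightarrow> (real^'n \<Rightarrow> real) \<Rightarrow> (real^'n \<Rightarrow> real^'n) \<Rightarrow> bool" where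
  "regular_function U \<rho> g \<longleftrightarrow> open U \<and> continuous_on U g \<and>
     (\<forall>z\<in>U. (\<rho> has_derivative (\<lambda>h. g z \<bullet> h)) (at z) \<and> g z \<noteq> 0)"

definition smooth_hypersurface :: "(real^'n) set \<Rightarrow> bool" where
  "smooth_hypersurface M \<longleftrightarrow>
     (\<forall>x\<in>M. \<exists>U \<rho> g. regular_function U \<rho> g \<and> x \<in> U \<and> M \<inter> U = {z\<in>U. \<rho> z = 0})"

text \<open>An edge set is covered by finitely many Lipschitz images of compact subsets of
  \<open>(N - 2)\<close>-dimensional subspaces of \<open>\<real>\<^sup>N\<close>: a finite set if \<open>N = 2\<close>, the empty set if \<open>N = 1\<close>.\<close>

definition edge_set :: "(real^'n) set \<Rightarrow> bool" where
  "edge_set E \<longleftrightarrow> (\<exists>F :: (real^'n) set set. finite F \<and> E \<subseteq> \<Union>F \<and>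
     (\<forall>A\<in>F. \<exists>(V :: (real^'n) set) K f C. subspace V \<and> dim V + 2 = CARD('n) \<and>
        compact K \<and> K \<subseteq> V \<and> C-lipschitz_on K f \<and> A = f ` K))"

text \<open>\<open>R\<close> is the smooth part, its components are the smooth pieces, and \<open>closure R - R\<close> consists
  of the edges. A piecewise smooth hypersurface may contain all, some or none of its edges, since
  two disjoint such surfaces are to fill out a whole boundary. It may be empty.\<close>

definition piecewise_smooth_hypersurface :: "(real^'n) set \<Rightarrow> bool" where
  "piecewise_smooth_hypersurface M \<longleftrightarrow>
     (\<exists>R. smooth_hypersurface R \<and> finite (components R) \<and> edge_set (closure R - R) \<and>
        R \<subseteq> M \<and> M \<subseteq> closure R)"

definition partitioned_region :: "(real^'n) set \<Rightarrow> (real^'n) set \<Rightarrow> (real^'n) set \<Rightarrow> bool" where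
  "partitioned_region \<Omega> \<D> \<L> \<longleftrightarrow>
     compact \<Omega> \<and> connected \<Omega> \<and> interior \<Omega> \<noteq> {} \<and> \<Omega> = closure (interior \<Omega>) \<and>
     frontier \<Omega> = \<D> \<union> \<L> \<and> \<D> \<inter> \<L> = {} \<and> \<D> \<noteq> {} \<and>
     piecewise_smooth_hypersurface \<D> \<and> piecewise_smooth_hypersurface \<L>"

text \<open>\<open>n\<close> is the unit outward normal at \<open>x\<close>. Such an \<open>n\<close> exists where \<open>\<Omega>\<close> lies locally on one side
  of a smooth hypersurface through \<open>x\<close>, and is then unique. Conditions on the normal at \<open>x\<close> are
  quantified over all \<open>n\<close> with \<open>outward_normal \<Omega> x n\<close>, hence void where there is no normal.\<close>

definition outward_normal :: "(real^'n) set \<Rightarrow> real^'n \<Rightarrow> real^'n \<Rightarrow> bool" where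
  "outward_normal \<Omega> x n \<longleftrightarrow>
     (\<exists>U \<rho> g. regular_function U \<rho> g \<and> x \<in> U \<and> \<rho> x = 0 \<and>
        \<Omega> \<inter> U = {z\<in>U. \<rho> z \<le> 0} \<and> n = g x /\<^sub>R norm (g x))"

definition partition_condition :: "(real^'n) set \<Rightarrow> (real^'n) set \<Rightarrow> (real^'n) set \<Rightarrow> bool" where
  "partition_condition \<Omega> \<D> \<L> \<longleftrightarrow>
     (\<forall>x\<in>\<D>. \<forall>n. outward_normal \<Omega> x n \<longrightarrow> x \<bullet> n \<ge> 0) \<and>
     (\<forall>x\<in>\<L>. \<forall>n. outward_normal \<Omega> x n \<longrightarrow> x \<bullet> n \<le> 0)"

section \<open>Stored energy and stress\<close>

definition Lin_plus :: "(real^'n^'n) set" where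
  "Lin_plus = {A. det A > 0}"

definition Orth_plus :: "(real^'n^'n) set" where
  "Orth_plus = {Q. rotation_matrix Q}"

definition tensor :: "real^'n \<Rightarrow> real^'n \<Rightarrow> real^'n^'n" where
  "tensor a b = (\<chi> i j. a $ i * b $ j)"

lemma inner_matrix_eq_trace: "A \<bullet> B = trace (transpose A ** B)" for A B :: "real^'n^'n"
  unfolding trace_def transpose_def matrix_matrix_mult_def inner_vec_def
  by (simp add: sum.swap[of "\<lambda>i j. A $ i $ j * B $ i $ j"])

text \<open>\<open>axis i (axis j 1)\<close> is the matrix whose only nonzero entry is a \<open>1\<close> in row \<open>i\<close>, column \<open>j\<close>.\<close>

definition stress :: "(real^'n^'n \<Rightarrow> real) \<Rightarrow> real^'n^'n \<Rightarrow> real^'n^'n" where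
  "stress W F = (\<chi> i j. frechet_derivative W (at F) (axis i (axis j 1)))"

definition rank_one_convex :: "(real^'n^'n \<Rightarrow> real) \<Rightarrow> bool" where
  "rank_one_convex W \<longleftrightarrow> (\<forall>A\<in>Lin_plus. \<forall>F\<in>Lin_plus.
     (\<exists>a b. A - F = tensor a b) \<longrightarrow> W A - W F \<ge> stress W F \<bullet> (A - F))"

section \<open>Classical equilibria\<close>

text \<open>The gradient of \<open>y\<close> on \<open>\<Omega>\<close>: at boundary points it is the limit of the gradient from the
  interior. When \<open>\<Omega>\<close> is the closure of its interior, continuity of \<open>gradient_on \<Omega> y\<close> on \<open>\<Omega>\<close> forces
  these limits to exist, that is, \<open>\<nabla>y\<close> extends continuously from the interior to \<open>\<Omega>\<close>.\<close>

definition gradient_on :: "(real^'n) set \<Rightarrow> (real^'n \<Rightarrow> real^'n) \<Rightarrow> real^'n \<Rightarrow> real^'n^'n" where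
  "gradient_on \<Omega> y x =
     (if x \<in> interior \<Omega> then jacobian y (at x)
      else Lim (at x within interior \<Omega>) (\<lambda>z. jacobian y (at z)))"

definition divergence :: "(real^'n \<Rightarrow> real^'n^'n) \<Rightarrow> real^'n \<Rightarrow> real^'n" where
  "divergence T x = (\<chi> i. \<Sum>j\<in>UNIV. frechet_derivative T (at x) (axis j 1) $ i $ j)"

definition classical_equilibrium ::
    "(real^'n^'n \<Rightarrow> real) \<Rightarrow> (real^'n) set \<Rightarrow> (real^'n \<Rightarrow> real^'n) \<Rightarrow> bool" where
  "classical_equilibrium W \<Omega> y \<longleftrightarrow>
     C2_on (interior \<Omega>) y \<and> continuous_on \<Omega> y \<and> continuous_on \<Omega> (gradient_on \<Omega> y) \<and>
     (\<forall>x\<in>\<Omega>. gradient_on \<Omega> y x \<in> Lin_plus) \<and>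
     (\<forall>x\<in>interior \<Omega>. divergence (\<lambda>z. stress W (gradient_on \<Omega> y z)) x = 0)"

end

theory Submission
  imports Defs
begin

text \<open>
Write \<open>F\<close> for the gradient of an equilibrium \<open>y\<close>, \<open>S = S(F)\<close> for its stress and \<open>w = W(F) - W(I)\<close> for the
excess energy, which is nonnegative because the identity minimizes \<open>W\<close>. The proof rests on the
energy-momentum field \<open>P(x) = w(x) x + S\<^sup>T (y - F x)\<close>, for which equilibrium gives Green's identity
\<open>div P = N w\<close> (lemma \<open>vdiv_energy_flux\<close>). Its flux through the boundary is nonpositive:

\<^item> At a smooth point of \<open>\<D>\<close> the map \<open>y - id\<close> vanishes along the boundary, so \<open>F - I = a \<otimes> n\<close> for some
  vector \<open>a\<close> (lemmas \<open>tangential_derivative_zero\<close> and \<open>matrix_eq_tensor\<close>). Then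
  \<open>P \<bullet> n = (x \<bullet> n) (W(F) - W(I) - S \<bullet> (F - I))\<close>, where the first factor is nonnegative by the partition
  condition and the second nonpositive by rank-one convexity.

\<^item> At a smooth point of \<open>\<L>\<close> the traction \<open>S n = S(I) n\<close> is zero, so \<open>P \<bullet> n = w (x \<bullet> n) \<le> 0\<close>.

Hence the integral of \<open>w\<close> is nonpositive, \<open>w\<close> vanishes, and \<open>F\<close> is a rotation everywhere. A \<open>C\<^sup>2\<close> map whose
gradient is a rotation is a rigid motion on every component of the interior (lemma
\<open>rigid_motion_on_connected\<close>). No component can have all of its smooth boundary in \<open>\<L>\<close>, by the divergence
theorem for the field \<open>x\<close> on that component (lemma \<open>component_meets_displacement_boundary\<close>). At a smooth
point of \<open>\<D>\<close> the rotation fixes the tangent hyperplane, so it is the identity, and the translation is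
zero because \<open>y\<close> fixes that point.

The divergence theorem is used only as an inequality, and in a form without surface measure (theorem
\<open>integral_divergence_nonpos\<close>): if \<open>P \<bullet> n \<le> 0\<close> at the smooth boundary points, then the integral of \<open>div P\<close>
is nonpositive. Near a smooth boundary point the field is multiplied by a cutoff that is a function of
the defining function \<open>\<rho>\<close> of the boundary. The divergence of a compactly supported field integrates to
zero, and the term in which the cutoff is differentiated has a sign, since the gradient of the cutoff
points along the inner normal. The edges are covered by finitely many balls with arbitrarily small sum
of \<open>r\<^bsup>N-1\<^esup>\<close>; removing them by cutoffs of slope \<open>1/r\<close> on volumes \<open>r\<^sup>N\<close> costs arbitrarily little.
\<close>

section \<open>Calculus of continuously differentiable maps\<close>

text \<open>On a Euclidean domain continuity of the derivative can be tested one direction at a time. Derivatives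
are then handled as plain functions \<open>frechet_derivative f (at x)\<close>, and bounded linear maps as a type
appear only in the proofs about composition and uniform bounds.\<close>

lemma C1_onI:
  fixes f :: "'a::euclidean_space \<Rightarrow> 'b::real_normed_vector"
  assumes der: "\<And>x. x \<in> U \<Longrightarrow> (f has_derivative f' x) (at x)"
    and cont: "\<And>v. continuous_on U (\<lambda>x. f' x v)"
  shows "C1_on U f"
proof -
  define F where "F x = Blinfun (f' x)" for x
  have F: "blinfun_apply (F x) = f' x" if "x \<in> U" for x
    unfolding F_def by (rule bounded_linear_Blinfun_apply) (rule has_derivative_bounded_linear[OF der[OF that]])
  have "continuous_on U F"
  proof (rule continuous_on_blinfun_componentwise)
    fix i :: 'a
    show "continuous_on U (\<lambda>x. blinfun_apply (F x) i)"
      using cont[of i] by (rule continuous_on_eq) (simp add: F)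
  qed
  then show ?thesis
    unfolding C1_on_def using der F by (intro exI[of _ F]) auto
qed

lemma C1_on_has_derivative:
  assumes "C1_on U f" "x \<in> U"
  shows "(f has_derivative frechet_derivative f (at x)) (at x)"
  using assms unfolding C1_on_def by (metis frechet_derivative_at)

lemma C1_on_continuous_derivative_blinfun:
  assumes "C1_on U f"
  obtains F where "continuous_on U F" "\<And>x. x \<in> U \<Longrightarrow> frechet_derivative f (at x) = blinfun_apply (F x)"
  using assms unfolding C1_on_def by (metis frechet_derivative_at)

lemma C1_on_continuous_derivative:
  assumes "C1_on U f" "continuous_on U w"
  shows "continuous_on U (\<lambda>x. frechet_derivative f (at x) (w x))"
proof -
  obtain F where F: "continuous_on U F" "\<And>x. x \<in> U \<Longrightarrow> frechet_derivative f (at x) = blinfun_apply (F x)"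
    using C1_on_continuous_derivative_blinfun[OF assms(1)] by blast
  have "continuous_on U (\<lambda>x. blinfun_apply (F x) (w x))"
    by (intro continuous_intros F assms)
  then show ?thesis by (rule continuous_on_eq) (simp add: F)
qed

lemma C1_on_continuous_on: "C1_on U f \<Longrightarrow> continuous_on U f"
  unfolding C1_on_def
  by (metis continuous_at_imp_continuous_on has_derivative_continuous)

lemma C1_on_linear_bound:
  assumes "C1_on U f" "compact K" "K \<subseteq> U"
  obtains B where "B \<ge> 0" "\<And>x v. x \<in> K \<Longrightarrow> norm (frechet_derivative f (at x) v) \<le> B * norm v"
proof -
  obtain F where F: "continuous_on U F" "\<And>x. x \<in> U \<Longrightarrow> frechet_derivative f (at x) = blinfun_apply (F x)"
    using C1_on_continuous_derivative_blinfun[OF assms(1)] by blast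
  have "bounded (F ` K)"
    using compact_continuous_image[OF continuous_on_subset[OF F(1) assms(3)] assms(2)] compact_imp_bounded by blast
  then obtain B where B: "B > 0" "\<And>x. x \<in> K \<Longrightarrow> norm (F x) \<le> B"
    unfolding bounded_pos by auto
  show ?thesis
  proof
    show "B \<ge> 0" using B by simp
    fix x v assume x: "x \<in> K"
    have "norm (blinfun_apply (F x) v) \<le> norm (F x) * norm v" by (rule norm_blinfun)
    also have "\<dots> \<le> B * norm v" using B(2)[OF x] by (rule mult_right_mono) simp
    finally show "norm (frechet_derivative f (at x) v) \<le> B * norm v"
      using F(2) x assms(3) by auto
  qed
qed

lemma C1_on_subset: "C1_on U f \<Longrightarrow> V \<subseteq> U \<Longrightarrow> C1_on V f"
  unfolding C1_on_def by (meson continuous_on_subset subsetD)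

lemma C1_on_cong:
  assumes "open U" "\<And>x. x \<in> U \<Longrightarrow> f x = g x" "C1_on U f"
  shows "C1_on U g"
proof -
  obtain f' where f': "\<And>x. x \<in> U \<Longrightarrow> (f has_derivative blinfun_apply (f' x)) (at x)" "continuous_on U f'"
    using assms(3) unfolding C1_on_def by blast
  have "(g has_derivative blinfun_apply (f' x)) (at x)" if "x \<in> U" for x
    using has_derivative_transform_within_open[OF f'(1)[OF that] assms(1) that] assms(2) by auto
  then show ?thesis unfolding C1_on_def using f'(2) by blast
qed

lemma C1_on_bounded_linear: "bounded_linear f \<Longrightarrow> C1_on U f"
  unfolding C1_on_def
  by (rule exI[of _ "\<lambda>_. Blinfun f"]) (auto simp: bounded_linear_Blinfun_apply bounded_linear_imp_has_derivative)

lemma C1_on_const: "C1_on U (\<lambda>x. c)"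
  unfolding C1_on_def by (rule exI[of _ "\<lambda>_. 0"]) (auto simp: zero_blinfun.rep_eq)

lemma C1_on_ident: "C1_on U (\<lambda>x. x)"
  by (rule C1_on_bounded_linear) (rule bounded_linear_ident)

lemma C1_on_compose:
  assumes "C1_on U f" "C1_on V g" "\<And>x. x \<in> U \<Longrightarrow> f x \<in> V"
  shows "C1_on U (\<lambda>x. g (f x))"
proof -
  obtain f' where f': "\<And>x. x \<in> U \<Longrightarrow> (f has_derivative blinfun_apply (f' x)) (at x)" "continuous_on U f'"
    using assms(1) unfolding C1_on_def by blast
  obtain g' where g': "\<And>x. x \<in> V \<Longrightarrow> (g has_derivative blinfun_apply (g' x)) (at x)" "continuous_on V g'"
    using assms(2) unfolding C1_on_def by blast
  have "continuous_on U (\<lambda>x. g' (f x))"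
    by (rule continuous_on_compose2[OF g'(2) C1_on_continuous_on[OF assms(1)]]) (use assms(3) in auto)
  then have cont: "continuous_on U (\<lambda>x. g' (f x) o\<^sub>L f' x)"
    using f'(2) by (rule bounded_bilinear.continuous_on[OF bounded_bilinear_blinfun_compose])
  have der: "((\<lambda>x. g (f x)) has_derivative blinfun_apply (g' (f x) o\<^sub>L f' x)) (at x)" if "x \<in> U" for x
    unfolding blinfun_compose.rep_eq o_def
    by (rule has_derivative_compose[OF f'(1)[OF that] g'(1)[OF assms(3)[OF that]]])
  show ?thesis unfolding C1_on_def
    by (rule exI, rule conjI, rule ballI, erule der, rule cont)
qed

lemma C1_on_linear_compose:
  "bounded_linear g \<Longrightarrow> C1_on U f \<Longrightarrow> C1_on U (\<lambda>x. g (f x))"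
  by (rule C1_on_compose[where V=UNIV]) (auto intro: C1_on_bounded_linear)

lemma C1_on_add:
  fixes f g :: "'a::euclidean_space \<Rightarrow> 'b::real_normed_vector"
  assumes "C1_on U f" "C1_on U g"
  shows "C1_on U (\<lambda>x. f x + g x)"
proof (rule C1_onI)
  show "((\<lambda>x. f x + g x) has_derivative
      (\<lambda>v. frechet_derivative f (at x) v + frechet_derivative g (at x) v)) (at x)" if "x \<in> U" for x
    by (intro has_derivative_add C1_on_has_derivative[OF _ that] assms)
  show "continuous_on U (\<lambda>x. frechet_derivative f (at x) v + frechet_derivative g (at x) v)" for v
    by (intro continuous_on_add C1_on_continuous_derivative assms continuous_on_const)
qed

lemma C1_on_minus:
  fixes f :: "'a::euclidean_space \<Rightarrow> 'b::real_normed_vector"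
  shows "C1_on U f \<Longrightarrow> C1_on U (\<lambda>x. - f x)"
  by (rule C1_on_linear_compose) (auto intro: bounded_linear_minus bounded_linear_ident)

lemma C1_on_diff:
  fixes f g :: "'a::euclidean_space \<Rightarrow> 'b::real_normed_vector"
  assumes "C1_on U f" "C1_on U g"
  shows "C1_on U (\<lambda>x. f x - g x)"
  using C1_on_add[OF assms(1) C1_on_minus[OF assms(2)]] by simp

lemma C1_on_bilinear:
  fixes f :: "'a::euclidean_space \<Rightarrow> 'b::real_normed_vector" and g :: "'a \<Rightarrow> 'c::real_normed_vector"
  assumes "bounded_bilinear p" "C1_on U f" "C1_on U g"
  shows "C1_on U (\<lambda>x. p (f x) (g x))"
proof (rule C1_onI)
  interpret bounded_bilinear p by fact
  show "((\<lambda>x. p (f x) (g x)) has_derivative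
      (\<lambda>v. p (f x) (frechet_derivative g (at x) v) + p (frechet_derivative f (at x) v) (g x))) (at x)"
    if "x \<in> U" for x
    by (intro FDERIV C1_on_has_derivative[OF _ that] assms)
  show "continuous_on U (\<lambda>x. p (f x) (frechet_derivative g (at x) v) + p (frechet_derivative f (at x) v) (g x))" for v
    by (intro continuous_on_add continuous_on C1_on_continuous_derivative C1_on_continuous_on assms continuous_on_const)
qed

lemmas C1_on_mult = C1_on_bilinear[OF bounded_bilinear_mult]
lemmas C1_on_scaleR = C1_on_bilinear[OF bounded_bilinear_scaleR]

lemma C1_on_vec_lambda:
  fixes f :: "'i::finite \<Rightarrow> 'a::euclidean_space \<Rightarrow> 'b::euclidean_space"
  assumes "\<And>i. C1_on U (f i)"
  shows "C1_on U (\<lambda>x. \<chi> i. f i x)"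
proof (rule C1_onI)
  show "((\<lambda>x. \<chi> i. f i x) has_derivative (\<lambda>v. \<chi> i. frechet_derivative (f i) (at x) v)) (at x)"
    if "x \<in> U" for x
    unfolding has_derivative_componentwise_within[of "\<lambda>x. \<chi> i. f i x"]
    by (auto simp: Basis_vec_def inner_axis
        intro!: has_derivative_inner_left C1_on_has_derivative[OF _ that] assms)
  show "continuous_on U (\<lambda>x. \<chi> i. frechet_derivative (f i) (at x) v)" for v
    by (intro continuous_on_vec_lambda C1_on_continuous_derivative assms continuous_on_const)
qed

lemma C1_on_vec_nth: "C1_on U f \<Longrightarrow> C1_on U (\<lambda>x. f x $ i)"
  by (rule C1_on_linear_compose) (rule bounded_linear_vec_nth)

lemma frechet_derivative_eq_0_open:
  fixes f :: "'a::real_normed_vector \<Rightarrow> 'b::real_normed_vector"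
  assumes "open S" "x \<in> S" "\<And>z. z \<in> S \<Longrightarrow> f z = 0"
  shows "frechet_derivative f (at x) v = 0"
proof -
  have "(f has_derivative (\<lambda>_. 0)) (at x)"
    by (rule has_derivative_transform_within_open[OF has_derivative_const[of 0], where s=S])
      (use assms in auto)
  then show ?thesis using frechet_derivative_at by metis
qed

text \<open>Test fields are first built on an open set where a defining function of the boundary is available;
this makes them global.\<close>

lemma C1_on_extend_by_zero:
  fixes f :: "'a::euclidean_space \<Rightarrow> 'b::real_normed_vector"
  assumes "open V" "C1_on V f" "closed K" "K \<subseteq> V" "\<And>x. x \<in> V - K \<Longrightarrow> f x = 0"
  shows "C1_on UNIV (\<lambda>x. if x \<in> V then f x else 0)"
proof (rule C1_onI)
  let ?g = "\<lambda>x. if x \<in> V then f x else 0"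
  let ?D = "\<lambda>x v. if x \<in> V then frechet_derivative f (at x) v else 0"
  have opK: "open (- K)" using assms(3) by auto
  have zero: "frechet_derivative f (at x) v = 0" if "x \<in> V" "x \<notin> K" for x v
    by (rule frechet_derivative_eq_0_open[of "V - K"]) (use assms that in auto)
  show "(?g has_derivative ?D x) (at x)" for x
  proof (cases "x \<in> V")
    case True
    have "(?g has_derivative frechet_derivative f (at x)) (at x)"
      by (rule has_derivative_transform_within_open[OF C1_on_has_derivative[OF assms(2) True] assms(1) True]) auto
    then show ?thesis using True by simp
  next
    case False
    have "(?g has_derivative (\<lambda>_. 0)) (at x)"
      by (rule has_derivative_transform_within_open[OF has_derivative_const[of 0] opK])
        (use assms False in auto)
    then show ?thesis using False by simp
  qed
  show "continuous_on UNIV (\<lambda>x. ?D x v)" for v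
  proof -
    have "continuous_on V (\<lambda>x. ?D x v)"
      by (rule continuous_on_eq[OF C1_on_continuous_derivative[OF assms(2) continuous_on_const[of _ v]]]) auto
    moreover have "continuous_on (-K) (\<lambda>x. ?D x v)"
      by (rule continuous_on_eq[OF continuous_on_const[of _ 0]]) (use zero in auto)
    ultimately have "continuous_on (V \<union> -K) (\<lambda>x. ?D x v)"
      using assms(1) opK by (simp add: continuous_on_open_Un)
    moreover have "V \<union> -K = UNIV" using assms(4) by auto
    ultimately show ?thesis by simp
  qed
qed

section \<open>Smooth cutoff functions\<close>

text \<open>The cubic \<open>3 t\<^sup>2 - 2 t\<^sup>3\<close> between \<open>0\<close> and \<open>1\<close>: the simplest monotone \<open>C\<^sup>1\<close> transition.\<close>

definition smoothstep :: "real \<Rightarrow> real" where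
  "smoothstep t = (if t \<le> 0 then 0 else if t \<ge> 1 then 1 else t\<^sup>2 * (3 - 2 * t))"

definition smoothstep_deriv :: "real \<Rightarrow> real" where
  "smoothstep_deriv t = (if t \<le> 0 then 0 else if t \<ge> 1 then 0 else 6 * t * (1 - t))"

lemma smoothstep_deriv_bounds: "0 \<le> smoothstep_deriv t" "smoothstep_deriv t \<le> 3/2"
proof -
  show "0 \<le> smoothstep_deriv t" by (auto simp: smoothstep_deriv_def)
  have "6 * t * (1 - t) = 3/2 - 6 * (t - 1/2)^2" by (simp add: power2_eq_square algebra_simps)
  also have "\<dots> \<le> 3/2" by simp
  finally show "smoothstep_deriv t \<le> 3/2" by (auto simp: smoothstep_deriv_def)
qed

lemma smoothstep_eq_0: "t \<le> 0 \<Longrightarrow> smoothstep t = 0"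
  and smoothstep_eq_1: "t \<ge> 1 \<Longrightarrow> smoothstep t = 1"
  by (auto simp: smoothstep_def)

lemma smoothstep_bounds: "0 \<le> smoothstep t" "smoothstep t \<le> 1"
proof -
  show "0 \<le> smoothstep t" by (auto simp: smoothstep_def)
  have "t\<^sup>2 * (3 - 2 * t) \<le> 1" if "0 < t" "t < 1"
  proof -
    have "1 - t\<^sup>2 * (3 - 2 * t) = (1 - t)\<^sup>2 * (1 + 2 * t)" by (simp add: power2_eq_square algebra_simps)
    also have "\<dots> \<ge> 0" using that by simp
    finally show ?thesis by simp
  qed
  then show "smoothstep t \<le> 1" by (auto simp: smoothstep_def)
qed

lemma smoothstep_has_real_derivative:
  "(smoothstep has_real_derivative smoothstep_deriv t) (at t)"
proof -
  let ?p = "\<lambda>t::real. t\<^sup>2 * (3 - 2 * t)"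
  let ?q = "\<lambda>t::real. if t \<in> {..1} then ?p t else 1"
  have "(?p has_real_derivative 6 * t * (1 - t)) (at t within S)" for t S
    by (auto intro!: derivative_eq_intros simp: power2_eq_square algebra_simps)
  then have p: "(?p has_derivative (\<lambda>h. 6 * t * (1 - t) * h)) (at t within S)" for t S
    unfolding has_field_derivative_def .
  have U1: "{..1} \<union> {1..} = (UNIV::real set)" by auto
  have "(?q has_derivative
     (if t \<in> {..1} then (\<lambda>h. 6 * t * (1 - t) * h) else (\<lambda>h. 0))) (at t within {..1} \<union> {1..})" for t
    by (rule has_derivative_If_within_closures[where f' = "\<lambda>t h. 6 * t * (1 - t) * h" and g' = "\<lambda>t h. 0", OF p])
      (auto intro!: has_derivative_const)
  then have "(?q has_derivative
     (if t \<in> {..1} then (\<lambda>h. 6 * t * (1 - t) * h) else (\<lambda>h. 0))) (at t)" for t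
    unfolding U1 .
  then have q: "(?q has_derivative
     (if t \<in> {..1} then (\<lambda>h. 6 * t * (1 - t) * h) else (\<lambda>h. 0))) (at t within S)" for t S
    by (rule has_derivative_at_withinI)
  have main: "((\<lambda>t. if t \<in> {..0} then 0 else ?q t) has_derivative
     (if t \<in> {..0} then (\<lambda>h. 0) else (if t \<in> {..1} then (\<lambda>h. 6 * t * (1 - t) * h) else (\<lambda>h. 0))))
     (at t within {..0} \<union> {0..})"
    by (rule has_derivative_If_within_closures[where f' = "\<lambda>t h. 0" and
         g' = "\<lambda>t. if t \<in> {..1} then (\<lambda>h. 6 * t * (1 - t) * h) else (\<lambda>h. 0)", OF has_derivative_const q])
      auto
  have univ: "{..0} \<union> {0..} = (UNIV::real set)" by auto
  have fn: "(\<lambda>t. if t \<in> {..0} then 0 else ?q t) = smoothstep"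
    by (auto simp: smoothstep_def)
  have der: "(if t \<in> {..0} then (\<lambda>h. 0) else (if t \<in> {..1} then (\<lambda>h. 6 * t * (1 - t) * h) else (\<lambda>h. 0)))
      = (*) (smoothstep_deriv t)"
    by (auto simp: smoothstep_deriv_def fun_eq_iff)
  show ?thesis using main unfolding has_field_derivative_def univ fn der .
qed

lemma smoothstep_deriv_eq: "smoothstep_deriv t = max 0 (6 * t * (1 - t))"
  by (auto simp: smoothstep_deriv_def max_def mult_le_0_iff zero_le_mult_iff not_le)

lemma C1_on_smoothstep: "C1_on UNIV smoothstep"
proof (rule C1_onI)
  show "(smoothstep has_derivative (*) (smoothstep_deriv t)) (at t)" for t
    using smoothstep_has_real_derivative[of t] by (simp add: has_field_derivative_def)
  show "continuous_on UNIV (\<lambda>x. smoothstep_deriv x * v)" for v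
    unfolding smoothstep_deriv_eq by (intro continuous_intros)
qed

text \<open>The squared distance keeps this differentiable at the centre; the factor \<open>4/3\<close> puts the argument of
the step above \<open>1\<close> exactly on the ball of half the radius.\<close>

definition bump :: "'a::euclidean_space \<Rightarrow> real \<Rightarrow> 'a \<Rightarrow> real" where
  "bump c r x = smoothstep (4/3 * (1 - (x - c) \<bullet> (x - c) / r\<^sup>2))"

lemma bump_bounds: "0 \<le> bump c r x" "bump c r x \<le> 1"
  by (simp_all add: bump_def smoothstep_bounds)

lemma bump_eq_1:
  assumes "r > 0" "x \<in> ball c (r/2)"
  shows "bump c r x = 1"
proof -
  have "norm (x - c) \<le> r/2" using assms by (simp add: dist_norm norm_minus_commute)
  then have "(norm (x - c))\<^sup>2 \<le> (r/2)\<^sup>2" by (intro power_mono) auto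
  then have "(x - c) \<bullet> (x - c) / r\<^sup>2 \<le> (r/2)\<^sup>2 / r\<^sup>2"
    by (intro divide_right_mono) (auto simp: power2_norm_eq_inner)
  also have "(r/2)\<^sup>2 / r\<^sup>2 = 1/4" using assms by (simp add: power_divide)
  finally have "(x - c) \<bullet> (x - c) / r\<^sup>2 \<le> 1/4" .
  moreover have "1 \<le> 4/3 * (1 - q)" if "q \<le> 1/4" for q :: real using that by simp
  ultimately have "1 \<le> 4/3 * (1 - (x - c) \<bullet> (x - c) / r\<^sup>2)" by blast
  then show ?thesis unfolding bump_def by (rule smoothstep_eq_1)
qed

lemma bump_eq_0:
  assumes "r > 0" "x \<notin> ball c r"
  shows "bump c r x = 0"
proof -
  have "norm (x - c) \<ge> r" using assms by (simp add: dist_norm norm_minus_commute)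
  then have "(norm (x - c))\<^sup>2 \<ge> r\<^sup>2" using assms by (intro power_mono) auto
  then have "(x - c) \<bullet> (x - c) / r\<^sup>2 \<ge> 1"
    using assms by (simp add: power2_norm_eq_inner[symmetric] field_simps)
  then show ?thesis unfolding bump_def by (intro smoothstep_eq_0) auto
qed

lemma bump_has_derivative:
  "(bump c r has_derivative
     (\<lambda>v. smoothstep_deriv (4/3 * (1 - (x - c) \<bullet> (x - c) / r\<^sup>2)) * (- (8/3) * ((x - c) \<bullet> v) / r\<^sup>2))) (at x)"
proof -
  have *: "((\<lambda>x. 4/3 * (1 - (x - c) \<bullet> (x - c) / r\<^sup>2)) has_derivative
     (\<lambda>v. (- (8/3) * ((x - c) \<bullet> v) / r\<^sup>2))) (at x)"
    unfolding divide_inverse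
    by (auto intro!: derivative_eq_intros simp: inner_commute algebra_simps diff_divide_distrib fun_eq_iff)
  show ?thesis
    unfolding bump_def[abs_def]
    using has_derivative_compose[OF * smoothstep_has_real_derivative[unfolded has_field_derivative_def]]
    by simp
qed

lemma C1_on_bump: "C1_on U (bump c r)"
proof (rule C1_onI[OF bump_has_derivative])
  show "continuous_on U (\<lambda>x. smoothstep_deriv (4/3 * (1 - (x - c) \<bullet> (x - c) / r\<^sup>2)) * (- (8/3) * ((x - c) \<bullet> v) / r\<^sup>2))" for v
    unfolding smoothstep_deriv_eq divide_inverse by (intro continuous_intros)
qed

text \<open>The slope is of order \<open>1/r\<close> on a ball of volume of order \<open>r\<^sup>N\<close>. A bump therefore costs \<open>r\<^bsup>N-1\<^esup>\<close> in the
flux balance, which is why edges of codimension two are negligible.\<close>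

lemma bump_derivative_bound:
  assumes "r > 0"
  shows "norm (frechet_derivative (bump c r) (at x) v) \<le> 4 / r * norm v * indicator (cball c r) x"
proof -
  let ?s = "smoothstep_deriv (4/3 * (1 - (x - c) \<bullet> (x - c) / r\<^sup>2))"
  have eq: "frechet_derivative (bump c r) (at x) v = ?s * (- (8/3) * ((x - c) \<bullet> v) / r\<^sup>2)"
    using frechet_derivative_at[OF bump_has_derivative] by metis
  show ?thesis
  proof (cases "x \<in> cball c r")
    case True
    then have n: "norm (x - c) \<le> r" by (simp add: dist_norm norm_minus_commute)
    have "\<bar>(x - c) \<bullet> v\<bar> \<le> norm (x - c) * norm v" by (rule Cauchy_Schwarz_ineq2)
    also have "\<dots> \<le> r * norm v" using n by (rule mult_right_mono) simp
    finally have a: "\<bar>(x - c) \<bullet> v\<bar> \<le> r * norm v" .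
    have "\<bar>?s * (- (8/3) * ((x - c) \<bullet> v) / r\<^sup>2)\<bar> = ?s * ((8/3) * \<bar>(x - c) \<bullet> v\<bar> / r\<^sup>2)"
      using smoothstep_deriv_bounds by (simp add: abs_mult)
    also have "\<dots> \<le> 3/2 * ((8/3) * (r * norm v) / r\<^sup>2)"
      using smoothstep_deriv_bounds a by (intro mult_mono divide_right_mono) auto
    also have "\<dots> = 4 / r * norm v" using assms by (simp add: power2_eq_square)
    finally show ?thesis using True eq by simp
  next
    case False
    then have "norm (x - c) \<ge> r" by (simp add: dist_norm norm_minus_commute)
    then have "(norm (x - c))\<^sup>2 \<ge> r\<^sup>2" using assms by (intro power_mono) auto
    then have "(x - c) \<bullet> (x - c) / r\<^sup>2 \<ge> 1"
      using assms by (simp add: power2_norm_eq_inner[symmetric] field_simps)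
    then have "?s = 0" by (simp add: smoothstep_deriv_def)
    then show ?thesis using eq assms by simp
  qed
qed

section \<open>Divergence of compactly supported fields\<close>

definition vdiv :: "(real^'n \<Rightarrow> real^'n) \<Rightarrow> real^'n \<Rightarrow> real" where
  "vdiv P x = (\<Sum>j\<in>UNIV. frechet_derivative P (at x) (axis j 1) $ j)"

lemma vdiv_eqI:
  assumes "(P has_derivative P') (at x)"
  shows "vdiv P x = (\<Sum>j\<in>UNIV. P' (axis j 1) $ j)"
  unfolding vdiv_def using frechet_derivative_at[OF assms] by simp

lemma vdiv_cong_open:
  assumes "open S" "x \<in> S" "\<And>z. z \<in> S \<Longrightarrow> P z = Q z" "P differentiable (at x)"
  shows "vdiv Q x = vdiv P x"
proof -
  have P: "(P has_derivative frechet_derivative P (at x)) (at x)"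
    using assms(4) frechet_derivative_works by blast
  have "(Q has_derivative frechet_derivative P (at x)) (at x)"
    by (rule has_derivative_transform_within_open[OF P assms(1,2)]) (use assms(3) in auto)
  then have "frechet_derivative Q (at x) = frechet_derivative P (at x)"
    using frechet_derivative_at by metis
  then show ?thesis by (simp add: vdiv_def)
qed

lemma linear_axis_expansion:
  fixes f :: "real^'n \<Rightarrow> 'b::real_vector"
  assumes "linear f"
  shows "f v = (\<Sum>j\<in>UNIV. v $ j *\<^sub>R f (axis j 1))"
proof -
  have "f v = f (\<Sum>j\<in>UNIV. v $ j *s axis j 1)" by (simp add: basis_expansion)
  also have "\<dots> = (\<Sum>j\<in>UNIV. v $ j *\<^sub>R f (axis j 1))"
    by (simp add: linear_sum[OF assms] linear_scale[OF assms] scalar_mult_eq_scaleR)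
  finally show ?thesis .
qed

lemma vdiv_scaleR:
  assumes "\<phi> differentiable (at x)" "P differentiable (at x)"
  shows "vdiv (\<lambda>x. \<phi> x *\<^sub>R P x) x = \<phi> x * vdiv P x + frechet_derivative \<phi> (at x) (P x)"
proof -
  have d: "(\<phi> has_derivative frechet_derivative \<phi> (at x)) (at x)" "(P has_derivative frechet_derivative P (at x)) (at x)"
    using assms frechet_derivative_works by blast+
  have lin: "linear (frechet_derivative \<phi> (at x))" using has_derivative_linear[OF d(1)] .
  have "vdiv (\<lambda>x. \<phi> x *\<^sub>R P x) x =
      (\<Sum>j\<in>UNIV. (\<phi> x *\<^sub>R frechet_derivative P (at x) (axis j 1) + frechet_derivative \<phi> (at x) (axis j 1) *\<^sub>R P x) $ j)"
    by (rule vdiv_eqI) (intro has_derivative_scaleR d)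
  also have "\<dots> = \<phi> x * vdiv P x + (\<Sum>j\<in>UNIV. P x $ j *\<^sub>R frechet_derivative \<phi> (at x) (axis j 1))"
    by (simp add: vdiv_def sum.distrib sum_distrib_left mult.commute)
  also have "(\<Sum>j\<in>UNIV. P x $ j *\<^sub>R frechet_derivative \<phi> (at x) (axis j 1)) = frechet_derivative \<phi> (at x) (P x)"
    using linear_axis_expansion[OF lin, of "P x"] by simp
  finally show ?thesis .
qed

lemma C1_on_differentiable: "C1_on U f \<Longrightarrow> x \<in> U \<Longrightarrow> f differentiable (at x)"
  using C1_on_has_derivative differentiableI by blast

lemma continuous_on_vdiv: "C1_on U P \<Longrightarrow> continuous_on U (vdiv P)"
  unfolding vdiv_def[abs_def]
  by (intro continuous_on_sum continuous_on_component C1_on_continuous_derivative continuous_on_const)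

lemma lborel_integral_translation:
  fixes f :: "'a::euclidean_space \<Rightarrow> real"
  assumes "integrable lborel f"
  shows "integrable lborel (\<lambda>x. f (a + x))" "(\<integral>x. f (a + x) \<partial>lborel) = (\<integral>x. f x \<partial>lborel)"
proof -
  have m: "(\<lambda>x. a + x) \<in> measurable lborel borel" by simp
  have f: "f \<in> borel_measurable borel" using assms by auto
  show "integrable lborel (\<lambda>x. f (a + x))"
    using integrable_distr[OF m, of f] assms lborel_distr_plus[of a] by simp
  show "(\<integral>x. f (a + x) \<partial>lborel) = (\<integral>x. f x \<partial>lborel)"
    using integral_distr[OF m f] lborel_distr_plus[of a] by simp
qed

lemma directional_difference_quotient:
  fixes f :: "'a::real_normed_vector \<Rightarrow> real"
  assumes "(f has_derivative f') (at x)"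
  shows "(\<lambda>n. real (Suc n) * (f (inverse (real (Suc n)) *\<^sub>R v + x) - f x)) \<longlonglongrightarrow> f' v"
proof -
  have lin: "linear f'" using assms has_derivative_linear by blast
  have d: "((\<lambda>t. f (t *\<^sub>R v + x)) has_derivative (\<lambda>t. f' (t *\<^sub>R v))) (at 0)"
    by (rule has_derivative_compose[where g=f, of "\<lambda>t. t *\<^sub>R v + x" "\<lambda>t. t *\<^sub>R v"])
      (use assms in \<open>auto intro!: derivative_eq_intros\<close>)
  then have "((\<lambda>t. f (t *\<^sub>R v + x)) has_real_derivative f' v) (at 0)"
    unfolding has_field_derivative_def by (simp add: linear_scale[OF lin] mult.commute[of _ "f' v"])
  then have "(\<lambda>h. (f (h *\<^sub>R v + x) - f x) / h) \<midarrow>0\<rightarrow> f' v"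
    unfolding DERIV_def by simp
  moreover have "filterlim (\<lambda>n. inverse (real (Suc n))) (at 0) sequentially"
    by (rule filterlim_atI) (use LIMSEQ_inverse_real_of_nat in auto)
  ultimately have "(\<lambda>n. (f (inverse (real (Suc n)) *\<^sub>R v + x) - f x) / inverse (real (Suc n))) \<longlonglongrightarrow> f' v"
    by (rule filterlim_compose)
  then show ?thesis by (simp add: divide_inverse mult.commute)
qed

text \<open>Translation invariance of Lebesgue measure makes every difference quotient of \<open>f\<close> integrate to \<open>0\<close>;
since \<open>f\<close> is Lipschitz with compact support, dominated convergence carries this to the derivative.\<close>

lemma integral_derivative_compact_support:
  fixes f :: "'a::euclidean_space \<Rightarrow> real"
  assumes f: "C1_on UNIV f" and K: "compact K" and supp: "\<And>x. x \<notin> K \<Longrightarrow> f x = 0"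
  shows "integrable lborel (\<lambda>x. frechet_derivative f (at x) v)"
    "(\<integral>x. frechet_derivative f (at x) v \<partial>lborel) = 0"
proof -
  let ?D = "\<lambda>x. frechet_derivative f (at x)"
  have der: "(f has_derivative ?D x) (at x)" for x
    using C1_on_has_derivative[OF f] by simp
  have zero: "?D x v = 0" if "x \<notin> K" for x v
    by (rule frechet_derivative_eq_0_open[of "- K"]) (use that supp K compact_imp_closed in auto)
  obtain L where L: "L \<ge> 0" "\<And>x v. x \<in> K \<Longrightarrow> norm (?D x v) \<le> L * norm v"
    using C1_on_linear_bound[OF f K] by auto
  have L': "norm (?D x v) \<le> L * norm v" for x v
    using L zero[of x v] by (cases "x \<in> K") auto
  have Lip: "norm (f y - f x) \<le> L * norm (y - x)" for x y
  proof (rule differentiable_bound[OF convex_UNIV, where f'="?D"])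
    show "onorm (?D x) \<le> L" for x by (rule onorm_le) (rule L')
  qed (simp_all add: der)
  have cf: "continuous_on UNIV f" by (rule C1_on_continuous_on[OF f])
  have int: "integrable lborel f"
  proof -
    have "integrable lborel (\<lambda>x. indicator K x *\<^sub>R f x)"
      by (rule borel_integrable_compact[OF K continuous_on_subset[OF cf]]) simp
    moreover have "(\<lambda>x. indicator K x *\<^sub>R f x) = f"
      using supp by (auto simp: fun_eq_iff indicator_def)
    ultimately show ?thesis by simp
  qed
  obtain R where R: "K \<subseteq> cball 0 R"
    using compact_imp_bounded[OF K] unfolding bounded_any_center[of K 0] by (metis mem_cball subsetI)
  let ?s = "\<lambda>n x. real (Suc n) * (f (inverse (real (Suc n)) *\<^sub>R v + x) - f x)"
  let ?w = "\<lambda>x. indicator (cball 0 (R + norm v)) x * (L * norm v) :: real"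
  have s_int: "integrable lborel (?s n)" for n
    by (intro integrable_mult_right Bochner_Integration.integrable_diff lborel_integral_translation int)
  have s0: "(\<integral>x. ?s n x \<partial>lborel) = 0" for n
    using lborel_integral_translation[OF int, of "inverse (real (Suc n)) *\<^sub>R v"] int
    by (simp add: Bochner_Integration.integral_diff)
  have meas: "(\<lambda>x. ?D x v) \<in> borel_measurable lborel"
    using borel_measurable_continuous_onI[OF C1_on_continuous_derivative[OF f continuous_on_const[of _ v]]] by simp
  have lim: "(\<lambda>n. ?s n x) \<longlonglongrightarrow> ?D x v" for x
    by (rule directional_difference_quotient[OF der])
  have w: "integrable lborel ?w"
    by (intro integrable_mult_left integrable_real_indicator) (auto simp: emeasure_lborel_cball_finite[unfolded infinity_ennreal_def])
  have bnd: "norm (?s n x) \<le> ?w x" for n x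
  proof (cases "x \<in> cball 0 (R + norm v)")
    case True
    have "norm (?s n x) = real (Suc n) * norm (f (inverse (real (Suc n)) *\<^sub>R v + x) - f x)"
      by (simp add: abs_mult)
    also have "\<dots> \<le> real (Suc n) * (L * norm (inverse (real (Suc n)) *\<^sub>R v + x - x))"
      by (intro mult_left_mono Lip) auto
    also have "\<dots> = L * norm v" by (simp add: field_simps)
    finally show ?thesis using True by simp
  next
    case False
    have "norm (inverse (real (Suc n)) *\<^sub>R v) \<le> norm v"
    proof -
      have "inverse (real (Suc n)) \<le> 1" by (simp add: field_simps)
      then have "inverse (real (Suc n)) * norm v \<le> 1 * norm v" by (intro mult_right_mono) auto
      then show ?thesis by simp
    qed
    moreover have "norm x \<le> norm (inverse (real (Suc n)) *\<^sub>R v + x) + norm (inverse (real (Suc n)) *\<^sub>R v)"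
      by (metis add.commute norm_add_leD norm_minus_commute add_diff_cancel_left' norm_triangle_sub)
    moreover have "R + norm v < norm x" using False by simp
    ultimately have "R < norm x" "R < norm (inverse (real (Suc n)) *\<^sub>R v + x)"
      using norm_ge_zero[of v] by linarith+
    then have "x \<notin> K" "inverse (real (Suc n)) *\<^sub>R v + x \<notin> K"
      using R by (metis mem_cball_0 not_le subsetD)+
    then show ?thesis using supp False by simp
  qed
  show "integrable lborel (\<lambda>x. ?D x v)"
    by (rule integrable_dominated_convergence[where s="?s" and w="?w"])
      (use meas s_int w lim bnd in auto)
  have "(\<lambda>n. \<integral>x. ?s n x \<partial>lborel) \<longlonglongrightarrow> (\<integral>x. ?D x v \<partial>lborel)"
    by (rule integral_dominated_convergence[where w="?w"])
      (use meas s_int w lim bnd in auto)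
  then show "(\<integral>x. ?D x v \<partial>lborel) = 0"
    unfolding s0 by (simp add: LIMSEQ_const_iff)
qed

lemma integral_vdiv_compact_support:
  fixes P :: "real^'n \<Rightarrow> real^'n"
  assumes P: "C1_on UNIV P" and K: "compact K" and supp: "\<And>x. x \<notin> K \<Longrightarrow> P x = 0"
  shows "integrable lborel (vdiv P)" "(\<integral>x. vdiv P x \<partial>lborel) = 0"
proof -
  have c: "frechet_derivative P (at x) v $ j = frechet_derivative (\<lambda>x. P x $ j) (at x) v" for x v j
  proof -
    have "((\<lambda>x. P x $ j) has_derivative (\<lambda>v. frechet_derivative P (at x) v $ j)) (at x)"
      by (rule bounded_linear.has_derivative[OF bounded_linear_vec_nth C1_on_has_derivative[OF P]]) simp
    then show ?thesis using frechet_derivative_at by metis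
  qed
  have "integrable lborel (\<lambda>x. frechet_derivative P (at x) (axis j 1) $ j) \<and>
      (\<integral>x. frechet_derivative P (at x) (axis j 1) $ j \<partial>lborel) = 0" for j
    unfolding c using integral_derivative_compact_support[OF C1_on_vec_nth[OF P] K] supp by auto
  then show "integrable lborel (vdiv P)" "(\<integral>x. vdiv P x \<partial>lborel) = 0"
    unfolding vdiv_def[abs_def] by (auto intro: Bochner_Integration.integrable_sum)
qed

lemma integral_vdiv_compact_in_open:
  fixes P :: "real^'n \<Rightarrow> real^'n" and \<phi> :: "real^'n \<Rightarrow> real"
  assumes V: "open V" and P: "C1_on V P" and \<phi>: "C1_on V \<phi>"
    and K: "compact K" "K \<subseteq> V" and supp: "\<And>x. x \<in> V - K \<Longrightarrow> \<phi> x = 0"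
  shows "integrable lborel (\<lambda>x. indicator V x * (\<phi> x * vdiv P x + frechet_derivative \<phi> (at x) (P x)))" (is ?int)
    and "(\<integral>x. indicator V x * (\<phi> x * vdiv P x + frechet_derivative \<phi> (at x) (P x)) \<partial>lborel) = 0" (is ?zero)
proof -
  let ?Q = "\<lambda>x. \<phi> x *\<^sub>R P x"
  let ?F = "\<lambda>x. if x \<in> V then ?Q x else 0"
  have Q: "C1_on V ?Q" by (rule C1_on_scaleR[OF \<phi> P])
  have F: "C1_on UNIV ?F"
    by (rule C1_on_extend_by_zero[OF V Q compact_imp_closed[OF K(1)] K(2)]) (use supp in auto)
  have "integrable lborel (\<lambda>x. vdiv ?F x)" "(\<integral>x. vdiv ?F x \<partial>lborel) = 0"
    by (rule integral_vdiv_compact_support[OF F K(1)]; use supp in auto)+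
  moreover have "vdiv ?F x = indicator V x * (\<phi> x * vdiv P x + frechet_derivative \<phi> (at x) (P x))" for x
  proof (cases "x \<in> V")
    case True
    have "vdiv ?F x = vdiv ?Q x"
      by (rule vdiv_cong_open[OF V True]) (auto intro: C1_on_differentiable[OF Q True])
    also have "\<dots> = \<phi> x * vdiv P x + frechet_derivative \<phi> (at x) (P x)"
      by (rule vdiv_scaleR[OF C1_on_differentiable[OF \<phi> True] C1_on_differentiable[OF P True]])
    finally show ?thesis using True by simp
  next
    case False
    have "frechet_derivative ?F (at x) v = 0" for v
      by (rule frechet_derivative_eq_0_open[of "- K"])
        (use False K compact_imp_closed[OF K(1)] supp in auto)
    then show ?thesis using False by (simp add: vdiv_def)
  qed
  ultimately show ?int ?zero by simp_all
qed

section \<open>The divergence tested against cutoff functions\<close>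

lemma integrable_continuous_bounded_on_open:
  fixes f :: "'a::euclidean_space \<Rightarrow> real"
  assumes "open S" "bounded S" "continuous_on S f" "\<And>x. x \<in> S \<Longrightarrow> \<bar>f x\<bar> \<le> B"
  shows "integrable lborel (\<lambda>x. indicator S x * f x)"
proof (rule Bochner_Integration.integrable_bound)
  show "integrable lborel (\<lambda>x. indicator S x * B)"
    using emeasure_bounded_finite[OF assms(2)] assms(1)
    by (intro integrable_mult_left integrable_real_indicator) auto
  show "(\<lambda>x. indicator S x * f x) \<in> borel_measurable lborel"
    using borel_measurable_continuous_on_indicator[OF _ assms(3)] assms(1) by simp
  show "AE x in lborel. norm (indicator S x * f x) \<le> norm (indicator S x * B)"
    using assms(4) by (intro AE_I2) (fastforce simp: indicator_def)
qed

text \<open>The setting of the divergence inequality. Of the derivatives of \<open>P\<close> only the divergence is bounded up to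
the boundary: the second derivatives of an equilibrium may blow up there, while the divergence of its
energy-momentum field stays bounded.\<close>

locale bounded_field =
  fixes S :: "(real^'n) set" and P :: "real^'n \<Rightarrow> real^'n" and M :: real
  assumes open_S: "open S" and bounded_S: "bounded S"
    and C1_P: "C1_on S P"
    and P_bound: "\<And>x. x \<in> S \<Longrightarrow> norm (P x) \<le> M"
    and div_bound: "\<And>x. x \<in> S \<Longrightarrow> \<bar>vdiv P x\<bar> \<le> M"
begin

text \<open>On \<open>S\<close> this is the divergence of \<open>\<phi> P\<close> whenever \<open>\<phi>\<close> is differentiable; it stays meaningful and bounded
for a smooth \<open>\<phi>\<close> that does not vanish at the boundary of \<open>S\<close>.\<close>

definition integrand :: "(real^'n \<Rightarrow> real) \<Rightarrow> real^'n \<Rightarrow> real" where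
  "integrand \<phi> x = \<phi> x * vdiv P x + frechet_derivative \<phi> (at x) (P x)"

definition weak_div :: "(real^'n \<Rightarrow> real) \<Rightarrow> real" where
  "weak_div \<phi> = (\<integral>x. indicator S x * integrand \<phi> x \<partial>lborel)"

lemma continuous_on_integrand: "C1_on S \<phi> \<Longrightarrow> continuous_on S (integrand \<phi>)"
  unfolding integrand_def[abs_def]
  by (intro continuous_on_add continuous_on_mult continuous_on_vdiv[OF C1_P]
      C1_on_continuous_derivative C1_on_continuous_on[OF C1_P] C1_on_continuous_on)

lemma compact_closure_S: "compact (closure S)"
  using bounded_S by (simp add: compact_closure)

lemma bounded_test_function:
  assumes "C1_on UNIV \<phi>"
  obtains B where "B \<ge> 0" "\<And>x. x \<in> S \<Longrightarrow> \<bar>\<phi> x\<bar> \<le> B"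
    "\<And>x v. x \<in> S \<Longrightarrow> \<bar>frechet_derivative \<phi> (at x) v\<bar> \<le> B * norm v"
proof -
  have "bounded (\<phi> ` closure S)"
    by (rule compact_imp_bounded[OF compact_continuous_image[OF _ compact_closure_S]])
      (rule continuous_on_subset[OF C1_on_continuous_on[OF assms]], simp)
  then obtain A where A: "A > 0" "\<And>x. x \<in> closure S \<Longrightarrow> norm (\<phi> x) \<le> A"
    unfolding bounded_pos by auto
  obtain B where B: "B \<ge> 0" "\<And>x v. x \<in> closure S \<Longrightarrow> norm (frechet_derivative \<phi> (at x) v) \<le> B * norm v"
    using C1_on_linear_bound[OF assms compact_closure_S] by auto
  show ?thesis
  proof
    show "A + B \<ge> 0" using A B by simp
    fix x assume "x \<in> S"
    then have x: "x \<in> closure S" using closure_subset by auto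
    show "\<bar>\<phi> x\<bar> \<le> A + B" using A(2)[OF x] B(1) by simp
    have "B * norm v \<le> (A + B) * norm v" for v :: "real^'n"
      using A(1) by (intro mult_right_mono) auto
    then show "\<bar>frechet_derivative \<phi> (at x) v\<bar> \<le> (A + B) * norm v" for v
      using B(2)[OF x, of v] by (metis order_trans real_norm_def)
  qed
qed

lemma integrand_bounded:
  assumes "C1_on UNIV \<phi>"
  obtains B where "\<And>x. x \<in> S \<Longrightarrow> \<bar>integrand \<phi> x\<bar> \<le> B"
proof -
  obtain B where B: "B \<ge> 0" "\<And>x. x \<in> S \<Longrightarrow> \<bar>\<phi> x\<bar> \<le> B"
    "\<And>x v. x \<in> S \<Longrightarrow> \<bar>frechet_derivative \<phi> (at x) v\<bar> \<le> B * norm v"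
    using bounded_test_function[OF assms] by blast
  have "\<bar>integrand \<phi> x\<bar> \<le> B * M + B * M" if x: "x \<in> S" for x
  proof -
    have "\<bar>\<phi> x * vdiv P x\<bar> \<le> B * M"
      unfolding abs_mult using B(1,2) div_bound x by (intro mult_mono) auto
    moreover have "\<bar>frechet_derivative \<phi> (at x) (P x)\<bar> \<le> B * M"
      using B(3)[OF x, of "P x"] mult_left_mono[OF P_bound[OF x] B(1)] by linarith
    ultimately show ?thesis unfolding integrand_def by linarith
  qed
  then show ?thesis using that by blast
qed

lemma integrable_integrand:
  assumes "C1_on UNIV \<phi>"
  shows "integrable lborel (\<lambda>x. indicator S x * integrand \<phi> x)"
proof -
  obtain B where "\<And>x. x \<in> S \<Longrightarrow> \<bar>integrand \<phi> x\<bar> \<le> B"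
    using integrand_bounded[OF assms] by blast
  then show ?thesis
    by (rule integrable_continuous_bounded_on_open[OF open_S bounded_S
          continuous_on_integrand[OF C1_on_subset[OF assms subset_UNIV]]])
qed

lemma integrand_add:
  assumes "C1_on UNIV \<phi>" "C1_on UNIV \<psi>"
  shows "integrand (\<lambda>x. \<phi> x + \<psi> x) x = integrand \<phi> x + integrand \<psi> x"
proof -
  have "((\<lambda>x. \<phi> x + \<psi> x) has_derivative (\<lambda>v. frechet_derivative \<phi> (at x) v + frechet_derivative \<psi> (at x) v)) (at x)"
    by (intro has_derivative_add C1_on_has_derivative[where U=UNIV] assms UNIV_I)
  then have "frechet_derivative (\<lambda>x. \<phi> x + \<psi> x) (at x) = (\<lambda>v. frechet_derivative \<phi> (at x) v + frechet_derivative \<psi> (at x) v)"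
    by (rule frechet_derivative_at[symmetric])
  then show ?thesis by (simp add: integrand_def algebra_simps)
qed

lemma weak_div_add:
  assumes "C1_on UNIV \<phi>" "C1_on UNIV \<psi>"
  shows "weak_div (\<lambda>x. \<phi> x + \<psi> x) = weak_div \<phi> + weak_div \<psi>"
  unfolding weak_div_def integrand_add[OF assms] distrib_left
  by (intro Bochner_Integration.integral_add integrable_integrand assms)

lemma weak_div_eq_0:
  assumes "\<And>x. x \<in> S \<Longrightarrow> \<phi> x = 0"
  shows "weak_div \<phi> = 0"
proof -
  have "indicator S x * integrand \<phi> x = 0" for x
    using assms frechet_derivative_eq_0_open[OF open_S, of x \<phi>]
    by (cases "x \<in> S") (auto simp: integrand_def)
  then show ?thesis unfolding weak_div_def by (simp only: Bochner_Integration.integral_zero)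
qed

text \<open>By the divergence theorem \<open>weak_div \<phi>\<close> would be the integral of \<open>\<phi> P \<bullet> n\<close> over the boundary. The predicate
thus says, without surface measure, that the outward flux of \<open>P\<close> through the boundary inside \<open>B\<close> is
nonpositive.\<close>

definition flux_nonpos_on :: "(real^'n) set \<Rightarrow> bool" where
  "flux_nonpos_on B \<longleftrightarrow> (\<forall>\<phi>. C1_on UNIV \<phi> \<and> (\<forall>x. 0 \<le> \<phi> x) \<and> (\<forall>x. x \<notin> B \<longrightarrow> \<phi> x = 0) \<longrightarrow> weak_div \<phi> \<le> 0)"

lemma flux_nonpos_interior:
  assumes "cball c r \<subseteq> S"
  shows "flux_nonpos_on (ball c r)"
  unfolding flux_nonpos_on_def
proof (intro allI impI, elim conjE)
  fix \<phi> :: "real^'n \<Rightarrow> real"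
  assume \<phi>: "C1_on UNIV \<phi>" "\<forall>x. 0 \<le> \<phi> x" "\<forall>x. x \<notin> ball c r \<longrightarrow> \<phi> x = 0"
  have "weak_div \<phi> = 0"
    unfolding weak_div_def integrand_def
    by (rule integral_vdiv_compact_in_open[OF open_S C1_P C1_on_subset[OF \<phi>(1)] compact_cball assms])
      (use \<phi>(3) ball_subset_cball in auto)
  then show "weak_div \<phi> \<le> 0" by simp
qed

text \<open>Localization: \<open>\<phi> = \<phi> h + \<phi> (1 - h)\<close> with a bump \<open>h\<close> peels off one ball at
a time, and after the last ball nothing is left on \<open>S\<close>.\<close>

lemma weak_div_finite_cover:
  assumes "finite F" "\<And>c r. (c, r) \<in> F \<Longrightarrow> 0 < r \<and> flux_nonpos_on (ball c r)"
    and "C1_on UNIV \<phi>" "\<And>x. 0 \<le> \<phi> x"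
    and "\<And>x. x \<in> S \<Longrightarrow> x \<notin> (\<Union>(c,r)\<in>F. ball c (r/2)) \<Longrightarrow> \<phi> x = 0"
  shows "weak_div \<phi> \<le> 0"
  using assms
proof (induction F arbitrary: \<phi> rule: finite_induct)
  case empty
  then have "weak_div \<phi> = 0" by (intro weak_div_eq_0) auto
  then show ?case by simp
next
  case (insert p F)
  obtain c r where p: "p = (c, r)" by force
  have r: "r > 0" and good: "flux_nonpos_on (ball c r)" using insert.prems(1)[of c r] p by auto
  let ?h = "bump c r"
  have h1: "C1_on UNIV (\<lambda>x. \<phi> x * (1 - ?h x))"
    by (intro C1_on_mult C1_on_diff C1_on_const C1_on_bump insert.prems)
  have h2: "C1_on UNIV (\<lambda>x. \<phi> x * ?h x)"
    by (intro C1_on_mult C1_on_bump insert.prems)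
  have "weak_div \<phi> = weak_div (\<lambda>x. \<phi> x * (1 - ?h x) + \<phi> x * ?h x)"
    by (simp add: algebra_simps)
  also have "\<dots> = weak_div (\<lambda>x. \<phi> x * (1 - ?h x)) + weak_div (\<lambda>x. \<phi> x * ?h x)"
    by (rule weak_div_add[OF h1 h2])
  also have "weak_div (\<lambda>x. \<phi> x * ?h x) \<le> 0"
  proof (rule good[unfolded flux_nonpos_on_def, rule_format], intro conjI allI impI)
    show "0 \<le> \<phi> x * ?h x" for x using insert.prems(3) bump_bounds(1) by (intro mult_nonneg_nonneg)
    show "\<phi> x * ?h x = 0" if "x \<notin> ball c r" for x using bump_eq_0[OF r that] by simp
  qed (rule h2)
  also have "weak_div (\<lambda>x. \<phi> x * (1 - ?h x)) \<le> 0"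
  proof (rule insert.IH[OF _ h1])
    show "0 < r \<and> flux_nonpos_on (ball c r)" if "(c, r) \<in> F" for c r
      using insert.prems(1) that by auto
    show "0 \<le> \<phi> x * (1 - ?h x)" for x using insert.prems(3) bump_bounds(2)[of c r x] by simp
    show "\<phi> x * (1 - ?h x) = 0" if "x \<in> S" "x \<notin> (\<Union>(c,r)\<in>F. ball c (r/2))" for x
    proof (cases "x \<in> ball c (r/2)")
      case True
      then show ?thesis using bump_eq_1[OF r True] by simp
    next
      case False
      then have "\<phi> x = 0" using insert.prems(4)[of x] that p by auto
      then show ?thesis by simp
    qed
  qed
  finally show ?case by simp
qed

end

section \<open>Flux through a smooth piece of the boundary\<close>

lemma C1_on_regular_function:
  assumes "regular_function U \<rho> g"
  shows "C1_on U \<rho>"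
  by (rule C1_onI[where f'="\<lambda>z h. g z \<bullet> h"])
    (use assms in \<open>auto simp: regular_function_def intro!: continuous_intros\<close>)

text \<open>Compactness turns the pointwise bound at the boundary into one on a whole layer along it.\<close>

lemma (in bounded_field) outflow_uniformly_small:
  assumes reg: "regular_function U \<rho> g" and cb: "cball c r \<subseteq> U"
    and SU: "S \<inter> U = {z \<in> U. \<rho> z < 0}"
    and flux: "\<And>x e. x \<in> U \<Longrightarrow> \<rho> x = 0 \<Longrightarrow> e > 0 \<Longrightarrow> \<exists>d>0. \<forall>z\<in>S \<inter> ball x d. P z \<bullet> g z \<le> e"
    and e: "e > 0"
  obtains d where "d > 0" "\<And>z. z \<in> S \<Longrightarrow> z \<in> cball c r \<Longrightarrow> - \<rho> z \<le> d \<Longrightarrow> P z \<bullet> g z \<le> e"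
proof (rule ccontr)
  assume contra: "\<not> thesis"
  have "\<exists>z. z \<in> S \<and> z \<in> cball c r \<and> - \<rho> z \<le> inverse (real (Suc n)) \<and> P z \<bullet> g z > e" for n
  proof (rule ccontr)
    assume "\<not> ?thesis"
    then have "thesis" by (intro that[of "inverse (real (Suc n))"]) (auto simp: not_less)
    then show False using contra by simp
  qed
  then obtain z where z: "\<And>n. z n \<in> S" "\<And>n. z n \<in> cball c r" "\<And>n. - \<rho> (z n) \<le> inverse (real (Suc n))"
    "\<And>n. P (z n) \<bullet> g (z n) > e" by metis
  obtain l k where l: "l \<in> cball c r" "strict_mono k" "(z \<circ> k) \<longlonglongrightarrow> l"
    using compact_cball[of c r] z(2) unfolding compact_def by metis
  have lU: "l \<in> U" using l cb by auto
  have "isCont \<rho> l"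
    using reg lU unfolding regular_function_def by (metis has_derivative_continuous)
  then have lim: "(\<lambda>n. \<rho> ((z \<circ> k) n)) \<longlonglongrightarrow> \<rho> l"
    using l(3) by (rule isCont_tendsto_compose)
  have "(\<lambda>n. - inverse (real (Suc (k n)))) \<longlonglongrightarrow> - 0"
    using LIMSEQ_subseq_LIMSEQ[OF LIMSEQ_inverse_real_of_nat l(2)] by (intro tendsto_minus) (simp add: o_def)
  then have "\<rho> l \<ge> - 0"
    by (rule tendsto_le[OF sequentially_bot lim])
      (use z(3) in \<open>auto intro!: always_eventually simp: minus_le_iff\<close>)
  moreover have "\<rho> l \<le> 0"
  proof (rule tendsto_upperbound[OF lim])
    have "\<rho> ((z \<circ> k) n) \<le> 0" for n
    proof -
      have "z (k n) \<in> S \<inter> U" using z(1,2) cb by blast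
      then show ?thesis unfolding SU by simp
    qed
    then show "\<forall>\<^sub>F n in sequentially. \<rho> ((z \<circ> k) n) \<le> 0" by (intro always_eventually) auto
  qed simp
  ultimately have "\<rho> l = 0" by simp
  then obtain d where d: "d > 0" "\<And>x. x \<in> S \<inter> ball l d \<Longrightarrow> P x \<bullet> g x \<le> e"
    using flux[OF lU _ e] by blast
  from l(3) d(1) obtain n where "dist ((z \<circ> k) n) l < d"
    unfolding lim_sequentially by blast
  then have "z (k n) \<in> S \<inter> ball l d" using z(1) by (simp add: dist_commute)
  then show False using d(2) z(4)[of "k n"] by fastforce
qed

lemma vdiv_diff_const: "vdiv (\<lambda>x. P x - c) x = vdiv P x" if "P differentiable (at x)"
proof -
  have "((\<lambda>x. P x - c) has_derivative (\<lambda>v. frechet_derivative P (at x) v - 0)) (at x)"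
    using that frechet_derivative_works by (intro has_derivative_diff has_derivative_const) blast
  then show ?thesis by (subst vdiv_eqI) (auto simp: vdiv_def)
qed

text \<open>Let \<open>v\<close> be the normal at \<open>x0\<close>. The field \<open>P - \<kappa> v\<close> has the same divergence as \<open>P\<close>, and its flux is
nonpositive on a whole layer along the boundary, not only in the limit. Multiplied by a cutoff \<open>\<eta>\<close> that
is a function of \<open>\<rho>\<close> and vanishes near the boundary, it has compact support in \<open>S\<close>, so its divergence
integrates to \<open>0\<close>. The part in which \<open>\<eta>\<close> is differentiated is nonnegative, because the derivative of \<open>\<eta>\<close> is
a nonpositive multiple of \<open>g\<close> supported in the layer; hence the remaining part is nonpositive. Then
\<open>\<eta>\<close> tends to \<open>1\<close>, and \<open>\<kappa>\<close> to \<open>0\<close>.\<close>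

lemma (in bounded_field) flux_nonpos_boundary:
  assumes reg: "regular_function U \<rho> g" and x0: "x0 \<in> U"
    and SU: "S \<inter> U = {z \<in> U. \<rho> z < 0}"
    and flux: "\<And>x e. x \<in> U \<Longrightarrow> \<rho> x = 0 \<Longrightarrow> e > 0 \<Longrightarrow> \<exists>d>0. \<forall>z\<in>S \<inter> ball x d. P z \<bullet> g z \<le> e"
  obtains r where "r > 0" "flux_nonpos_on (ball x0 r)"
proof -
  have U: "open U" and cont_g: "continuous_on U g" and g0: "g x0 \<noteq> 0"
    and der_\<rho>: "\<And>x. x \<in> U \<Longrightarrow> (\<rho> has_derivative (\<lambda>h. g x \<bullet> h)) (at x)"
    using reg x0 unfolding regular_function_def by auto
  define v where "v = g x0"
  \<comment> \<open>half of the value of \<open>g z \<bullet> v\<close> at \<open>x0\<close>, hence a lower bound nearby\<close>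
  define c where "c = v \<bullet> v / 2"
  have c: "c > 0" using g0 by (simp add: c_def v_def)
  have "open (U \<inter> (\<lambda>z. g z \<bullet> v) -` {c<..})"
    by (rule continuous_open_preimage) (auto intro!: continuous_intros cont_g U)
  moreover have "x0 \<in> U \<inter> (\<lambda>z. g z \<bullet> v) -` {c<..}"
    using x0 c by (simp add: c_def v_def)
  ultimately obtain r where r: "r > 0" "cball x0 r \<subseteq> U \<inter> (\<lambda>z. g z \<bullet> v) -` {c<..}"
    using open_contains_cball by metis
  then have cb: "cball x0 r \<subseteq> U" and gv: "\<And>z. z \<in> cball x0 r \<Longrightarrow> g z \<bullet> v \<ge> c"
    by (auto simp: subset_iff intro: less_imp_le)
  let ?V = "S \<inter> U"
  have V: "open ?V" "bounded ?V" using open_S bounded_S U by (auto intro: bounded_subset)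
  have P_V: "C1_on ?V P" by (rule C1_on_subset[OF C1_P]) simp
  have \<rho>_V: "C1_on ?V \<rho>" by (rule C1_on_subset[OF C1_on_regular_function[OF reg]]) simp
  have "flux_nonpos_on (ball x0 r)"
    unfolding flux_nonpos_on_def
  proof (intro allI impI, elim conjE)
    fix \<phi> :: "real^'n \<Rightarrow> real"
    assume \<phi>: "C1_on UNIV \<phi>" and \<phi>0: "\<forall>x. 0 \<le> \<phi> x" and supp: "\<forall>x. x \<notin> ball x0 r \<longrightarrow> \<phi> x = 0"
    let ?D = "\<lambda>x. frechet_derivative \<phi> (at x)"
    have D: "(\<phi> has_derivative ?D x) (at x)" for x by (rule C1_on_has_derivative[OF \<phi>]) simp
    have lin: "linear (?D x)" for x by (rule has_derivative_linear[OF D])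
    have \<phi>_V: "C1_on ?V \<phi>" by (rule C1_on_subset[OF \<phi>]) simp
    have supp_D: "?D x w = 0" if "x \<notin> cball x0 r" for x w
      by (rule frechet_derivative_eq_0_open[of "- cball x0 r"]) (use supp that in auto)
    obtain B where B: "\<And>x. x \<in> S \<Longrightarrow> \<bar>integrand \<phi> x\<bar> \<le> B"
      using integrand_bounded[OF \<phi>] by blast
    obtain B' where B': "\<And>x. x \<in> S \<Longrightarrow> \<bar>?D x v\<bar> \<le> B'"
    proof -
      obtain B where "\<And>x v. x \<in> S \<Longrightarrow> \<bar>?D x v\<bar> \<le> B * norm v"
        using bounded_test_function[OF \<phi>] by metis
      then show ?thesis by (rule that[of "B * norm v"])
    qed
    have D_cont: "continuous_on S (\<lambda>x. ?D x v)"
      by (rule C1_on_continuous_derivative[OF C1_on_subset[OF \<phi>]]) auto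
    have D_int: "integrable lborel (\<lambda>x. indicator S x * ?D x v)"
      by (rule integrable_continuous_bounded_on_open[OF open_S bounded_S D_cont B'])
    have key: "weak_div \<phi> \<le> \<kappa> * (\<integral>x. indicator S x * ?D x v \<partial>lborel)" if \<kappa>: "\<kappa> > 0" for \<kappa>
    proof -
      define q where "q x = integrand \<phi> x - \<kappa> * ?D x v" for x
      have e: "\<kappa> * c > 0" using \<kappa> c by simp
      obtain d where d: "d > 0" "\<And>z. z \<in> S \<Longrightarrow> z \<in> cball x0 r \<Longrightarrow> - \<rho> z \<le> d \<Longrightarrow> P z \<bullet> g z \<le> \<kappa> * c"
        using outflow_uniformly_small[OF reg cb SU flux e] by blast
      define \<delta> where "\<delta> n = d / 2 * inverse (real (Suc n))" for n
      have \<delta>: "\<delta> n > 0" "2 * \<delta> n \<le> d" for n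
        using d(1) by (auto simp: \<delta>_def field_simps)
      \<comment> \<open>zero for \<open>- \<rho> \<le> \<delta>\<close>, one for \<open>- \<rho> \<ge> 2 \<delta>\<close>: the transition stays in the layer where the flux is small\<close>
      define \<eta> where "\<eta> n x = smoothstep (- \<rho> x / \<delta> n - 1)" for n x
      have \<eta>: "0 \<le> \<eta> n x" "\<eta> n x \<le> 1" for n x by (simp_all add: \<eta>_def smoothstep_bounds)
      have \<eta>_V: "C1_on ?V (\<eta> n)" for n
        unfolding \<eta>_def[abs_def] divide_inverse
        by (rule C1_on_compose[OF _ C1_on_smoothstep])
          (intro C1_on_diff C1_on_mult C1_on_minus C1_on_const \<rho>_V, simp)
      have \<eta>_der: "(\<eta> n has_derivative (\<lambda>w. smoothstep_deriv (- \<rho> x / \<delta> n - 1) * (- (g x \<bullet> w) / \<delta> n))) (at x)"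
        if "x \<in> ?V" for x n
      proof -
        have "((\<lambda>x. - \<rho> x / \<delta> n - 1) has_derivative (\<lambda>w. - (g x \<bullet> w) / \<delta> n)) (at x)"
          unfolding divide_inverse
          by (rule derivative_eq_intros der_\<rho> refl | use that in simp)+
        from has_derivative_compose[OF this smoothstep_has_real_derivative[unfolded has_field_derivative_def]]
        show ?thesis unfolding \<eta>_def[abs_def] .
      qed
      define P' where "P' x = P x - \<kappa> *\<^sub>R v" for x
      have P'_V: "C1_on ?V P'" unfolding P'_def[abs_def] by (intro C1_on_diff P_V C1_on_const)
      have div_P': "vdiv P' x = vdiv P x" if "x \<in> ?V" for x
        unfolding P'_def[abs_def] by (rule vdiv_diff_const) (rule C1_on_differentiable[OF P_V that])
      let ?full = "\<lambda>n x. \<phi> x * \<eta> n x * vdiv P' x + frechet_derivative (\<lambda>x. \<phi> x * \<eta> n x) (at x) (P' x)"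
      have full: "integrable lborel (\<lambda>x. indicator ?V x * ?full n x)"
        "(\<integral>x. indicator ?V x * ?full n x \<partial>lborel) = 0" for n
      proof -
        let ?K = "{x \<in> cball x0 r. \<rho> x \<le> - \<delta> n}"
        have "continuous_on (cball x0 r) \<rho>"
          using C1_on_continuous_on[OF C1_on_regular_function[OF reg]] cb by (rule continuous_on_subset)
        then have "compact (cball x0 r \<inter> \<rho> -` {.. - \<delta> n})"
          by (intro closed_Int_compact[of _ "cball x0 r", simplified Int_commute] continuous_closed_preimage
              | simp add: compact_eq_bounded_closed continuous_closed_preimage bounded_Int)+
        moreover have "cball x0 r \<inter> \<rho> -` {.. - \<delta> n} = ?K" by auto
        ultimately have K: "compact ?K" by simp
        have KV: "?K \<subseteq> ?V" unfolding SU using cb \<delta>(1)[of n] by auto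
        have K0: "\<phi> x * \<eta> n x = 0" if "x \<in> ?V - ?K" for x
        proof (cases "x \<in> cball x0 r")
          case True
          then have "\<rho> x > - \<delta> n" using that by auto
          then have "- \<rho> x / \<delta> n - 1 \<le> 0" using \<delta>(1)[of n] by (simp add: field_simps)
          then show ?thesis by (simp add: \<eta>_def smoothstep_eq_0)
        next
          case False
          then have "\<phi> x = 0" using supp by auto
          then show ?thesis by simp
        qed
        show "integrable lborel (\<lambda>x. indicator ?V x * ?full n x)"
          "(\<integral>x. indicator ?V x * ?full n x \<partial>lborel) = 0"
          by (rule integral_vdiv_compact_in_open[OF V(1) P'_V C1_on_mult[OF \<phi>_V \<eta>_V] K KV], rule K0, assumption)+
      qed
      \<comment> \<open>the derivative of \<open>\<eta>\<close> contributes with the favourable sign and is dropped\<close>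
      have ineq: "\<eta> n x * q x \<le> ?full n x" if x: "x \<in> ?V" for n x
      proof -
        let ?s = "smoothstep_deriv (- \<rho> x / \<delta> n - 1)"
        have "((\<lambda>x. \<phi> x * \<eta> n x) has_derivative
            (\<lambda>w. \<phi> x * (?s * (- (g x \<bullet> w) / \<delta> n)) + ?D x w * \<eta> n x)) (at x)"
          by (rule has_derivative_mult[OF D \<eta>_der[OF x]])
        then have "frechet_derivative (\<lambda>x. \<phi> x * \<eta> n x) (at x) =
            (\<lambda>w. \<phi> x * (?s * (- (g x \<bullet> w) / \<delta> n)) + ?D x w * \<eta> n x)"
          by (rule frechet_derivative_at[symmetric])
        then have "?full n x = \<phi> x * \<eta> n x * vdiv P x +
            (\<phi> x * (?s * (- (g x \<bullet> P' x) / \<delta> n)) + ?D x (P' x) * \<eta> n x)"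
          using div_P'[OF x] by simp
        also have "?D x (P' x) = ?D x (P x) - \<kappa> * ?D x v"
          unfolding P'_def by (simp add: linear_diff[OF lin] linear_scale[OF lin])
        finally have "?full n x = \<eta> n x * q x + \<phi> x * ?s * (- (g x \<bullet> P' x)) / \<delta> n"
          by (simp add: q_def integrand_def algebra_simps)
        moreover have "\<phi> x * ?s * (- (g x \<bullet> P' x)) / \<delta> n \<ge> 0"
        proof (cases "\<phi> x = 0 \<or> ?s = 0")
          case False
          then have xb: "x \<in> cball x0 r" using supp ball_subset_cball by blast
          have "- \<rho> x / \<delta> n - 1 < 1" using False by (auto simp: smoothstep_deriv_def split: if_splits)
          then have "- \<rho> x < 2 * \<delta> n" using \<delta>(1)[of n] by (simp add: field_simps)
          then have "P x \<bullet> g x \<le> \<kappa> * c" using d(2)[OF _ xb] \<delta>(2)[of n] x by auto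
          moreover have "\<kappa> * c \<le> \<kappa> * (g x \<bullet> v)" using gv[OF xb] \<kappa> by simp
          ultimately have "- (g x \<bullet> P' x) \<ge> 0" by (simp add: P'_def inner_diff_right inner_commute)
          then show ?thesis using \<phi>0 smoothstep_deriv_bounds(1) \<delta>(1)[of n]
            by (intro divide_nonneg_pos mult_nonneg_nonneg) auto
        qed auto
        ultimately show ?thesis by linarith
      qed
      have q_cont: "continuous_on ?V q"
        unfolding q_def[abs_def]
        by (intro continuous_on_diff continuous_on_mult continuous_on_const
            continuous_on_subset[OF D_cont] continuous_on_subset[OF continuous_on_integrand[OF C1_on_subset[OF \<phi>]]])
          auto
      define Q where "Q = B + \<kappa> * B'"
      have q_bound: "\<bar>q x\<bar> \<le> Q" if "x \<in> ?V" for x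
      proof -
        have "\<bar>\<kappa> * ?D x v\<bar> \<le> \<kappa> * B'" unfolding abs_mult using B'[of x] \<kappa> that by auto
        then show ?thesis using B[of x] that unfolding q_def Q_def by auto
      qed
      have \<eta>q_bound: "\<bar>\<eta> n x * q x\<bar> \<le> Q" if "x \<in> ?V" for n x
      proof -
        have "\<bar>\<eta> n x * q x\<bar> \<le> 1 * \<bar>q x\<bar>" unfolding abs_mult using \<eta>[of n x] by (intro mult_right_mono) auto
        then show ?thesis using q_bound[OF that] by simp
      qed
      have \<eta>q_int: "integrable lborel (\<lambda>x. indicator ?V x * (\<eta> n x * q x))" for n
        by (rule integrable_continuous_bounded_on_open[OF V _ \<eta>q_bound])
          (intro continuous_on_mult C1_on_continuous_on[OF \<eta>_V] q_cont)
      have le0: "(\<integral>x. indicator ?V x * (\<eta> n x * q x) \<partial>lborel) \<le> 0" for n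
      proof -
        have "(\<integral>x. indicator ?V x * (\<eta> n x * q x) \<partial>lborel) \<le> (\<integral>x. indicator ?V x * ?full n x \<partial>lborel)"
          by (rule integral_mono[OF \<eta>q_int full(1)]) (auto simp: indicator_def intro: ineq)
        then show ?thesis using full(2)[of n] by simp
      qed
      have "(\<lambda>n. \<integral>x. indicator ?V x * (\<eta> n x * q x) \<partial>lborel) \<longlonglongrightarrow> (\<integral>x. indicator ?V x * q x \<partial>lborel)"
      proof (rule integral_dominated_convergence[where w="\<lambda>x. indicator ?V x * Q"])
        have i: "integrable lborel (\<lambda>x. indicator ?V x * q x)"
          by (rule integrable_continuous_bounded_on_open[OF V q_cont q_bound])
        show "(\<lambda>x. indicator ?V x * q x) \<in> borel_measurable lborel"
          using borel_measurable_integrable[OF i] .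
        show "(\<lambda>x. indicator ?V x * (\<eta> n x * q x)) \<in> borel_measurable lborel" for n
          using borel_measurable_integrable[OF \<eta>q_int] .
        show "integrable lborel (\<lambda>x. indicator ?V x * Q)"
          by (rule integrable_continuous_bounded_on_open[OF V, of _ "\<bar>Q\<bar>"]) auto
        show "AE x in lborel. norm (indicator ?V x * (\<eta> n x * q x)) \<le> indicator ?V x * Q" for n
          using \<eta>q_bound[of _ n] by (intro AE_I2) (auto simp: indicator_def)
        show "AE x in lborel. (\<lambda>n. indicator ?V x * (\<eta> n x * q x)) \<longlonglongrightarrow> indicator ?V x * q x"
        proof (intro AE_I2)
          fix x
          show "(\<lambda>n. indicator ?V x * (\<eta> n x * q x)) \<longlonglongrightarrow> indicator ?V x * q x"
          proof (cases "x \<in> ?V")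
            case True
            then have neg: "- \<rho> x > 0" using SU by auto
            have "(\<lambda>n. 2 * \<delta> n) \<longlonglongrightarrow> 2 * (d / 2 * 0)"
              unfolding \<delta>_def by (intro tendsto_intros LIMSEQ_inverse_real_of_nat)
            then have "(\<lambda>n. 2 * \<delta> n) \<longlonglongrightarrow> 0" by simp
            then have "\<forall>\<^sub>F n in sequentially. 2 * \<delta> n < - \<rho> x"
              using neg by (rule order_tendstoD(2))
            then have "\<forall>\<^sub>F n in sequentially. \<eta> n x = 1"
            proof eventually_elim
              case (elim n)
              then have "1 \<le> - \<rho> x / \<delta> n - 1" using \<delta>(1)[of n] by (simp add: field_simps)
              then show ?case unfolding \<eta>_def by (rule smoothstep_eq_1)
            qed
            then have "\<forall>\<^sub>F n in sequentially. indicator ?V x * (\<eta> n x * q x) = indicator ?V x * q x"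
              by eventually_elim simp
            then show ?thesis by (rule tendsto_eventually)
          qed simp
        qed
      qed
      then have "(\<integral>x. indicator ?V x * q x \<partial>lborel) \<le> 0"
        by (rule LIMSEQ_le_const2) (use le0 in auto)
      moreover have "indicator ?V x * q x = indicator S x * integrand \<phi> x - \<kappa> * (indicator S x * ?D x v)" for x
      proof (cases "x \<in> S - U")
        case True
        then have "x \<notin> cball x0 r" using cb by auto
        then have "integrand \<phi> x = 0" "?D x v = 0"
          using supp_D supp by (auto simp: integrand_def)
        then show ?thesis using True by simp
      qed (auto simp: q_def indicator_def)
      ultimately have "(\<integral>x. indicator S x * integrand \<phi> x - \<kappa> * (indicator S x * ?D x v) \<partial>lborel) \<le> 0"
        by simp
      then show ?thesis unfolding weak_div_def
        using integrable_integrand[OF \<phi>] D_int by simp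
    qed
    show "weak_div \<phi> \<le> 0"
    proof (rule field_le_epsilon)
      fix e :: real assume e: "e > 0"
      let ?J = "\<integral>x. indicator S x * ?D x v \<partial>lborel"
      have "weak_div \<phi> \<le> e / (\<bar>?J\<bar> + 1) * ?J" by (rule key) (use e in auto)
      also have "\<dots> \<le> e / (\<bar>?J\<bar> + 1) * (\<bar>?J\<bar> + 1)" using e by (intro mult_left_mono) auto
      also have "\<dots> = e" by (simp add: add_pos_nonneg less_imp_neq[symmetric])
      finally show "weak_div \<phi> \<le> 0 + e" by simp
    qed
  qed
  then show ?thesis using that r by blast
qed

section \<open>Sets too small to carry flux\<close>

text \<open>Sets of \<open>(N - 1)\<close>-dimensional Hausdorff measure zero that are so small that finite covers suffice. For
\<open>N = 1\<close> the exponent is \<open>0\<close> and only the empty set qualifies.\<close>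

definition codim1_null :: "'a::euclidean_space set \<Rightarrow> bool" where
  "codim1_null E \<longleftrightarrow> (\<forall>e>0. \<exists>F. finite F \<and> (\<forall>(c,r)\<in>F. 0 < r \<and> r \<le> (1::real)) \<and>
     E \<subseteq> (\<Union>(c,r)\<in>F. ball c r) \<and> (\<Sum>(c,r)\<in>F. r ^ (DIM('a) - 1)) < e)"

lemma codim1_null_subset: "codim1_null E \<Longrightarrow> A \<subseteq> E \<Longrightarrow> codim1_null A"
  unfolding codim1_null_def by (meson order_trans)

lemma codim1_null_empty: "codim1_null {}"
  unfolding codim1_null_def by (intro allI impI exI[of _ "{}"]) auto

lemma codim1_null_Un:
  fixes A B :: "'a::euclidean_space set"
  assumes "codim1_null A" "codim1_null B"
  shows "codim1_null (A \<union> B)"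
  unfolding codim1_null_def
proof (intro allI impI)
  fix e :: real assume "e > 0"
  then have e: "e / 2 > 0" by simp
  let ?s = "\<lambda>(c::'a, r::real). r ^ (DIM('a) - 1)"
  obtain F where F: "finite F" "\<forall>(c,r)\<in>F. 0 < r \<and> r \<le> (1::real)" "A \<subseteq> (\<Union>(c,r)\<in>F. ball c r)" "sum ?s F < e / 2"
    using assms(1) e unfolding codim1_null_def by meson
  obtain G where G: "finite G" "\<forall>(c,r)\<in>G. 0 < r \<and> r \<le> (1::real)" "B \<subseteq> (\<Union>(c,r)\<in>G. ball c r)" "sum ?s G < e / 2"
    using assms(2) e unfolding codim1_null_def by meson
  have "sum ?s (F \<union> G) \<le> sum ?s F + sum ?s G"
  proof -
    have "sum ?s (F \<union> G) + sum ?s (F \<inter> G) = sum ?s F + sum ?s G"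
      by (rule sum.union_inter[OF F(1) G(1)])
    moreover have "sum ?s (F \<inter> G) \<ge> 0" using F(2) by (intro sum_nonneg) auto
    ultimately show ?thesis by linarith
  qed
  then have "sum ?s (F \<union> G) < e" using F G by linarith
  then show "\<exists>F. finite F \<and> (\<forall>(c,r)\<in>F. 0 < r \<and> r \<le> (1::real)) \<and> A \<union> B \<subseteq> (\<Union>(c,r)\<in>F. ball c r) \<and> sum ?s F < e"
    using F G by (intro exI[of _ "F \<union> G"]) (simp add: ball_Un le_supI1 le_supI2 SUP_union)
qed

lemma codim1_null_Union:
  "finite \<F> \<Longrightarrow> (\<And>A. A \<in> \<F> \<Longrightarrow> codim1_null A) \<Longrightarrow> codim1_null (\<Union>\<F>)"
  by (induction \<F> rule: finite_induct) (auto intro: codim1_null_empty codim1_null_Un)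

text \<open>The points of a bounded set in a \<open>d\<close>-dimensional subspace are sorted by their rounded coordinates in an
orthonormal basis: of order \<open>n\<^sup>d\<close> cells with diameter of order \<open>1/n\<close>.\<close>

lemma grid_cover_count:
  fixes V :: "'a::euclidean_space set"
  assumes V: "subspace V" and K: "K \<subseteq> V" "\<And>x. x \<in> K \<Longrightarrow> norm x \<le> R" and n: "n > 0" and R: "R > 0"
  obtains k :: "'a \<Rightarrow> 'a \<Rightarrow> int" where "finite (k ` K)" "card (k ` K) \<le> (2 * n + 1) ^ dim V"
    "\<And>x y. x \<in> K \<Longrightarrow> y \<in> K \<Longrightarrow> k x = k y \<Longrightarrow> dist x y \<le> real (dim V) * (R / real n)"
proof -
  obtain B where B: "B \<subseteq> V" "pairwise orthogonal B" "\<And>x. x \<in> B \<Longrightarrow> norm x = 1"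
    "independent B" "card B = dim V" "span B = V"
    using orthonormal_basis_subspace[OF V] by metis
  have finB: "finite B" using B(4) by (rule independent_imp_finite)
  define s where "s = R / real n"
  have s: "s > 0" using n R by (simp add: s_def)
  define k where "k x = (\<lambda>b\<in>B. \<lfloor>(x \<bullet> b) / s\<rfloor>)" for x
  have range: "k ` K \<subseteq> B \<rightarrow>\<^sub>E {- int n..int n}"
  proof
    fix j assume "j \<in> k ` K"
    then obtain x where x: "x \<in> K" "j = k x" by blast
    have "\<lfloor>(x \<bullet> b) / s\<rfloor> \<in> {- int n..int n}" if "b \<in> B" for b
    proof -
      have "\<bar>x \<bullet> b\<bar> \<le> norm x * norm b" by (rule Cauchy_Schwarz_ineq2)
      then have "\<bar>x \<bullet> b\<bar> \<le> R" using K(2)[OF x(1)] B(3)[OF that] by simp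
      then have "\<bar>x \<bullet> b\<bar> \<le> real n * s" using n by (simp add: s_def)
      then have "\<bar>(x \<bullet> b) / s\<bar> \<le> real n" using s by (simp add: field_simps)
      then have "- real n \<le> (x \<bullet> b) / s" "(x \<bullet> b) / s \<le> real n" by linarith+
      then show ?thesis by (auto simp: le_floor_iff floor_le_iff)
    qed
    then show "j \<in> B \<rightarrow>\<^sub>E {- int n..int n}" using x by (auto simp: k_def)
  qed
  have fin: "finite (B \<rightarrow>\<^sub>E {- int n..int n})" using finB by (intro finite_PiE) auto
  have "card (k ` K) \<le> card (B \<rightarrow>\<^sub>E {- int n..int n})" by (rule card_mono[OF fin range])
  also have "\<dots> = (2 * n + 1) ^ dim V"
    using finB by (simp add: card_funcsetE B(5)) (simp add: nat_add_distrib nat_mult_distrib)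
  finally have card: "card (k ` K) \<le> (2 * n + 1) ^ dim V" .
  have close: "dist x y \<le> real (dim V) * (R / real n)" if xy: "x \<in> K" "y \<in> K" "k x = k y" for x y
  proof -
    have "x - y \<in> span B" using xy K(1) V B(6) by (auto intro: subspace_diff)
    then have "x - y = (\<Sum>b\<in>B. ((x - y) \<bullet> b) *\<^sub>R b)"
      using orthonormal_basis_expand[OF B(2,3) _ finB] by simp
    then have "norm (x - y) = norm (\<Sum>b\<in>B. ((x - y) \<bullet> b) *\<^sub>R b)" by simp
    also have "\<dots> \<le> (\<Sum>b\<in>B. norm (((x - y) \<bullet> b) *\<^sub>R b))" by (rule norm_sum)
    also have "\<dots> \<le> (\<Sum>b\<in>B. s)"
    proof (rule sum_mono)
      fix b assume b: "b \<in> B"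
      have "\<lfloor>(x \<bullet> b) / s\<rfloor> = \<lfloor>(y \<bullet> b) / s\<rfloor>" using fun_cong[OF xy(3), of b] b by (simp add: k_def)
      then have "\<bar>(x \<bullet> b) / s - (y \<bullet> b) / s\<bar> \<le> 1" by linarith
      then have "\<bar>((x - y) \<bullet> b) / s\<bar> \<le> 1" by (simp add: inner_diff_left diff_divide_distrib)
      then show "norm (((x - y) \<bullet> b) *\<^sub>R b) \<le> s" using B(3)[OF b] s by (simp add: field_simps)
    qed
    also have "\<dots> = real (dim V) * (R / real n)" by (simp add: B(5) s_def)
    finally show ?thesis by (simp add: dist_norm)
  qed
  show ?thesis by (rule that[OF finite_subset[OF range fin] card close])
qed

text \<open>With \<open>d = N - 2\<close> there are at most \<open>(3 n)\<^sup>d\<close> balls of radius \<open>A / n\<close>, so the sum of the powers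
\<open>r\<^bsup>d+1\<^esup>\<close> is of order \<open>1/n\<close>.\<close>

lemma codim1_null_lipschitz_image:
  fixes f :: "'a::euclidean_space \<Rightarrow> 'a"
  assumes V: "subspace V" "dim V + 2 = DIM('a)" and K: "compact K" "K \<subseteq> V" and f: "C-lipschitz_on K f"
  shows "codim1_null (f ` K)"
  unfolding codim1_null_def
proof (intro allI impI)
  fix e :: real assume e: "e > 0"
  define d where "d = dim V"
  obtain R0 where "\<forall>x\<in>K. norm x \<le> R0" using compact_imp_bounded[OF K(1)] unfolding bounded_iff by blast
  then have R: "\<And>x. x \<in> K \<Longrightarrow> norm x \<le> \<bar>R0\<bar> + 1" by force
  define R where "R = \<bar>R0\<bar> + 1"
  have R0: "R > 0" and KR: "\<And>x. x \<in> K \<Longrightarrow> norm x \<le> R" using R by (auto simp: R_def)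
  have C: "C \<ge> 0" using f by (rule lipschitz_on_nonneg)
  define A where "A = (C * real d + 1) * R"
  have A: "A > 0" unfolding A_def using C R0 by (intro mult_pos_pos add_nonneg_pos) auto
  obtain n :: nat where n0: "real n > max A (3 ^ d * A ^ (d + 1) / e)" using reals_Archimedean2 by blast
  then have nA: "A < real n" "3 ^ d * A ^ (d + 1) < e * real n"
    using e by (auto simp: pos_divide_less_eq mult.commute)
  have n: "n > 0" using nA(1) A by (cases n) auto
  define r where "r = A / real n"
  have r: "0 < r" "r \<le> 1" using A nA n by (auto simp: r_def)
  obtain k :: "'a \<Rightarrow> 'a \<Rightarrow> int" where k: "finite (k ` K)" "card (k ` K) \<le> (2 * n + 1) ^ d"
    "\<And>x y. x \<in> K \<Longrightarrow> y \<in> K \<Longrightarrow> k x = k y \<Longrightarrow> dist x y \<le> real d * (R / real n)"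
    using grid_cover_count[OF V(1) K(2) KR n R0] unfolding d_def by blast
  define p where "p = inv_into K k"
  have p: "p (k x) \<in> K" "k (p (k x)) = k x" if "x \<in> K" for x
    using that unfolding p_def by (auto intro: inv_into_into f_inv_into_f)
  let ?F = "(\<lambda>j. (f (p j), r)) ` (k ` K)"
  have fin: "finite ?F" using k(1) by (rule finite_imageI)
  have "f ` K \<subseteq> (\<Union>(c,r)\<in>?F. ball c r)"
  proof
    fix z assume "z \<in> f ` K"
    then obtain x where x: "x \<in> K" "z = f x" by blast
    have "dist (f (p (k x))) (f x) \<le> C * dist (p (k x)) x"
      by (rule lipschitz_onD[OF f p(1)[OF x(1)] x(1)])
    also have "\<dots> \<le> C * (real d * (R / real n))"
      by (intro mult_left_mono k(3) p x C)
    also have "\<dots> < r" using R0 n unfolding r_def A_def by (simp add: field_simps)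
    finally have "z \<in> ball (f (p (k x))) r" using x by simp
    then show "z \<in> (\<Union>(c,r)\<in>?F. ball c r)" using x by auto
  qed
  moreover have "(\<Sum>(c,r)\<in>?F. r ^ (DIM('a) - 1)) < e"
  proof -
    have D: "DIM('a) - 1 = d + 1" using V(2) by (simp add: d_def)
    have "(\<Sum>(c,r)\<in>?F. r ^ (DIM('a) - 1)) = (\<Sum>q\<in>?F. r ^ (d + 1))"
      unfolding D by (rule sum.cong) auto
    also have "\<dots> = real (card ?F) * r ^ (d + 1)" by simp
    also have "\<dots> \<le> real ((2 * n + 1) ^ d) * r ^ (d + 1)"
      using r order_trans[OF card_image_le[OF k(1)] k(2)]
      by (intro mult_right_mono) (simp_all del: of_nat_power)
    also have "\<dots> \<le> (3 * real n) ^ d * r ^ (d + 1)"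
    proof -
      have "real (2 * n + 1) ^ d \<le> (3 * real n) ^ d" using n by (intro power_mono) auto
      then show ?thesis using r by (intro mult_right_mono) simp_all
    qed
    also have "\<dots> = 3 ^ d * A ^ (d + 1) / real n"
      using n by (simp add: r_def power_mult_distrib power_divide field_simps)
    also have "\<dots> < e" using nA(2) n by (simp add: pos_divide_less_eq)
    finally show ?thesis .
  qed
  ultimately show "\<exists>F. finite F \<and> (\<forall>(c,r)\<in>F. 0 < r \<and> r \<le> (1::real)) \<and>
     f ` K \<subseteq> (\<Union>(c,r)\<in>F. ball c r) \<and> (\<Sum>(c,r)\<in>F. r ^ (DIM('a) - 1)) < e"
    using fin r by (intro exI[of _ ?F] conjI) auto
qed

lemma codim1_null_edge_set:
  fixes E :: "(real^'n) set"
  assumes "edge_set E"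
  shows "codim1_null E"
proof -
  obtain F :: "(real^'n) set set" where F: "finite F" "E \<subseteq> \<Union>F"
    "\<forall>A\<in>F. \<exists>(V :: (real^'n) set) K f C. subspace V \<and> dim V + 2 = CARD('n) \<and>
        compact K \<and> K \<subseteq> V \<and> C-lipschitz_on K f \<and> A = f ` K"
    using assms unfolding edge_set_def by blast
  have "codim1_null A" if A: "A \<in> F" for A
  proof -
    obtain V :: "(real^'n) set" and K f C where "subspace V" "dim V + 2 = CARD('n)" "compact K" "K \<subseteq> V"
      "C-lipschitz_on K f" "A = f ` K" using F(3) A by meson
    then show ?thesis using codim1_null_lipschitz_image[of V K C f] by simp
  qed
  then show ?thesis using codim1_null_Union[OF F(1)] codim1_null_subset F(2) by blast
qed

section \<open>The divergence inequality\<close>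

text \<open>What is needed of a product of the functions \<open>1 - bump c (2 * r)\<close>: it removes the balls, and its
distance from \<open>1\<close> and its gradient are controlled by sums over the balls.\<close>

definition cutoff_off :: "((real^'n) \<times> real) set \<Rightarrow> (real^'n \<Rightarrow> real) \<Rightarrow> bool" where
  "cutoff_off F \<theta> \<longleftrightarrow> C1_on UNIV \<theta> \<and> (\<forall>x. 0 \<le> \<theta> x) \<and> (\<forall>x. \<theta> x \<le> 1) \<and>
    (\<forall>x \<in> (\<Union>(c,r)\<in>F. ball c r). \<theta> x = 0) \<and>
    (\<forall>x. 1 - \<theta> x \<le> (\<Sum>(c,r)\<in>F. indicator (cball c (2 * r)) x)) \<and>
    (\<forall>x v. \<bar>frechet_derivative \<theta> (at x) v\<bar> \<le> norm v * (\<Sum>(c,r)\<in>F. 2 / r * indicator (cball c (2 * r)) x))"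

lemma cutoff_offD:
  assumes "cutoff_off F \<theta>"
  shows "C1_on UNIV \<theta>" "0 \<le> \<theta> x" "\<theta> x \<le> 1"
    "x \<in> (\<Union>(c,r)\<in>F. ball c r) \<Longrightarrow> \<theta> x = 0"
    "1 - \<theta> x \<le> (\<Sum>(c,r)\<in>F. indicator (cball c (2 * r)) x)"
    "\<bar>frechet_derivative \<theta> (at x) v\<bar> \<le> norm v * (\<Sum>(c,r)\<in>F. 2 / r * indicator (cball c (2 * r)) x)"
  using assms by (simp_all only: cutoff_off_def)

lemma cutoff_off_exists:
  fixes F :: "((real^'n) \<times> real) set"
  assumes "finite F" "\<forall>p\<in>F. 0 < snd p"
  shows "\<exists>\<theta>. cutoff_off F \<theta>"
  using assms
proof (induction F rule: finite_induct)
  case empty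
  show ?case by (rule exI[of _ "\<lambda>x. 1"]) (simp add: cutoff_off_def C1_on_const)
next
  case (insert p F)
  obtain c r where p: "p = (c, r)" by force
  have r: "r > 0" using insert.prems p by auto
  obtain \<theta> :: "real^'n \<Rightarrow> real" where "cutoff_off F \<theta>"
    using insert.IH insert.prems by auto
  note \<theta> = cutoff_offD[OF this]
  let ?h = "bump c (2 * r)"
  let ?\<theta> = "\<lambda>x. \<theta> x * (1 - ?h x)"
  have h: "0 \<le> ?h x" "?h x \<le> 1" for x by (rule bump_bounds)+
  have h_ind: "?h x \<le> indicator (cball c (2 * r)) x" for x
  proof (cases "x \<in> ball c (2 * r)")
    case True then show ?thesis using h[of x] by (auto simp: indicator_def)
  next
    case False then show ?thesis using bump_eq_0[of "2 * r" x c] r by (auto simp: indicator_def)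
  qed
  have "\<bar>frechet_derivative ?\<theta> (at x) v\<bar> \<le>
      norm v * (\<Sum>(c,r)\<in>insert p F. 2 / r * indicator (cball c (2 * r)) x)" for x v
  proof -
    let ?D = "frechet_derivative \<theta> (at x)" and ?Dh = "frechet_derivative ?h (at x)"
    have "((\<lambda>x. 1 - ?h x) has_derivative (\<lambda>v. 0 - ?Dh v)) (at x)"
      by (intro has_derivative_diff has_derivative_const C1_on_has_derivative[OF C1_on_bump UNIV_I])
    then have "(?\<theta> has_derivative (\<lambda>v. \<theta> x * (0 - ?Dh v) + ?D v * (1 - ?h x))) (at x)"
      by (rule has_derivative_mult[OF C1_on_has_derivative[OF \<theta>(1) UNIV_I]])
    then have "frechet_derivative ?\<theta> (at x) = (\<lambda>v. \<theta> x * (0 - ?Dh v) + ?D v * (1 - ?h x))"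
      by (rule frechet_derivative_at[symmetric])
    then have "\<bar>frechet_derivative ?\<theta> (at x) v\<bar> \<le> \<bar>\<theta> x\<bar> * \<bar>?Dh v\<bar> + \<bar>?D v\<bar> * \<bar>1 - ?h x\<bar>"
      by (simp add: abs_mult[symmetric] abs_triangle_ineq4)
    also have "\<dots> \<le> 1 * \<bar>?Dh v\<bar> + \<bar>?D v\<bar> * 1"
      using \<theta>(2,3)[of x] h[of x] by (intro add_mono mult_mono) auto
    also have "\<dots> \<le> 4 / (2 * r) * norm v * indicator (cball c (2 * r)) x +
        norm v * (\<Sum>(c,r)\<in>F. 2 / r * indicator (cball c (2 * r)) x)"
      using bump_derivative_bound[of "2 * r" c x v] r \<theta>(6)[of x v] by (intro add_mono) auto
    also have "\<dots> = norm v * (\<Sum>(c,r)\<in>insert p F. 2 / r * indicator (cball c (2 * r)) x)"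
      using insert.hyps by (simp add: p algebra_simps)
    finally show ?thesis .
  qed
  moreover have "1 - ?\<theta> x \<le> (\<Sum>(c,r)\<in>insert p F. indicator (cball c (2 * r)) x)" for x
  proof -
    have "1 - ?\<theta> x = (1 - \<theta> x) + \<theta> x * ?h x" by (simp add: algebra_simps)
    also have "\<dots> \<le> (\<Sum>(c,r)\<in>F. indicator (cball c (2 * r)) x) + 1 * indicator (cball c (2 * r)) x"
      using \<theta>(2,3)[of x] \<theta>(5)[of x] h[of x] h_ind[of x] by (intro add_mono mult_mono) auto
    also have "\<dots> = (\<Sum>(c,r)\<in>insert p F. indicator (cball c (2 * r)) x)"
      using insert.hyps by (simp add: p)
    finally show ?thesis .
  qed
  moreover have "?\<theta> x = 0" if "x \<in> (\<Union>(c,r)\<in>insert p F. ball c r)" for x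
  proof (cases "x \<in> ball c r")
    case True
    then have "?h x = 1" using bump_eq_1[of "2 * r" x c] r by simp
    then show ?thesis by simp
  next
    case False
    then have "\<theta> x = 0" using that p by (intro \<theta>(4)) auto
    then show ?thesis by simp
  qed
  moreover have "0 \<le> ?\<theta> x" "?\<theta> x \<le> 1" for x
    using \<theta>(2,3)[of x] h[of x] by (auto intro: mult_nonneg_nonneg mult_le_one)
  moreover have "C1_on UNIV ?\<theta>"
    by (intro C1_on_mult C1_on_diff C1_on_const C1_on_bump \<theta>)
  ultimately have "cutoff_off (insert p F) ?\<theta>" unfolding cutoff_off_def by blast
  then show ?case by blast
qed

lemma integral_indicator_cball:
  fixes c :: "'a::euclidean_space"
  assumes "r \<ge> 0"
  shows "integrable lborel (\<lambda>x. indicator (cball c r) x :: real)"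
    "(\<integral>x. indicator (cball c r) x \<partial>lborel) = r ^ DIM('a) * measure lborel (ball (0::'a) 1)"
proof -
  show "integrable lborel (\<lambda>x. indicator (cball c r) x :: real)"
    by (intro integrable_real_indicator) (auto simp: emeasure_lborel_cball_finite[unfolded infinity_ennreal_def])
  have "measure lborel (cball c r) = measure lborel (ball c r)"
    using content_cball_conv_ball[of c r] by simp
  then show "(\<integral>x. indicator (cball c r) x \<partial>lborel) = r ^ DIM('a) * measure lborel (ball (0::'a) 1)"
    using content_ball_conv_unit_ball[OF assms, of c] by simp
qed

text \<open>A cutoff \<open>\<theta>\<close> removes small balls covering the exceptional set. What remains of the closure is compact and
covered by finitely many balls with nonpositive flux, so that \<open>weak_div \<theta> \<le> 0\<close>. Replacing \<open>\<theta>\<close> by \<open>1\<close>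
changes the integral by at most a constant times the sum of the \<open>r\<^bsup>N-1\<^esup>\<close>, which is as small as desired.

Flux is tested against the unnormalized normal \<open>g\<close>; only its sign matters.\<close>

theorem (in bounded_field) integral_divergence_nonpos:
  assumes E: "codim1_null E"
    and bdry: "\<And>x. x \<in> closure S \<Longrightarrow> x \<notin> S \<Longrightarrow> x \<notin> E \<Longrightarrow>
      \<exists>U \<rho> g. regular_function U \<rho> g \<and> x \<in> U \<and> S \<inter> U = {z \<in> U. \<rho> z < 0} \<and>
        (\<forall>x\<in>U. \<rho> x = 0 \<longrightarrow> (\<forall>e>0. \<exists>d>0. \<forall>z\<in>S \<inter> ball x d. P z \<bullet> g z \<le> e))"
  shows "(\<integral>x. indicator S x * vdiv P x \<partial>lborel) \<le> 0"
proof -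
  have good: "\<exists>r>0. flux_nonpos_on (ball x r)" if x: "x \<in> closure S - E" for x
  proof (cases "x \<in> S")
    case True
    then obtain r where "r > 0" "cball x r \<subseteq> S" using open_S open_contains_cball by metis
    then show ?thesis using flux_nonpos_interior by blast
  next
    case False
    then obtain U \<rho> g where "regular_function U \<rho> g" "x \<in> U" "S \<inter> U = {z \<in> U. \<rho> z < 0}"
      "\<forall>x\<in>U. \<rho> x = 0 \<longrightarrow> (\<forall>e>0. \<exists>d>0. \<forall>z\<in>S \<inter> ball x d. P z \<bullet> g z \<le> e)"
      using bdry[of x] x False by blast
    then show ?thesis using flux_nonpos_boundary[of U \<rho> g x] by metis
  qed
  define m where "m = measure lborel (ball (0::real^'n) 1)"
  have m: "m \<ge> 0" by (simp add: m_def)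
  define N where "N = CARD('n)"
  have N: "N \<ge> 1" by (simp add: N_def Suc_leI)
  \<comment> \<open>a bump of radius \<open>2 r\<close> changes the integral by at most \<open>(1 + 2 / r) (2 r)\<^sup>N m\<close> times the bounds of the
    field, and \<open>r \<le> 1\<close> gives \<open>1 + 2 / r \<le> 3 / r\<close>\<close>
  define C where "C = (1 + \<bar>M\<bar>) * (3 * 2 ^ N * (m + 1))"
  have C: "C > 0" unfolding C_def using m by simp
  show ?thesis
  proof (rule field_le_epsilon)
    fix e :: real assume e: "e > 0"
    then have "e / C > 0" using C by simp
    then obtain F :: "((real^'n) \<times> real) set" where F: "finite F" "\<forall>(c,r)\<in>F. 0 < r \<and> r \<le> 1"
      "E \<subseteq> (\<Union>(c,r)\<in>F. ball c r)" "(\<Sum>(c,r)\<in>F. r ^ (N - 1)) < e / C"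
      using E unfolding codim1_null_def N_def by (simp add: split_beta) meson
    have Fr: "0 < r" "r \<le> 1" if "(c, r) \<in> F" for c r using F(2) that by auto
    obtain \<theta> where "cutoff_off F \<theta>"
      using cutoff_off_exists[OF F(1)] F(2) by fastforce
    note \<theta> = cutoff_offD[OF this]
    have "weak_div \<theta> \<le> 0"
    proof -
      let ?W = "\<Union>(c,r)\<in>F. ball c r"
      have comp: "compact (closure S - ?W)"
        by (intro compact_diff compact_closure_S open_UN ballI) auto
      have "\<forall>x\<in>closure S - ?W. \<exists>r. r > 0 \<and> flux_nonpos_on (ball x r)"
        using good F(3) by blast
      then obtain R where R: "\<forall>x\<in>closure S - ?W. R x > 0 \<and> flux_nonpos_on (ball x (R x))"
        by (rule bchoice[THEN exE])
      have cover: "closure S - ?W \<subseteq> (\<Union>x\<in>closure S - ?W. ball x (R x / 2))"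
      proof
        fix x assume x: "x \<in> closure S - ?W"
        then have "R x > 0" using R by blast
        then have "x \<in> ball x (R x / 2)" by simp
        then show "x \<in> (\<Union>x\<in>closure S - ?W. ball x (R x / 2))" using x by blast
      qed
      obtain T where T: "T \<subseteq> closure S - ?W" "finite T"
        "closure S - ?W \<subseteq> (\<Union>x\<in>T. ball x (R x / 2))"
        by (rule compactE_image[OF comp open_ball cover])
      show ?thesis
      proof (rule weak_div_finite_cover[of "(\<lambda>x. (x, R x)) ` T"])
        show "finite ((\<lambda>x. (x, R x)) ` T)" using T(2) by simp
        show "0 < r \<and> flux_nonpos_on (ball c r)" if "(c, r) \<in> (\<lambda>x. (x, R x)) ` T" for c r
        proof -
          from that have "c \<in> closure S - ?W" "r = R c" using T(1) by blast+
          then show ?thesis using R by blast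
        qed
        show "\<theta> x = 0" if "x \<in> S" "x \<notin> (\<Union>(c,r)\<in>(\<lambda>x. (x, R x)) ` T. ball c (r / 2))" for x
        proof (rule \<theta>(4), rule ccontr)
          assume "x \<notin> ?W"
          then have "x \<in> closure S - ?W" using that(1) closure_subset by auto
          then show False using T(3) that(2) by auto
        qed
      qed (use \<theta> in auto)
    qed
    moreover have "(\<integral>x. indicator S x * vdiv P x \<partial>lborel) - weak_div \<theta> \<le> e"
    proof -
      let ?b = "\<lambda>x. (1 + \<bar>M\<bar>) * (\<Sum>p\<in>F. (1 + 2 / snd p) * indicator (cball (fst p) (2 * snd p)) x)"
      have int1: "integrable lborel (\<lambda>x. indicator S x * vdiv P x)"
        by (rule integrable_continuous_bounded_on_open[OF open_S bounded_S continuous_on_vdiv[OF C1_P] div_bound])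
      have intb: "integrable lborel ?b"
        by (intro integrable_mult_right Bochner_Integration.integrable_sum integral_indicator_cball)
          (auto dest!: Fr(1) intro: less_imp_le)
      have pw: "indicator S x * vdiv P x - indicator S x * integrand \<theta> x \<le> ?b x" for x
      proof (cases "x \<in> S")
        case True
        let ?D = "frechet_derivative \<theta> (at x)"
        let ?s1 = "\<Sum>(c,r)\<in>F. indicator (cball c (2 * r)) x :: real"
        let ?s2 = "\<Sum>(c,r)\<in>F. 2 / r * indicator (cball c (2 * r)) x :: real"
        have M: "M \<ge> 0" using P_bound[OF True] norm_ge_zero order_trans by blast
        have s: "?s1 \<ge> 0" "?s2 \<ge> 0" using Fr(1) by (auto intro!: sum_nonneg simp: less_imp_le)
        have "vdiv P x - integrand \<theta> x = (1 - \<theta> x) * vdiv P x - ?D (P x)"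
          by (simp add: integrand_def algebra_simps)
        also have "\<dots> \<le> \<bar>1 - \<theta> x\<bar> * \<bar>vdiv P x\<bar> + \<bar>?D (P x)\<bar>"
          unfolding abs_mult[symmetric] by linarith
        also have "\<dots> \<le> ?s1 * M + M * ?s2"
        proof (intro add_mono mult_mono)
          show "\<bar>?D (P x)\<bar> \<le> M * ?s2"
            using \<theta>(6)[of x "P x"] mult_right_mono[OF P_bound[OF True] s(2)] by linarith
        qed (use \<theta>(3)[of x] \<theta>(5)[of x] div_bound[OF True] s in auto)
        also have "\<dots> = M * (?s1 + ?s2)" by (simp add: algebra_simps)
        also have "\<dots> \<le> (1 + \<bar>M\<bar>) * (?s1 + ?s2)" using s by (intro mult_right_mono) auto
        also have "?s1 + ?s2 = (\<Sum>p\<in>F. (1 + 2 / snd p) * indicator (cball (fst p) (2 * snd p)) x)"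
          by (simp add: sum.distrib[symmetric] split_beta algebra_simps)
        finally show ?thesis using True by simp
      next
        case False
        then show ?thesis using Fr(1)
          by (auto intro!: mult_nonneg_nonneg sum_nonneg add_nonneg_nonneg simp: less_imp_le)
      qed
      have "(\<integral>x. indicator S x * vdiv P x \<partial>lborel) - weak_div \<theta> =
          (\<integral>x. indicator S x * vdiv P x - indicator S x * integrand \<theta> x \<partial>lborel)"
        unfolding weak_div_def
        by (rule Bochner_Integration.integral_diff[symmetric, OF int1 integrable_integrand[OF \<theta>(1)]])
      also have "\<dots> \<le> (\<integral>x. ?b x \<partial>lborel)"
        by (intro integral_mono Bochner_Integration.integrable_diff int1 integrable_integrand \<theta>(1) intb pw)
      also have "\<dots> = (1 + \<bar>M\<bar>) * (\<Sum>p\<in>F. (1 + 2 / snd p) * ((2 * snd p) ^ N * m))"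
      proof -
        have "(\<integral>x. (\<Sum>p\<in>F. (1 + 2 / snd p) * indicator (cball (fst p) (2 * snd p)) x) \<partial>lborel) =
            (\<Sum>p\<in>F. \<integral>x. (1 + 2 / snd p) * indicator (cball (fst p) (2 * snd p)) x \<partial>lborel)"
          by (rule Bochner_Integration.integral_sum)
            (use Fr in \<open>auto intro!: integrable_mult_right integral_indicator_cball simp: less_imp_le\<close>)
        also have "\<dots> = (\<Sum>p\<in>F. (1 + 2 / snd p) * ((2 * snd p) ^ N * m))"
        proof (rule sum.cong[OF refl])
          fix p assume "p \<in> F"
          then have "0 \<le> 2 * snd p" using Fr(1)[of "fst p" "snd p"] by simp
          then show "(\<integral>x. (1 + 2 / snd p) * indicator (cball (fst p) (2 * snd p)) x \<partial>lborel) =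
              (1 + 2 / snd p) * ((2 * snd p) ^ N * m)"
            using integral_indicator_cball(2)[of "2 * snd p" "fst p"] by (simp add: m_def N_def)
        qed
        finally show ?thesis by simp
      qed
      also have "\<dots> \<le> (1 + \<bar>M\<bar>) * (\<Sum>p\<in>F. 3 * 2 ^ N * (m + 1) * snd p ^ (N - 1))"
      proof (intro mult_left_mono sum_mono)
        fix p assume "p \<in> F"
        then have r: "0 < snd p" "snd p \<le> 1" using Fr[of "fst p" "snd p"] by auto
        have "snd p ^ N = snd p * snd p ^ (N - 1)" using N by (metis Suc_le_D Suc_1 One_nat_def diff_Suc_1 power_Suc)
        then have "(1 + 2 / snd p) * ((2 * snd p) ^ N * m) = (snd p + 2) * (2 ^ N * m * snd p ^ (N - 1))"
          using r by (simp add: power_mult_distrib field_simps)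
        also have "\<dots> \<le> 3 * (2 ^ N * (m + 1) * snd p ^ (N - 1))"
          using r m by (intro mult_mono mult_right_mono mult_left_mono) auto
        finally show "(1 + 2 / snd p) * ((2 * snd p) ^ N * m) \<le> 3 * 2 ^ N * (m + 1) * snd p ^ (N - 1)"
          by simp
      qed auto
      also have "\<dots> = C * (\<Sum>(c,r)\<in>F. r ^ (N - 1))"
        by (simp add: C_def sum_distrib_left split_beta mult.assoc)
      also have "\<dots> \<le> C * (e / C)" using F(4) C by (intro mult_left_mono) auto
      also have "\<dots> = e" using C by simp
      finally show ?thesis .
    qed
    ultimately show "(\<integral>x. indicator S x * vdiv P x \<partial>lborel) \<le> 0 + e" by linarith
  qed
qed

section \<open>Local structure of a piecewise smooth boundary\<close>

lemma regular_function_subset: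
  "regular_function U \<rho> g \<Longrightarrow> open U' \<Longrightarrow> U' \<subseteq> U \<Longrightarrow> regular_function U' \<rho> g"
  unfolding regular_function_def by (auto intro: continuous_on_subset)

lemma regular_function_uminus:
  assumes "regular_function U \<rho> g"
  shows "regular_function U (\<lambda>z. - \<rho> z) (\<lambda>z. - g z)"
proof -
  have d: "((\<lambda>z. - \<rho> z) has_derivative (\<lambda>h. - g z \<bullet> h)) (at z)" if "z \<in> U" for z
    unfolding inner_minus_left
    by (rule has_derivative_minus) (use assms that in \<open>simp add: regular_function_def\<close>)
  show ?thesis using assms unfolding regular_function_def
    by (auto intro!: continuous_on_minus d)
qed

text \<open>Strict differentiability: near \<open>x0\<close> a defining function differs from a linear one by a map with
arbitrarily small Lipschitz constant. All geometric statements about the hypersurface below are read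
off from this one estimate.\<close>

lemma regular_function_strict_derivative:
  assumes reg: "regular_function U \<rho> g" and x0: "x0 \<in> U" and \<kappa>: "\<kappa> > 0"
  obtains r where "r > 0" "ball x0 r \<subseteq> U"
    "\<And>z w. z \<in> ball x0 r \<Longrightarrow> w \<in> ball x0 r \<Longrightarrow> \<bar>\<rho> z - \<rho> w - g x0 \<bullet> (z - w)\<bar> \<le> \<kappa> * norm (z - w)"
proof -
  have U: "open U" and cg: "continuous_on U g" and der: "\<And>z. z \<in> U \<Longrightarrow> (\<rho> has_derivative (\<lambda>h. g z \<bullet> h)) (at z)"
    using reg unfolding regular_function_def by auto
  have "open (U \<inter> (\<lambda>z. norm (g z - g x0)) -` {..<\<kappa>})"
    by (rule continuous_open_preimage) (auto intro!: continuous_intros cg U)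
  moreover have "x0 \<in> U \<inter> (\<lambda>z. norm (g z - g x0)) -` {..<\<kappa>}" using x0 \<kappa> by simp
  ultimately obtain r where r: "r > 0" "ball x0 r \<subseteq> U \<inter> (\<lambda>z. norm (g z - g x0)) -` {..<\<kappa>}"
    using open_contains_ball by metis
  have "\<bar>\<rho> z - \<rho> w - g x0 \<bullet> (z - w)\<bar> \<le> \<kappa> * norm (z - w)" if zw: "z \<in> ball x0 r" "w \<in> ball x0 r" for z w
  proof -
    let ?f = "\<lambda>z. \<rho> z - g x0 \<bullet> z"
    have "norm (?f z - ?f w) \<le> \<kappa> * norm (z - w)"
    proof (rule differentiable_bound[OF convex_ball _ _ zw(1) zw(2)])
      fix z assume z: "z \<in> ball x0 r"
      have "(?f has_derivative (\<lambda>h. g z \<bullet> h - g x0 \<bullet> h)) (at z)"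
        using r z by (intro has_derivative_diff der has_derivative_inner_right has_derivative_ident) auto
      then show "(?f has_derivative (\<lambda>h. g z \<bullet> h - g x0 \<bullet> h)) (at z within ball x0 r)"
        by (rule has_derivative_at_withinI)
      show "onorm (\<lambda>h. g z \<bullet> h - g x0 \<bullet> h) \<le> \<kappa>"
      proof (rule onorm_le)
        fix h
        have "norm (g z \<bullet> h - g x0 \<bullet> h) \<le> norm (g z - g x0) * norm h"
          unfolding inner_diff_left[symmetric] real_norm_def by (rule Cauchy_Schwarz_ineq2)
        also have "\<dots> \<le> \<kappa> * norm h" using r z by (intro mult_right_mono) (auto intro: less_imp_le)
        finally show "norm (g z \<bullet> h - g x0 \<bullet> h) \<le> \<kappa> * norm h" .
      qed
    qed
    then show ?thesis by (simp add: inner_diff_right algebra_simps)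
  qed
  then show ?thesis using that r by blast
qed

text \<open>Each side of a hypersurface is locally connected to a fixed point \<open>p\<close>: one moves against the gradient
by a fixed amount, into a ball that lies entirely on this side, and then straight to its centre.\<close>

lemma hypersurface_side_connected:
  assumes reg: "regular_function U \<rho> g" and x0: "x0 \<in> U" "\<rho> x0 = 0"
  obtains r p where "r > 0" "ball x0 r \<subseteq> U"
    "\<And>z. z \<in> ball x0 r \<Longrightarrow> \<rho> z < 0 \<Longrightarrow>
       \<exists>T. connected T \<and> z \<in> T \<and> p \<in> T \<and> T \<subseteq> {w \<in> U. \<rho> w < 0}"
proof -
  define e where "e = g x0"
  have e: "norm e > 0" using reg x0 unfolding regular_function_def e_def by auto
  obtain R where R: "R > 0" "ball x0 R \<subseteq> U"
    "\<And>z w. z \<in> ball x0 R \<Longrightarrow> w \<in> ball x0 R \<Longrightarrow> \<bar>\<rho> z - \<rho> w - e \<bullet> (z - w)\<bar> \<le> norm e / 2 * norm (z - w)"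
    using regular_function_strict_derivative[OF reg x0(1), of "norm e / 2"] e unfolding e_def by auto
  \<comment> \<open>the step \<open>s e\<close> has length \<open>R / 2\<close>, long compared with the radius \<open>R / 8\<close> of the neighbourhood but
    still inside the ball where \<open>\<rho>\<close> is nearly linear\<close>
  define s where "s = R / (2 * norm e)"
  have s: "s > 0" "s * norm e = R / 2" using R(1) e by (auto simp: s_def)
  define r where "r = R / 8"
  have r: "r > 0" using R by (simp add: r_def)
  define p where "p = x0 - s *\<^sub>R e"
  have ee: "e \<bullet> e = norm e * norm e" by (simp add: power2_norm_eq_inner[symmetric] power2_eq_square)
  have side: "\<exists>T. connected T \<and> z \<in> T \<and> p \<in> T \<and> T \<subseteq> {w \<in> U. \<rho> w < 0}"
    if z: "z \<in> ball x0 r" and neg: "\<rho> z < 0" for z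
  proof -
    have zn: "norm (z - x0) < R / 8" using z by (simp add: r_def dist_norm norm_minus_commute)
    define q where "q = z - s *\<^sub>R e"
    let ?T = "closed_segment z q \<union> closed_segment q p"
    have "connected ?T" by (rule connected_Un) auto
    moreover have "closed_segment z q \<subseteq> {w \<in> U. \<rho> w < 0}"
    proof
      fix w assume "w \<in> closed_segment z q"
      then obtain u where u: "0 \<le> u" "u \<le> 1" and w: "w = (1 - u) *\<^sub>R z + u *\<^sub>R q"
        unfolding in_segment by blast
      define t where "t = u * s"
      have t: "0 \<le> t" "t \<le> s" using u s by (auto simp: t_def mult_left_le_one_le)
      have w': "w = z - t *\<^sub>R e" unfolding w q_def t_def by (simp add: algebra_simps)
      have "norm (w - x0) \<le> norm (z - x0) + norm (t *\<^sub>R e)"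
        unfolding w' using norm_triangle_ineq4[of "z - x0" "t *\<^sub>R e"] by (simp add: algebra_simps)
      also have "norm (t *\<^sub>R e) \<le> s * norm e" using t by (simp add: mult_right_mono)
      finally have "norm (w - x0) < R" using zn s R(1) by linarith
      then have wR: "w \<in> ball x0 R" by (simp add: dist_norm norm_minus_commute)
      have zR: "z \<in> ball x0 R" using zn R(1) by (simp add: dist_norm norm_minus_commute)
      have "\<bar>\<rho> w - \<rho> z - e \<bullet> (w - z)\<bar> \<le> norm e / 2 * norm (w - z)" by (rule R(3)[OF wR zR])
      then have "\<bar>\<rho> w - \<rho> z + t * (norm e * norm e)\<bar> \<le> norm e / 2 * (t * norm e)"
        using t by (simp add: w' ee)
      moreover have "norm e / 2 * (t * norm e) = t * (norm e * norm e) / 2" by simp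
      ultimately have "\<rho> w \<le> \<rho> z - t * (norm e * norm e) / 2" by linarith
      also have "\<dots> \<le> \<rho> z" using t by simp
      finally show "w \<in> {w \<in> U. \<rho> w < 0}" using neg wR R(2) by auto
    qed
    moreover have "closed_segment q p \<subseteq> {w \<in> U. \<rho> w < 0}"
    proof
      have qp: "closed_segment q p \<subseteq> ball p r"
        using z r by (intro closed_segment_subset) (auto simp: q_def p_def dist_norm)
      fix w assume "w \<in> closed_segment q p"
      then have wp: "norm (w - p) < R / 8" using qp by (auto simp: r_def dist_norm norm_minus_commute)
      have eq: "w - x0 = (w - p) - s *\<^sub>R e" by (simp add: p_def)
      have n: "norm (w - x0) \<le> norm (w - p) + s * norm e"
        unfolding eq using norm_triangle_ineq4[of "w - p" "s *\<^sub>R e"] s by simp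
      then have wR: "w \<in> ball x0 R" using wp s R(1) by (simp add: dist_norm norm_minus_commute)
      have "\<bar>\<rho> w - \<rho> x0 - e \<bullet> (w - x0)\<bar> \<le> norm e / 2 * norm (w - x0)"
        by (rule R(3)[OF wR]) (use R(1) in simp)
      also have "\<dots> \<le> norm e / 2 * (norm (w - p) + s * norm e)" using n by (intro mult_left_mono) auto
      finally have "\<rho> w \<le> e \<bullet> (w - x0) + norm e / 2 * (norm (w - p) + s * norm e)" using x0(2) by linarith
      also have "e \<bullet> (w - x0) = e \<bullet> (w - p) - s * (norm e * norm e)"
        unfolding eq by (simp add: inner_diff_right ee)
      also have "e \<bullet> (w - p) \<le> norm e * norm (w - p)" by (rule norm_cauchy_schwarz)
      finally have "\<rho> w \<le> norm e * (norm (w - p) - s * norm e + (norm (w - p) + s * norm e) / 2)"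
        by (simp add: field_simps)
      also have "\<dots> < 0"
      proof (rule mult_pos_neg[OF e])
        show "norm (w - p) - s * norm e + (norm (w - p) + s * norm e) / 2 < 0"
          unfolding s(2) using wp R(1) by (simp add: field_simps)
      qed
      finally show "w \<in> {w \<in> U. \<rho> w < 0}" using wR R(2) by auto
    qed
    ultimately show ?thesis by (intro exI[of _ ?T]) auto
  qed
  have "ball x0 r \<subseteq> U" using R by (auto simp: r_def)
  then show ?thesis using that r side by blast
qed

text \<open>Each of the two sides lies entirely inside or entirely outside \<open>\<Omega>\<close>, since it is connected and avoids the
frontier. Both inside would make \<open>x0\<close> an interior point; both outside would contradict that \<open>\<Omega>\<close> is the
closure of its interior. So \<open>\<Omega>\<close> is exactly one side, and outward normals exist near \<open>x0\<close>.\<close>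

lemma region_at_hypersurface_point:
  assumes \<Omega>: "closed \<Omega>" "\<Omega> \<subseteq> closure (interior \<Omega>)" and reg: "regular_function U \<rho> g"
    and x0: "x0 \<in> U" "x0 \<in> frontier \<Omega>" and fr: "frontier \<Omega> \<inter> U = {z \<in> U. \<rho> z = 0}"
  obtains U' \<rho>' g' where "regular_function U' \<rho>' g'" "x0 \<in> U'" "U' \<subseteq> U" "\<rho>' x0 = 0"
    "\<Omega> \<inter> U' = {z \<in> U'. \<rho>' z \<le> 0}" "frontier \<Omega> \<inter> U' = {z \<in> U'. \<rho>' z = 0}"
proof -
  have \<rho>0: "\<rho> x0 = 0" using x0 fr by auto
  obtain r1 p1 where 1: "r1 > 0" "ball x0 r1 \<subseteq> U"
    "\<And>z. z \<in> ball x0 r1 \<Longrightarrow> \<rho> z < 0 \<Longrightarrow> \<exists>T. connected T \<and> z \<in> T \<and> p1 \<in> T \<and> T \<subseteq> {w \<in> U. \<rho> w < 0}"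
    using hypersurface_side_connected[OF reg x0(1) \<rho>0] by blast
  obtain r2 p2 where 2: "r2 > 0" "ball x0 r2 \<subseteq> U"
    "\<And>z. z \<in> ball x0 r2 \<Longrightarrow> - \<rho> z < 0 \<Longrightarrow> \<exists>T. connected T \<and> z \<in> T \<and> p2 \<in> T \<and> T \<subseteq> {w \<in> U. - \<rho> w < 0}"
    using hypersurface_side_connected[OF regular_function_uminus[OF reg] x0(1)] \<rho>0 by auto
  define B where "B = ball x0 (min r1 r2)"
  have B: "open B" "B \<subseteq> U" "x0 \<in> B" using 1 2 by (auto simp: B_def)
  have same: "z \<in> \<Omega> \<longleftrightarrow> p \<in> \<Omega>" if "connected T" "z \<in> T" "p \<in> T" "T \<inter> frontier \<Omega> = {}" for T z p
    using connected_Int_frontier[OF that(1), of \<Omega>] that by blast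
  have off: "{w \<in> U. \<rho> w < 0} \<inter> frontier \<Omega> = {}" "{w \<in> U. - \<rho> w < 0} \<inter> frontier \<Omega> = {}"
  proof -
    have "\<rho> w = 0" if "w \<in> U" "w \<in> frontier \<Omega>" for w using that fr by blast
    then show "{w \<in> U. \<rho> w < 0} \<inter> frontier \<Omega> = {}" "{w \<in> U. - \<rho> w < 0} \<inter> frontier \<Omega> = {}"
      by force+
  qed
  have neg: "z \<in> \<Omega> \<longleftrightarrow> p1 \<in> \<Omega>" if z: "z \<in> B" "\<rho> z < 0" for z
  proof -
    obtain T where "connected T" "z \<in> T" "p1 \<in> T" "T \<subseteq> {w \<in> U. \<rho> w < 0}"
      using 1(3)[of z] z by (auto simp: B_def)
    then show ?thesis using off by (intro same[of T]) blast+
  qed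
  have pos: "z \<in> \<Omega> \<longleftrightarrow> p2 \<in> \<Omega>" if z: "z \<in> B" "\<rho> z > 0" for z
  proof -
    obtain T where "connected T" "z \<in> T" "p2 \<in> T" "T \<subseteq> {w \<in> U. - \<rho> w < 0}"
      using 2(3)[of z] z by (auto simp: B_def)
    then show ?thesis using off by (intro same[of T]) blast+
  qed
  have zero: "z \<in> \<Omega>" if "z \<in> B" "\<rho> z = 0" for z
    using that fr B(2) \<Omega>(1) frontier_subset_closed by blast
  have frB: "frontier \<Omega> \<inter> B = {z \<in> B. \<rho> z = 0}" using fr B(2) by blast
  have regB: "regular_function B \<rho> g" by (rule regular_function_subset[OF reg B(1,2)])
  have not_both_in: "\<not> (p1 \<in> \<Omega> \<and> p2 \<in> \<Omega>)"
  proof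
    assume "p1 \<in> \<Omega> \<and> p2 \<in> \<Omega>"
    then have "z \<in> \<Omega>" if "z \<in> B" for z
      using neg[OF that] pos[OF that] zero[OF that]
      by (cases "\<rho> z" "0::real" rule: linorder_cases) auto
    then have "B \<subseteq> \<Omega>" by blast
    then have "x0 \<in> interior \<Omega>" using B interiorI by blast
    then show False using x0(2) by (simp add: frontier_def)
  qed
  have not_both_out: "p1 \<in> \<Omega> \<or> p2 \<in> \<Omega>"
  proof (rule ccontr)
    assume "\<not> ?thesis"
    then have "\<rho> z = 0" if "z \<in> B" "z \<in> \<Omega>" for z
      using neg[OF that(1)] pos[OF that(1)] that(2)
      by (cases "\<rho> z" "0::real" rule: linorder_cases) auto
    then have "\<Omega> \<inter> B \<subseteq> frontier \<Omega>" using frB by blast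
    then have "B \<inter> interior \<Omega> = {}" using interior_subset[of \<Omega>] by (auto simp: frontier_def)
    moreover have "x0 \<in> closure (interior \<Omega>)"
      using x0(2) \<Omega> frontier_subset_closed by blast
    ultimately show False using B open_Int_closure_eq_empty[OF B(1), of "interior \<Omega>"] by blast
  qed
  show ?thesis
  proof (cases "p1 \<in> \<Omega>")
    case True
    then have "p2 \<notin> \<Omega>" using not_both_in by blast
    then have "z \<in> \<Omega> \<longleftrightarrow> \<rho> z \<le> 0" if "z \<in> B" for z
      using neg[OF that] pos[OF that] zero[OF that] True
      by (cases "\<rho> z" "0::real" rule: linorder_cases) auto
    then have "\<Omega> \<inter> B = {z \<in> B. \<rho> z \<le> 0}" by blast
    then show ?thesis using that[OF regB B(3,2) \<rho>0] frB by blast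
  next
    case False
    then have p2: "p2 \<in> \<Omega>" using not_both_out by blast
    then have "z \<in> \<Omega> \<longleftrightarrow> - \<rho> z \<le> 0" if "z \<in> B" for z
      using neg[OF that] pos[OF that] zero[OF that] False
      by (cases "\<rho> z" "0::real" rule: linorder_cases) auto
    then have "\<Omega> \<inter> B = {z \<in> B. - \<rho> z \<le> 0}" by blast
    moreover have "frontier \<Omega> \<inter> B = {z \<in> B. - \<rho> z = 0}" using frB by auto
    ultimately show ?thesis using that[OF regular_function_uminus[OF regB] B(3,2)] \<rho>0 by simp
  qed
qed

definition smooth_boundary_chart ::
    "(real^'n) set \<Rightarrow> (real^'n) set \<Rightarrow> (real^'n) set \<Rightarrow> (real^'n \<Rightarrow> real) \<Rightarrow> (real^'n \<Rightarrow> real^'n) \<Rightarrow> bool" where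
  "smooth_boundary_chart \<Omega> M U \<rho> g \<longleftrightarrow> regular_function U \<rho> g \<and>
     \<Omega> \<inter> U = {z \<in> U. \<rho> z \<le> 0} \<and> frontier \<Omega> \<inter> U = {z \<in> U. \<rho> z = 0} \<and> frontier \<Omega> \<inter> U \<subseteq> M"

lemma smooth_boundary_chart_interior:
  assumes "smooth_boundary_chart \<Omega> M U \<rho> g"
  shows "interior \<Omega> \<inter> U = {z \<in> U. \<rho> z < 0}"
proof -
  have "interior \<Omega> \<inter> U = (\<Omega> \<inter> U) - (frontier \<Omega> \<inter> U)"
    using interior_subset[of \<Omega>] closure_subset[of \<Omega>] by (auto simp: frontier_def)
  then show ?thesis using assms unfolding smooth_boundary_chart_def by auto
qed

text \<open>Off the edges of both surfaces a point of \<open>M1\<close> belongs to \<open>R1\<close> and has positive distance from \<open>M2\<close>,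
so the frontier coincides there with the smooth hypersurface \<open>R1\<close>.\<close>

lemma smooth_boundary_chart_exists:
  assumes \<Omega>: "closed \<Omega>" "\<Omega> \<subseteq> closure (interior \<Omega>)"
    and fr: "frontier \<Omega> = M1 \<union> M2" "M1 \<inter> M2 = {}"
    and R1: "smooth_hypersurface R1" "R1 \<subseteq> M1" "M1 \<subseteq> closure R1"
    and R2: "R2 \<subseteq> M2" "M2 \<subseteq> closure R2"
    and x: "x \<in> M1" "x \<notin> closure R1 - R1" "x \<notin> closure R2 - R2"
  obtains U \<rho> g where "smooth_boundary_chart \<Omega> M1 U \<rho> g" "x \<in> U"
proof -
  have xR1: "x \<in> R1" and xR2: "x \<notin> closure R2" using x R1 R2 fr(2) by auto
  obtain U \<rho> g where U: "regular_function U \<rho> g" "x \<in> U" "R1 \<inter> U = {z \<in> U. \<rho> z = 0}"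
    using R1(1) xR1 unfolding smooth_hypersurface_def by blast
  define U' where "U' = U - closure R2"
  have opU: "open U" using U(1) by (simp add: regular_function_def)
  have opU': "open U'" unfolding U'_def using opU by (intro open_Diff) auto
  have reg': "regular_function U' \<rho> g" by (rule regular_function_subset[OF U(1) opU']) (auto simp: U'_def)
  have closed_in: "closure R1 \<inter> U \<subseteq> R1"
  proof
    fix z assume z: "z \<in> closure R1 \<inter> U"
    have c: "continuous_on U \<rho>" by (rule C1_on_continuous_on[OF C1_on_regular_function[OF U(1)]])
    have op: "open (U \<inter> \<rho> -` (- {0}))" by (rule continuous_open_preimage[OF c opU]) auto
    show "z \<in> R1"
    proof (rule ccontr)
      assume "z \<notin> R1"
      then have "z \<in> U \<inter> \<rho> -` (- {0})" using z U(3) by auto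
      moreover have "(U \<inter> \<rho> -` (- {0})) \<inter> R1 = {}" using U(3) by auto
      ultimately show False using z open_Int_closure_eq_empty[OF op, of R1] by blast
    qed
  qed
  have frU': "frontier \<Omega> \<inter> U' = {z \<in> U'. \<rho> z = 0}"
    using fr(1) R1 R2 closed_in U(3) unfolding U'_def by blast
  have sub: "frontier \<Omega> \<inter> U' \<subseteq> M1" using fr(1) R2 unfolding U'_def by blast
  have xU': "x \<in> U'" using U(2) xR2 by (simp add: U'_def)
  have xfr: "x \<in> frontier \<Omega>" using x fr by simp
  show ?thesis
  proof (rule region_at_hypersurface_point[OF \<Omega> reg' xU' xfr frU'])
    fix V \<rho>' g' assume "regular_function V \<rho>' g'" "x \<in> V" "V \<subseteq> U'" "\<rho>' x = 0"
      "\<Omega> \<inter> V = {z \<in> V. \<rho>' z \<le> 0}" "frontier \<Omega> \<inter> V = {z \<in> V. \<rho>' z = 0}"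
    then show ?thesis using that[of V \<rho>' g'] sub unfolding smooth_boundary_chart_def by blast
  qed
qed

theorem partitioned_region_charts:
  assumes "partitioned_region \<Omega> \<D> \<L>"
  obtains E where "codim1_null E"
    "\<And>x. x \<in> frontier \<Omega> \<Longrightarrow> x \<notin> E \<Longrightarrow> \<exists>U \<rho> g. x \<in> U \<and>
       (smooth_boundary_chart \<Omega> \<D> U \<rho> g \<or> smooth_boundary_chart \<Omega> \<L> U \<rho> g)"
proof -
  have \<Omega>: "closed \<Omega>" "\<Omega> \<subseteq> closure (interior \<Omega>)"
    and fr: "frontier \<Omega> = \<D> \<union> \<L>" "\<D> \<inter> \<L> = {}"
    using assms compact_imp_closed unfolding partitioned_region_def by auto
  obtain RD where RD: "smooth_hypersurface RD" "edge_set (closure RD - RD)" "RD \<subseteq> \<D>" "\<D> \<subseteq> closure RD"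
    using assms unfolding partitioned_region_def piecewise_smooth_hypersurface_def by blast
  obtain RL where RL: "smooth_hypersurface RL" "edge_set (closure RL - RL)" "RL \<subseteq> \<L>" "\<L> \<subseteq> closure RL"
    using assms unfolding partitioned_region_def piecewise_smooth_hypersurface_def by blast
  let ?E = "(closure RD - RD) \<union> (closure RL - RL)"
  show ?thesis
  proof (rule that)
    show "codim1_null ?E" by (intro codim1_null_Un codim1_null_edge_set RD RL)
    fix x assume x: "x \<in> frontier \<Omega>" "x \<notin> ?E"
    then consider "x \<in> \<D>" | "x \<in> \<L>" using fr by blast
    then show "\<exists>U \<rho> g. x \<in> U \<and> (smooth_boundary_chart \<Omega> \<D> U \<rho> g \<or> smooth_boundary_chart \<Omega> \<L> U \<rho> g)"
    proof cases
      case 1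
      obtain U \<rho> g where "smooth_boundary_chart \<Omega> \<D> U \<rho> g" "x \<in> U"
        by (rule smooth_boundary_chart_exists[OF \<Omega> fr RD(1,3,4) RL(3,4) 1]) (use x in auto)
      then show ?thesis by blast
    next
      case 2
      have fr': "frontier \<Omega> = \<L> \<union> \<D>" "\<L> \<inter> \<D> = {}" using fr by auto
      obtain U \<rho> g where "smooth_boundary_chart \<Omega> \<L> U \<rho> g" "x \<in> U"
        by (rule smooth_boundary_chart_exists[OF \<Omega> fr' RL(1,3,4) RD(3,4) 2]) (use x in auto)
      then show ?thesis by blast
    qed
  qed
qed

text \<open>The divergence inequality on a region: it remains to bound the flux in charts that lie entirely in one
of the two boundary parts.\<close>

lemma integral_divergence_nonpos_partitioned:
  fixes \<Omega> :: "(real^'n) set"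
  assumes region: "partitioned_region \<Omega> \<D> \<L>" and bf: "bounded_field (interior \<Omega>) P M"
    and flux: "\<And>U \<rho> g x e. smooth_boundary_chart \<Omega> \<D> U \<rho> g \<or> smooth_boundary_chart \<Omega> \<L> U \<rho> g \<Longrightarrow>
      x \<in> U \<Longrightarrow> \<rho> x = 0 \<Longrightarrow> 0 < e \<Longrightarrow> \<exists>d>0. \<forall>z\<in>interior \<Omega> \<inter> ball x d. P z \<bullet> g z \<le> e"
  shows "(\<integral>x. indicator (interior \<Omega>) x * vdiv P x \<partial>lborel) \<le> 0"
proof -
  have \<Omega>: "compact \<Omega>" "closure (interior \<Omega>) = \<Omega>" using region by (auto simp: partitioned_region_def)
  obtain E where E: "codim1_null E" "\<And>x. x \<in> frontier \<Omega> \<Longrightarrow> x \<notin> E \<Longrightarrow> \<exists>U \<rho> g. x \<in> U \<and>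
       (smooth_boundary_chart \<Omega> \<D> U \<rho> g \<or> smooth_boundary_chart \<Omega> \<L> U \<rho> g)"
    using partitioned_region_charts[OF region] by blast
  show ?thesis
  proof (rule bounded_field.integral_divergence_nonpos[OF bf E(1)])
    fix x assume "x \<in> closure (interior \<Omega>)" "x \<notin> interior \<Omega>" "x \<notin> E"
    then have "x \<in> frontier \<Omega>" using \<Omega> by (simp add: frontier_def compact_imp_closed)
    then obtain U \<rho> g where U: "x \<in> U" "smooth_boundary_chart \<Omega> \<D> U \<rho> g \<or> smooth_boundary_chart \<Omega> \<L> U \<rho> g"
      using E(2) \<open>x \<notin> E\<close> by blast
    have reg: "regular_function U \<rho> g" using U(2) unfolding smooth_boundary_chart_def by blast
    have SU: "interior \<Omega> \<inter> U = {z \<in> U. \<rho> z < 0}" using U(2) smooth_boundary_chart_interior by blast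
    show "\<exists>U \<rho> g. regular_function U \<rho> g \<and> x \<in> U \<and> interior \<Omega> \<inter> U = {z \<in> U. \<rho> z < 0} \<and>
        (\<forall>x\<in>U. \<rho> x = 0 \<longrightarrow> (\<forall>e>0. \<exists>d>0. \<forall>z\<in>interior \<Omega> \<inter> ball x d. P z \<bullet> g z \<le> e))"
      by (rule exI[of _ U], rule exI[of _ \<rho>], rule exI[of _ g])
        (intro conjI reg U(1) SU ballI impI allI flux[OF U(2)])
  qed
qed

section \<open>Symmetry of second derivatives\<close>

lemma line_has_real_derivative:
  fixes f :: "'a::real_normed_vector \<Rightarrow> real"
  assumes "(f has_derivative f') (at (p + t *\<^sub>R u))"
  shows "((\<lambda>t. f (p + t *\<^sub>R u)) has_real_derivative f' u) (at t)"
proof -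
  have lin: "linear f'" using assms has_derivative_linear by blast
  have "((\<lambda>t. p + t *\<^sub>R u) has_derivative (\<lambda>t. t *\<^sub>R u)) (at t)"
    by (auto intro!: derivative_eq_intros)
  from has_derivative_compose[OF this assms]
  have "((\<lambda>t. f (p + t *\<^sub>R u)) has_derivative (\<lambda>t. f' (t *\<^sub>R u))) (at t)" .
  then show ?thesis
    unfolding has_field_derivative_def by (simp add: linear_scale[OF lin] mult.commute[of _ "f' u"])
qed

text \<open>The mean value theorem applied first in direction \<open>u\<close> and then in direction \<open>v\<close>. The left-hand side is
symmetric in \<open>u\<close> and \<open>v\<close>, which yields the symmetry of second derivatives.\<close>

lemma second_difference_mean_value:
  fixes f :: "'a::euclidean_space \<Rightarrow> real"
  assumes f: "C1_on U f" and A: "C1_on U (\<lambda>z. frechet_derivative f (at z) u)"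
    and s: "s > 0" and sub: "cball x (s * (norm u + norm v)) \<subseteq> U"
  obtains \<xi> where "\<xi> \<in> cball x (s * (norm u + norm v))"
    "f (x + s *\<^sub>R u + s *\<^sub>R v) - f (x + s *\<^sub>R u) - f (x + s *\<^sub>R v) + f x =
      s * s * frechet_derivative (\<lambda>z. frechet_derivative f (at z) u) (at \<xi>) v"
proof -
  let ?A = "\<lambda>z. frechet_derivative f (at z) u"
  have mem: "x + a *\<^sub>R u + b *\<^sub>R v \<in> cball x (s * (norm u + norm v))"
    if "0 \<le> a" "a \<le> s" "0 \<le> b" "b \<le> s" for a b
  proof -
    have "norm (a *\<^sub>R u + b *\<^sub>R v) \<le> norm (a *\<^sub>R u) + norm (b *\<^sub>R v)" by (rule norm_triangle_ineq)
    also have "\<dots> \<le> s * norm u + s * norm v"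
      using that by (intro add_mono) (auto intro!: mult_right_mono)
    finally have "norm (a *\<^sub>R u + b *\<^sub>R v) \<le> s * (norm u + norm v)" by (simp add: distrib_left)
    then show ?thesis by (subst mem_cball, subst dist_commute) (simp add: dist_norm add.assoc)
  qed
  let ?g = "\<lambda>a. f ((x + s *\<^sub>R v) + a *\<^sub>R u) - f (x + a *\<^sub>R u)"
  have "\<exists>a. 0 < a \<and> a < s \<and> ?g s - ?g 0 = (s - 0) * (?A ((x + s *\<^sub>R v) + a *\<^sub>R u) - ?A (x + a *\<^sub>R u))"
  proof (rule MVT2[OF s])
    fix a assume a: "0 \<le> a" "a \<le> s"
    have "(x + s *\<^sub>R v) + a *\<^sub>R u \<in> U" "x + a *\<^sub>R u \<in> U"
      using mem[of a s] mem[of a 0] a s sub by (auto simp: algebra_simps)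
    then show "(?g has_real_derivative ?A ((x + s *\<^sub>R v) + a *\<^sub>R u) - ?A (x + a *\<^sub>R u)) (at a)"
      by (intro DERIV_diff line_has_real_derivative C1_on_has_derivative[OF f])
  qed
  then obtain a where a: "0 < a" "a < s"
    "?g s - ?g 0 = s * (?A ((x + s *\<^sub>R v) + a *\<^sub>R u) - ?A (x + a *\<^sub>R u))" by auto
  let ?h = "\<lambda>b. ?A ((x + a *\<^sub>R u) + b *\<^sub>R v)"
  have "\<exists>b. 0 < b \<and> b < s \<and> ?h s - ?h 0 = (s - 0) * frechet_derivative ?A (at ((x + a *\<^sub>R u) + b *\<^sub>R v)) v"
  proof (rule MVT2[OF s])
    fix b assume b: "0 \<le> b" "b \<le> s"
    have "(x + a *\<^sub>R u) + b *\<^sub>R v \<in> U" using mem[of a b] a b sub by auto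
    then show "(?h has_real_derivative frechet_derivative ?A (at ((x + a *\<^sub>R u) + b *\<^sub>R v)) v) (at b)"
      by (intro line_has_real_derivative C1_on_has_derivative[OF A])
  qed
  then obtain b where b: "0 < b" "b < s"
    "?h s - ?h 0 = s * frechet_derivative ?A (at ((x + a *\<^sub>R u) + b *\<^sub>R v)) v" by auto
  show ?thesis
  proof (rule that[OF mem[of a b]])
    have "f (x + s *\<^sub>R u + s *\<^sub>R v) - f (x + s *\<^sub>R u) - f (x + s *\<^sub>R v) + f x = ?g s - ?g 0"
      by (simp add: algebra_simps)
    also have "\<dots> = s * (?h s - ?h 0)" unfolding a(3) by (simp add: algebra_simps)
    also have "\<dots> = s * s * frechet_derivative ?A (at (x + a *\<^sub>R u + b *\<^sub>R v)) v" unfolding b(3) by simp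
    finally show "f (x + s *\<^sub>R u + s *\<^sub>R v) - f (x + s *\<^sub>R u) - f (x + s *\<^sub>R v) + f x =
      s * s * frechet_derivative ?A (at (x + a *\<^sub>R u + b *\<^sub>R v)) v" .
  qed (use a b in auto)
qed

lemma second_derivative_symmetric_real:
  fixes f :: "'a::euclidean_space \<Rightarrow> real"
  assumes U: "open U" "x \<in> U" and f: "C1_on U f"
    and A: "\<And>u. C1_on U (\<lambda>z. frechet_derivative f (at z) u)"
  shows "frechet_derivative (\<lambda>z. frechet_derivative f (at z) u) (at x) v =
    frechet_derivative (\<lambda>z. frechet_derivative f (at z) v) (at x) u"
proof -
  obtain r where r: "r > 0" "cball x r \<subseteq> U" using U open_contains_cball by metis
  define c where "c = norm u + norm v + 1"
  have c: "c > 0" unfolding c_def by (intro add_nonneg_pos) auto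
  define s where "s n = r / c * inverse (real (Suc n))" for n
  have s: "s n > 0" for n using r c by (simp add: s_def)
  have s_lim: "s \<longlonglongrightarrow> 0"
    unfolding s_def[abs_def] by (rule tendsto_mult_right_zero[OF LIMSEQ_inverse_real_of_nat])
  have sr: "s n * (norm u + norm v) \<le> r" for n
  proof -
    have "s n * (norm u + norm v) \<le> r / c * 1 * c"
      unfolding s_def using r c by (intro mult_mono mult_left_mono) (auto simp: c_def field_simps)
    then show ?thesis using c by simp
  qed
  let ?q = "\<lambda>n. f (x + s n *\<^sub>R u + s n *\<^sub>R v) - f (x + s n *\<^sub>R u) - f (x + s n *\<^sub>R v) + f x"
  have lim: "(\<lambda>n. ?q n / (s n * s n)) \<longlonglongrightarrow> frechet_derivative (\<lambda>z. frechet_derivative f (at z) a) (at x) b"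
    if ab: "(a = u \<and> b = v) \<or> (a = v \<and> b = u)" for a b
  proof -
    have q: "?q n = f (x + s n *\<^sub>R a + s n *\<^sub>R b) - f (x + s n *\<^sub>R a) - f (x + s n *\<^sub>R b) + f x" for n
      using ab by (auto simp: algebra_simps)
    have nab: "norm a + norm b = norm u + norm v" using ab by auto
    have "\<exists>\<xi>. \<xi> \<in> cball x (s n * (norm a + norm b)) \<and>
        ?q n = s n * s n * frechet_derivative (\<lambda>z. frechet_derivative f (at z) a) (at \<xi>) b" for n
    proof -
      have "cball x (s n * (norm a + norm b)) \<subseteq> U" using sr[of n] r nab by auto
      from second_difference_mean_value[OF f A s this] show ?thesis unfolding q by metis
    qed
    then obtain \<xi> where \<xi>: "\<And>n. \<xi> n \<in> cball x (s n * (norm a + norm b))"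
      "\<And>n. ?q n = s n * s n * frechet_derivative (\<lambda>z. frechet_derivative f (at z) a) (at (\<xi> n)) b" by metis
    have "\<xi> \<longlonglongrightarrow> x"
    proof (rule Lim_transform_bound[where g="\<lambda>n. s n * (norm a + norm b)", THEN LIM_zero_cancel])
      show "\<forall>\<^sub>F n in sequentially. norm (\<xi> n - x) \<le> norm (s n * (norm a + norm b))"
        using \<xi>(1) s by (intro always_eventually) (auto simp: dist_norm norm_minus_commute abs_mult less_imp_le)
      show "(\<lambda>n. s n * (norm a + norm b)) \<longlonglongrightarrow> 0" by (rule tendsto_mult_left_zero[OF s_lim])
    qed
    moreover have "isCont (\<lambda>z. frechet_derivative (\<lambda>z. frechet_derivative f (at z) a) (at z) b) x"
      using C1_on_continuous_derivative[OF A continuous_on_const[of U b]] U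
      by (simp add: continuous_on_eq_continuous_at)
    ultimately have "(\<lambda>n. frechet_derivative (\<lambda>z. frechet_derivative f (at z) a) (at (\<xi> n)) b) \<longlonglongrightarrow>
        frechet_derivative (\<lambda>z. frechet_derivative f (at z) a) (at x) b"
      by (rule isCont_tendsto_compose[rotated])
    moreover have "?q n / (s n * s n) = frechet_derivative (\<lambda>z. frechet_derivative f (at z) a) (at (\<xi> n)) b" for n
      unfolding \<xi>(2) using s[of n] by simp
    ultimately show ?thesis by simp
  qed
  show ?thesis using LIMSEQ_unique[OF lim lim] by blast
qed

section \<open>Stress and deformation gradient\<close>

lemma inner_matrix_sum: "(A::real^'n^'m) \<bullet> B = (\<Sum>i\<in>UNIV. \<Sum>j\<in>UNIV. A $ i $ j * B $ i $ j)"
  by (simp add: inner_vec_def)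

lemma matrix_expansion: "(A::real^'n^'m) = (\<Sum>i\<in>UNIV. \<Sum>j\<in>UNIV. A $ i $ j *\<^sub>R axis i (axis j 1))"
proof -
  have "(\<Sum>i\<in>UNIV. \<Sum>j\<in>UNIV. A $ i $ j *\<^sub>R axis i (axis j 1)) $ k $ l = A $ k $ l" for k l
  proof -
    have "(\<Sum>i\<in>UNIV. \<Sum>j\<in>UNIV. A $ i $ j *\<^sub>R axis i (axis j 1)) $ k $ l =
        (\<Sum>i\<in>UNIV. \<Sum>j\<in>UNIV. if i = k \<and> j = l then A $ i $ j else 0)"
      by (auto simp: axis_def intro!: sum.cong)
    also have "\<dots> = (\<Sum>i\<in>UNIV. if i = k then (\<Sum>j\<in>UNIV. if j = l then A $ i $ j else 0) else 0)"
      by (intro sum.cong refl) auto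
    also have "\<dots> = A $ k $ l" by simp
    finally show ?thesis .
  qed
  then show ?thesis by (simp add: vec_eq_iff)
qed

lemma open_Lin_plus: "open (Lin_plus :: (real^'n^'n) set)"
proof -
  have "continuous_on UNIV (\<lambda>A::real^'n^'n. det A)"
    unfolding det_def by (intro continuous_intros)
  then have "open ((\<lambda>A::real^'n^'n. det A) -` {0<..})"
    by (intro open_vimage) auto
  then show ?thesis by (simp add: Lin_plus_def vimage_def)
qed

lemma C2_on_imp_C1_on: "C2_on U f \<Longrightarrow> C1_on U f"
  unfolding C1_on_def[of U f] C2_on_def using C1_on_continuous_on by blast

lemma C2_on_derivative_C1_on:
  assumes "C2_on U f" "open U"
  shows "C1_on U (\<lambda>z. frechet_derivative f (at z) u)"
proof -
  obtain f' where f': "\<And>x. x \<in> U \<Longrightarrow> (f has_derivative blinfun_apply (f' x)) (at x)" "C1_on U f'"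
    using assms(1) unfolding C2_on_def by blast
  have "C1_on U (\<lambda>x. blinfun_apply (f' x) u)"
    by (rule C1_on_linear_compose[OF _ f'(2)]) (rule blinfun.bounded_linear_left)
  then show ?thesis
    by (rule C1_on_cong[OF assms(2), rotated])
      (simp add: frechet_derivative_at[OF f'(1), symmetric])
qed

lemma derivative_eq_stress:
  assumes "C1_on Lin_plus W" "F \<in> Lin_plus"
  shows "frechet_derivative W (at F) H = stress W F \<bullet> H"
proof -
  have lin: "linear (frechet_derivative W (at F))"
    by (rule has_derivative_linear[OF C1_on_has_derivative[OF assms]])
  have "frechet_derivative W (at F) H = frechet_derivative W (at F) (\<Sum>i\<in>UNIV. \<Sum>j\<in>UNIV. H $ i $ j *\<^sub>R axis i (axis j 1))"
    using matrix_expansion[of H] by simp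
  also have "\<dots> = (\<Sum>i\<in>UNIV. \<Sum>j\<in>UNIV. H $ i $ j * frechet_derivative W (at F) (axis i (axis j 1)))"
    by (simp add: linear_sum[OF lin] linear_scale[OF lin])
  also have "\<dots> = stress W F \<bullet> H"
    by (simp add: inner_matrix_sum stress_def mult.commute)
  finally show ?thesis .
qed

lemma C1_on_stress:
  assumes "C2_on Lin_plus W"
  shows "C1_on Lin_plus (stress W)"
  unfolding stress_def[abs_def]
  by (intro C1_on_vec_lambda C2_on_derivative_C1_on[OF assms open_Lin_plus])

lemma stress_eq_0_at_minimum:
  assumes W: "C1_on Lin_plus W" and F: "F \<in> Lin_plus" and min: "\<And>A. A \<in> Lin_plus \<Longrightarrow> W F \<le> W A"
  shows "stress W F = 0"
proof -
  obtain e where e: "e > 0" "ball F e \<subseteq> Lin_plus" using open_Lin_plus F open_contains_ball by metis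
  have "frechet_derivative W (at F) = (\<lambda>v. 0)"
    by (rule differential_zero_maxmin[OF _ open_ball[of F e] C1_on_has_derivative[OF W F]])
      (use e min in auto)
  then show ?thesis by (simp add: stress_def vec_eq_iff)
qed

lemma jacobian_mult:
  fixes y :: "real^'n \<Rightarrow> real^'m"
  assumes "y differentiable (at x)"
  shows "jacobian y (at x) *v h = frechet_derivative y (at x) h"
proof -
  have "(y has_derivative (\<lambda>h. jacobian y (at x) *v h)) (at x)" using assms jacobian_works by blast
  from fun_cong[OF frechet_derivative_at[OF this], of h] show ?thesis .
qed

lemma jacobian_component:
  fixes y :: "real^'n \<Rightarrow> real^'m"
  shows "jacobian y (at x) $ i $ j = frechet_derivative y (at x) (axis j 1) $ i"
  by (simp add: jacobian_def matrix_def)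

section \<open>The energy-momentum field\<close>

text \<open>The energy-momentum tensor applied to the position \<open>x\<close>, with the energy normalized to vanish at the
identity and with the traction term \<open>S\<^sup>T y\<close> added. For a homogeneous
deformation \<open>y x = F x\<close> the two traction terms cancel.\<close>

definition energy_flux ::
    "(real^'n^'n \<Rightarrow> real) \<Rightarrow> (real^'n \<Rightarrow> real^'n) \<Rightarrow> (real^'n \<Rightarrow> real^'n^'n) \<Rightarrow> real^'n \<Rightarrow> real^'n" where
  "energy_flux W y G x = (W (G x) - W (mat 1)) *\<^sub>R x + (y x - G x *v x) v* stress W (G x)"

lemma energy_flux_inner:
  "energy_flux W y G x \<bullet> w = (W (G x) - W (mat 1)) * (x \<bullet> w) + (y x - G x *v x) \<bullet> (stress W (G x) *v w)"
  by (simp add: energy_flux_def inner_add_left dot_lmul_matrix)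

lemma bounded_bilinear_matrix_vector_mult: "bounded_bilinear (\<lambda>(A::real^'n^'m) x. A *v x)"
proof -
  have "bilinear (\<lambda>(A::real^'n^'m) x. A *v x)"
    unfolding bilinear_def
    by (auto intro!: linearI simp: matrix_vector_mult_add_rdistrib matrix_vector_right_distrib
        scaleR_matrix_vector_assoc matrix_vector_mult_scaleR)
  then show ?thesis using bilinear_conv_bounded_bilinear by blast
qed

lemma bounded_bilinear_vector_matrix_mult: "bounded_bilinear (\<lambda>x (A::real^'n^'m). x v* A)"
proof -
  have "bilinear (\<lambda>x (A::real^'n^'m). x v* A)"
    unfolding bilinear_def
    by (auto intro!: linearI simp: vec_eq_iff vector_matrix_mult_def sum.distrib sum_distrib_left algebra_simps)
  then show ?thesis using bilinear_conv_bounded_bilinear by blast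
qed

text \<open>\<open>G\<close> stands for the gradient of \<open>y\<close>. It is a parameter because it is later also evaluated on the boundary,
where it is a limit and not the jacobian of \<open>y\<close>.\<close>

locale smooth_deformation =
  fixes W :: "real^'n^'n \<Rightarrow> real" and S :: "(real^'n) set" and y :: "real^'n \<Rightarrow> real^'n"
    and G :: "real^'n \<Rightarrow> real^'n^'n"
  assumes W_C2: "C2_on Lin_plus W" and open_S: "open S" and y_C2: "C2_on S y"
    and G_jacobian: "\<And>x. x \<in> S \<Longrightarrow> G x = jacobian y (at x)"
    and G_Lin_plus: "\<And>x. x \<in> S \<Longrightarrow> G x \<in> Lin_plus"
begin

lemma W_C1: "C1_on Lin_plus W" by (rule C2_on_imp_C1_on[OF W_C2])
lemma y_C1: "C1_on S y" by (rule C2_on_imp_C1_on[OF y_C2])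

lemma G_mult: "x \<in> S \<Longrightarrow> G x *v h = frechet_derivative y (at x) h"
  using G_jacobian jacobian_mult[OF C1_on_differentiable[OF y_C1]] by simp

lemma y_has_derivative: "x \<in> S \<Longrightarrow> (y has_derivative (\<lambda>h. G x *v h)) (at x)"
  using C1_on_has_derivative[OF y_C1] by (simp add: G_mult)

lemma G_C1: "C1_on S G"
proof -
  have "C1_on S (\<lambda>x. \<chi> i j. frechet_derivative y (at x) (axis j 1) $ i)"
    by (intro C1_on_vec_lambda C1_on_vec_nth C2_on_derivative_C1_on[OF y_C2 open_S])
  then show ?thesis
    by (rule C1_on_cong[OF open_S, rotated]) (simp add: G_jacobian jacobian_component vec_eq_iff)
qed

lemma frechet_derivative_G_mult:
  assumes x: "x \<in> S"
  shows "frechet_derivative G (at x) w *v u = frechet_derivative (\<lambda>z. frechet_derivative y (at z) u) (at x) w"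
proof -
  have "((\<lambda>z. G z *v u) has_derivative (\<lambda>w. frechet_derivative G (at x) w *v u)) (at x)"
    using bounded_bilinear.FDERIV[OF bounded_bilinear_matrix_vector_mult
        C1_on_has_derivative[OF G_C1 x] has_derivative_const[of u]]
    by (simp add: matrix_vector_mult_0_right)
  then have "((\<lambda>z. frechet_derivative y (at z) u) has_derivative (\<lambda>w. frechet_derivative G (at x) w *v u)) (at x)"
    by (rule has_derivative_transform_within_open[OF _ open_S x]) (simp add: G_mult)
  from fun_cong[OF frechet_derivative_at[OF this], of w] show ?thesis .
qed

lemma G_derivative_symmetric:
  assumes x: "x \<in> S"
  shows "frechet_derivative G (at x) w *v u = frechet_derivative G (at x) u *v w"
proof -
  have d1: "frechet_derivative y (at z) u $ i = frechet_derivative (\<lambda>z. y z $ i) (at z) u"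
    if "z \<in> S" for z i u
  proof -
    have "((\<lambda>z. y z $ i) has_derivative (\<lambda>u. frechet_derivative y (at z) u $ i)) (at z)"
      by (rule bounded_linear.has_derivative[OF bounded_linear_vec_nth C1_on_has_derivative[OF y_C1 that]])
    from fun_cong[OF frechet_derivative_at[OF this], of u] show ?thesis .
  qed
  have c: "(frechet_derivative G (at x) w *v u) $ i =
      frechet_derivative (\<lambda>z. frechet_derivative (\<lambda>z. y z $ i) (at z) u) (at x) w" for u w i
  proof -
    have "((\<lambda>z. frechet_derivative y (at z) u $ i) has_derivative
        (\<lambda>w. frechet_derivative (\<lambda>z. frechet_derivative y (at z) u) (at x) w $ i)) (at x)"
      by (rule bounded_linear.has_derivative[OF bounded_linear_vec_nth
            C1_on_has_derivative[OF C2_on_derivative_C1_on[OF y_C2 open_S] x]])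
    then have "((\<lambda>z. frechet_derivative (\<lambda>z. y z $ i) (at z) u) has_derivative
        (\<lambda>w. frechet_derivative (\<lambda>z. frechet_derivative y (at z) u) (at x) w $ i)) (at x)"
      by (rule has_derivative_transform_within_open[OF _ open_S x]) (rule d1)
    from fun_cong[OF frechet_derivative_at[OF this], of w] show ?thesis
      unfolding frechet_derivative_G_mult[OF x] .
  qed
  have A: "C1_on S (\<lambda>z. frechet_derivative (\<lambda>z. y z $ i) (at z) u)" for i u
    by (rule C1_on_cong[OF open_S d1 C1_on_vec_nth[OF C2_on_derivative_C1_on[OF y_C2 open_S]]])
  show ?thesis
    unfolding vec_eq_iff c
    using second_derivative_symmetric_real[OF open_S x C1_on_vec_nth[OF y_C1] A] by blast
qed

lemma stress_G_C1: "C1_on S (\<lambda>x. stress W (G x))"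
  by (rule C1_on_compose[OF G_C1 C1_on_stress[OF W_C2] G_Lin_plus])

lemma energy_flux_C1: "C1_on S (energy_flux W y G)"
  unfolding energy_flux_def[abs_def]
  by (intro C1_on_add C1_on_scaleR C1_on_diff C1_on_compose[OF G_C1 W_C1 G_Lin_plus] C1_on_const C1_on_ident
      C1_on_bilinear[OF bounded_bilinear_vector_matrix_mult] C1_on_bilinear[OF bounded_bilinear_matrix_vector_mult]
      y_C1 G_C1 stress_G_C1)

text \<open>Green's identity. The derivative of the energy contributes \<open>S \<bullet> G'(x)\<close>, where \<open>G'(x)\<close> is the derivative of
\<open>G\<close> in the direction of the position, and the traction term contributes minus the same quantity, by
symmetry of the second derivatives of \<open>y\<close>. Derivatives of the stress enter only through
its divergence, which is zero.\<close>

theorem vdiv_energy_flux: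
  assumes x: "x \<in> S" and equil: "divergence (\<lambda>z. stress W (G z)) x = 0"
  shows "vdiv (energy_flux W y G) x = real CARD('n) * (W (G x) - W (mat 1))"
proof -
  let ?G' = "frechet_derivative G (at x)"
  let ?T = "\<lambda>z. stress W (G z)"
  let ?T' = "frechet_derivative ?T (at x)"
  let ?w = "W (G x) - W (mat 1)"
  let ?u = "y x - G x *v x"
  have dG: "(G has_derivative ?G') (at x)" by (rule C1_on_has_derivative[OF G_C1 x])
  have linG: "linear ?G'" using has_derivative_linear[OF dG] .
  have dT: "(?T has_derivative ?T') (at x)" by (rule C1_on_has_derivative[OF stress_G_C1 x])
  have dW: "((\<lambda>z. W (G z) - W (mat 1)) has_derivative (\<lambda>h. ?T x \<bullet> ?G' h)) (at x)"
  proof -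
    have "((\<lambda>z. W (G z)) has_derivative (\<lambda>h. frechet_derivative W (at (G x)) (?G' h))) (at x)"
      by (rule has_derivative_compose[OF dG C1_on_has_derivative[OF W_C1 G_Lin_plus[OF x]]])
    then have "((\<lambda>z. W (G z)) has_derivative (\<lambda>h. ?T x \<bullet> ?G' h)) (at x)"
      by (simp add: derivative_eq_stress[OF W_C1 G_Lin_plus[OF x]])
    from has_derivative_diff[OF this has_derivative_const] show ?thesis by simp
  qed
  have du: "((\<lambda>z. y z - G z *v z) has_derivative (\<lambda>h. - (?G' h *v x))) (at x)"
  proof -
    have "((\<lambda>z. y z - G z *v z) has_derivative (\<lambda>h. G x *v h - (G x *v h + ?G' h *v x))) (at x)"
      by (intro has_derivative_diff y_has_derivative[OF x]
          bounded_bilinear.FDERIV[OF bounded_bilinear_matrix_vector_mult dG has_derivative_ident])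
    then show ?thesis by simp
  qed
  have "(energy_flux W y G has_derivative
      (\<lambda>h. (?w *\<^sub>R h + (?T x \<bullet> ?G' h) *\<^sub>R x) + (?u v* ?T' h + (- (?G' h *v x)) v* ?T x))) (at x)"
    unfolding energy_flux_def[abs_def]
    by (intro has_derivative_add has_derivative_scaleR dW has_derivative_ident
        bounded_bilinear.FDERIV[OF bounded_bilinear_vector_matrix_mult du dT])
  then have "vdiv (energy_flux W y G) x = (\<Sum>j\<in>UNIV. ((?w *\<^sub>R axis j 1 + (?T x \<bullet> ?G' (axis j 1)) *\<^sub>R x)
      + (?u v* ?T' (axis j 1) + (- (?G' (axis j 1) *v x)) v* ?T x)) $ j)"
    by (rule vdiv_eqI)
  also have "\<dots> = (\<Sum>j\<in>(UNIV::'n set). ?w) + (\<Sum>j\<in>UNIV. x $ j * (?T x \<bullet> ?G' (axis j 1)))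
      + (\<Sum>j\<in>UNIV. (?u v* ?T' (axis j 1)) $ j) - (\<Sum>j\<in>UNIV. ((?G' (axis j 1) *v x) v* ?T x) $ j)"
    by (simp add: sum.distrib sum_subtractf axis_def vector_matrix_mult_def sum_negf mult.commute)
  also have "(\<Sum>j\<in>UNIV. x $ j * (?T x \<bullet> ?G' (axis j 1))) = ?T x \<bullet> ?G' x"
  proof -
    have "?T x \<bullet> ?G' x = ?T x \<bullet> (\<Sum>j\<in>UNIV. x $ j *\<^sub>R ?G' (axis j 1))"
      using linear_axis_expansion[OF linG, of x] by simp
    then show ?thesis by (simp add: inner_sum_right)
  qed
  also have "(\<Sum>j\<in>UNIV. (?u v* ?T' (axis j 1)) $ j) = ?u \<bullet> divergence ?T x"
    unfolding vector_matrix_mult_def divergence_def inner_vec_def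
    by (simp add: sum_distrib_left mult.commute) (rule sum.swap)
  also have "(\<Sum>j\<in>UNIV. ((?G' (axis j 1) *v x) v* ?T x) $ j) = ?T x \<bullet> ?G' x"
  proof -
    have "(\<Sum>j\<in>UNIV. ((?G' (axis j 1) *v x) v* ?T x) $ j) = (\<Sum>j\<in>UNIV. ((?G' x *v axis j 1) v* ?T x) $ j)"
      using G_derivative_symmetric[OF x] by simp
    also have "\<dots> = (\<Sum>j\<in>UNIV. \<Sum>i\<in>UNIV. ?T x $ i $ j * ?G' x $ i $ j)"
      by (simp add: vector_matrix_mult_def matrix_vector_mult_basis column_def mult.commute)
    also have "\<dots> = ?T x \<bullet> ?G' x"
      unfolding inner_matrix_sum by (rule sum.swap)
    finally show ?thesis .
  qed
  finally show ?thesis using equil by simp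
qed

end

section \<open>Boundary trace of the gradient\<close>

lemma norm_matrix_vector_le:
  fixes A :: "real^'n^'n"
  shows "norm (A *v h) \<le> real CARD('n) * norm A * norm h"
proof -
  have "\<bar>(A *v h) $ i\<bar> \<le> norm A * norm h" for i
  proof -
    have "(A *v h) $ i = A $ i \<bullet> h" by (simp add: matrix_vector_mult_def inner_vec_def)
    then have "\<bar>(A *v h) $ i\<bar> \<le> norm (A $ i) * norm h" using Cauchy_Schwarz_ineq2 by metis
    also have "\<dots> \<le> norm A * norm h" by (intro mult_right_mono Finite_Cartesian_Product.norm_nth_le) auto
    finally show ?thesis .
  qed
  then have "(\<Sum>i\<in>UNIV. \<bar>(A *v h) $ i\<bar>) \<le> (\<Sum>i\<in>(UNIV::'n set). norm A * norm h)" by (intro sum_mono)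
  then show ?thesis using norm_le_l1_cart[of "A *v h"] by simp
qed

lemma segment_increment_bound:
  fixes u :: "real^'n \<Rightarrow> real^'n"
  assumes cont: "continuous_on (closed_segment a b) u"
    and der: "\<And>x. x \<in> open_segment a b \<Longrightarrow> (u has_derivative (\<lambda>h. H x *v h)) (at x)"
    and close: "\<And>x. x \<in> open_segment a b \<Longrightarrow> norm (H x - H0) \<le> \<eta>"
  shows "norm (u b - u a - H0 *v (b - a)) \<le> real CARD('n) * \<eta> * norm (b - a)"
proof (cases "a = b")
  case True
  then show ?thesis by simp
next
  case False
  let ?p = "\<lambda>t. a + t *\<^sub>R (b - a)"
  let ?f = "\<lambda>t. u (?p t) - H0 *v ?p t"
  have seg: "?p t \<in> closed_segment a b" if "0 \<le> t" "t \<le> 1" for t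
    unfolding in_segment using that by (intro exI[of _ t]) (simp add: algebra_simps)
  have oseg: "?p t \<in> open_segment a b" if "0 < t" "t < 1" for t
    unfolding in_segment using that False by (intro conjI exI[of _ t]) (simp_all add: algebra_simps)
  have "\<exists>t\<in>{0<..<1}. norm (?f 1 - ?f 0) \<le> norm ((\<lambda>s. H (?p t) *v (s *\<^sub>R (b - a)) - H0 *v (s *\<^sub>R (b - a))) (1 - 0))"
  proof (rule mvt_general)
    show "(0::real) < 1" by simp
    have "continuous_on {0..1} (\<lambda>t. u (?p t))"
      by (rule continuous_on_compose2[OF cont]) (auto intro!: continuous_intros seg)
    moreover have "continuous_on {0..1} (\<lambda>t. H0 *v ?p t)"
      by (intro matrix_vector_mult_linear_continuous_on[THEN continuous_on_compose2] continuous_intros) auto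
    ultimately show "continuous_on {0..1} ?f" by (rule continuous_on_diff)
    fix t :: real assume t: "0 < t" "t < 1"
    have dp: "(?p has_derivative (\<lambda>s. s *\<^sub>R (b - a))) (at t)"
      by (auto intro!: derivative_eq_intros)
    have "((\<lambda>t. u (?p t)) has_derivative (\<lambda>s. H (?p t) *v (s *\<^sub>R (b - a)))) (at t)"
      by (rule has_derivative_compose[OF dp der[OF oseg[OF t]]])
    moreover have "((\<lambda>t. H0 *v ?p t) has_derivative (\<lambda>s. H0 *v (s *\<^sub>R (b - a)))) (at t)"
      by (rule bounded_linear.has_derivative[OF matrix_vector_mul_bounded_linear dp])
    ultimately show "(?f has_derivative (\<lambda>s. H (?p t) *v (s *\<^sub>R (b - a)) - H0 *v (s *\<^sub>R (b - a)))) (at t)"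
      by (rule has_derivative_diff)
  qed
  then obtain t where t: "0 < t" "t < 1"
    "norm (?f 1 - ?f 0) \<le> norm (H (?p t) *v (b - a) - H0 *v (b - a))" by auto
  have "norm (u b - u a - H0 *v (b - a)) = norm (?f 1 - ?f 0)"
    by (simp add: matrix_vector_mult_diff_distrib algebra_simps)
  also have "\<dots> \<le> norm ((H (?p t) - H0) *v (b - a))"
    using t(3) by (simp add: matrix_vector_mult_diff_rdistrib)
  also have "\<dots> \<le> real CARD('n) * norm (H (?p t) - H0) * norm (b - a)" by (rule norm_matrix_vector_le)
  also have "\<dots> \<le> real CARD('n) * \<eta> * norm (b - a)"
    using close[OF oseg[OF t(1,2)]] by (intro mult_right_mono mult_left_mono) auto
  finally show ?thesis .
qed

text \<open>A map that vanishes on the boundary has no tangential derivative there. As the boundary is only \<open>C\<^sup>1\<close> and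
\<open>u\<close> is differentiable only in the interior, the increment of \<open>u\<close> between \<open>x0\<close> and a boundary point near
\<open>x0 + t \<tau>\<close> is estimated along three segments inside \<open>\<Omega>\<close>: down from \<open>x0\<close> by \<open>\<kappa> t\<close> against the normal
direction \<open>e\<close>, across by \<open>t \<tau>\<close>, and up again to the boundary. The error relative to the linear map
\<open>H x0\<close> is of order \<open>t (\<eta> + \<kappa>)\<close>, with \<open>\<eta>\<close> and \<open>\<kappa>\<close> arbitrarily small, while both end values are \<open>0\<close>.\<close>

lemma tangential_derivative_zero:
  fixes u :: "real^'n \<Rightarrow> real^'n" and H :: "real^'n \<Rightarrow> real^'n^'n"
  assumes chart: "smooth_boundary_chart \<Omega> M U \<rho> g" and x0: "x0 \<in> U" "\<rho> x0 = 0"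
    and u_cont: "continuous_on \<Omega> u" and u_zero: "\<And>x. x \<in> M \<Longrightarrow> u x = 0"
    and u_der: "\<And>x. x \<in> interior \<Omega> \<Longrightarrow> (u has_derivative (\<lambda>h. H x *v h)) (at x)"
    and H_cont: "continuous_on \<Omega> H" and \<tau>: "g x0 \<bullet> \<tau> = 0"
  shows "H x0 *v \<tau> = 0"
proof -
  have reg: "regular_function U \<rho> g" and \<Omega>U: "\<Omega> \<inter> U = {z \<in> U. \<rho> z \<le> 0}"
    and fr: "frontier \<Omega> \<inter> U = {z \<in> U. \<rho> z = 0}" "frontier \<Omega> \<inter> U \<subseteq> M"
    using chart unfolding smooth_boundary_chart_def by blast+
  have int: "interior \<Omega> \<inter> U = {z \<in> U. \<rho> z < 0}" by (rule smooth_boundary_chart_interior[OF chart])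
  have on_M: "u z = 0" if "z \<in> U" "\<rho> z = 0" for z using that fr u_zero by blast
  have mem_\<Omega>: "w \<in> \<Omega>" if "w \<in> U" "\<rho> w \<le> 0" for w
  proof -
    have "w \<in> \<Omega> \<inter> U" unfolding \<Omega>U using that by simp
    then show ?thesis ..
  qed
  have mem_int: "w \<in> interior \<Omega>" if "w \<in> U" "\<rho> w < 0" for w
  proof -
    have "w \<in> interior \<Omega> \<inter> U" unfolding int using that by simp
    then show ?thesis ..
  qed
  have x0\<Omega>: "x0 \<in> \<Omega>" using x0 by (intro mem_\<Omega>) auto
  define e where "e = g x0"
  define ne where "ne = norm e"
  define n\<tau> where "n\<tau> = norm \<tau>"
  define N where "N = real CARD('n)"
  define K where "K = N * norm (H x0)"
  have ne: "ne > 0" using reg x0 unfolding regular_function_def ne_def e_def by auto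
  have n\<tau>: "n\<tau> \<ge> 0" by (simp add: n\<tau>_def)
  have N: "N \<ge> 0" and K: "K \<ge> 0" by (auto simp: N_def K_def)
  have ee: "e \<bullet> e = ne * ne" by (simp add: ne_def power2_norm_eq_inner[symmetric] power2_eq_square)
  have e\<tau>: "e \<bullet> \<tau> = 0" using \<tau> by (simp add: e_def)
  have claim: "norm (H x0 *v \<tau>) \<le> N * \<eta> * (3 * ne + n\<tau>) + \<kappa> * (K * ne)"
    if \<kappa>: "0 < \<kappa>" "\<kappa> \<le> 1" and \<eta>: "\<eta> > 0" for \<kappa> \<eta>
  proof -
    \<comment> \<open>so small a deviation from linearity that \<open>\<rho>\<close> is strictly monotone along \<open>e\<close> and that the middle
      segment stays at negative values of \<open>\<rho>\<close>\<close>
    define \<kappa>' where "\<kappa>' = \<kappa> * ne * (ne / (2 * (ne + n\<tau>)))"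
    have \<kappa>'0: "\<kappa>' > 0" unfolding \<kappa>'_def using \<kappa> ne n\<tau> by (intro mult_pos_pos divide_pos_pos) auto
    have frac: "ne / (2 * (ne + n\<tau>)) \<le> 1 / 2" using ne n\<tau> by (simp add: field_simps)
    have \<kappa>'1: "\<kappa>' < ne"
    proof -
      have "\<kappa>' \<le> 1 * ne * (1 / 2)" unfolding \<kappa>'_def using \<kappa> ne frac n\<tau> by (intro mult_mono) auto
      then show ?thesis using ne by simp
    qed
    have \<kappa>'2: "\<kappa>' * (\<kappa> * ne + n\<tau>) < \<kappa> * (ne * ne)"
    proof -
      have "\<kappa>' * (\<kappa> * ne + n\<tau>) \<le> \<kappa>' * (ne + n\<tau>)"
        using \<kappa> ne \<kappa>'0 by (intro mult_left_mono add_right_mono mult_left_le_one_le) auto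
      also have "\<dots> = \<kappa> * (ne * ne) / 2" unfolding \<kappa>'_def using ne n\<tau> by (simp add: field_simps)
      also have "\<dots> < \<kappa> * (ne * ne)" using \<kappa> ne by simp
      finally show ?thesis .
    qed
    obtain R where R: "R > 0" "ball x0 R \<subseteq> U"
      "\<And>z w. z \<in> ball x0 R \<Longrightarrow> w \<in> ball x0 R \<Longrightarrow> \<bar>\<rho> z - \<rho> w - e \<bullet> (z - w)\<bar> \<le> \<kappa>' * norm (z - w)"
      using regular_function_strict_derivative[OF reg x0(1) \<kappa>'0] unfolding e_def by blast
    obtain d where d: "d > 0" "\<And>x. x \<in> \<Omega> \<Longrightarrow> dist x x0 < d \<Longrightarrow> dist (H x) (H x0) < \<eta>"
      using H_cont x0\<Omega> \<eta> unfolding continuous_on_iff by blast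
    define r where "r = min R d"
    have r: "r > 0" "r \<le> R" "r \<le> d" using R d by (auto simp: r_def)
    define L where "L = 3 * ne + n\<tau>"
    have L: "L > 0" using ne n\<tau> by (simp add: L_def)
    define t where "t = r / (2 * L)"
    have t: "t > 0" "t * L < r" using r L by (auto simp: t_def)
    have near: "w \<in> ball x0 R" "w \<in> U" if "norm (w - x0) \<le> t * L" for w
      using that t r R(2) by (auto simp: dist_norm norm_minus_commute)
    have H_near: "norm (H w - H x0) \<le> \<eta>" if "norm (w - x0) \<le> t * L" "\<rho> w \<le> 0" for w
    proof -
      have "w \<in> \<Omega>" using near[OF that(1)] that(2) by (intro mem_\<Omega>)
      moreover have "dist w x0 < d" using that t r by (simp add: dist_norm)
      ultimately show ?thesis using d(2)[of w] by (simp add: dist_norm)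
    qed
    define P where "P a b = x0 + a *\<^sub>R e + b *\<^sub>R \<tau>" for a b
    have P_dist: "norm (P a b - x0) \<le> t * L" if "\<bar>a\<bar> \<le> 3 * t" "0 \<le> b" "b \<le> t" for a b
    proof -
      have "norm (P a b - x0) \<le> \<bar>a\<bar> * ne + \<bar>b\<bar> * n\<tau>"
        unfolding P_def ne_def n\<tau>_def using norm_triangle_ineq[of "a *\<^sub>R e" "b *\<^sub>R \<tau>"] by (simp add: algebra_simps)
      also have "\<dots> \<le> 3 * t * ne + t * n\<tau>" using that ne n\<tau> by (intro add_mono mult_right_mono) auto
      finally show ?thesis by (simp add: L_def algebra_simps)
    qed
    have \<kappa>t: "0 < \<kappa> * t" "\<kappa> * t \<le> t" using \<kappa> t by auto
    have \<kappa>t_abs: "\<bar>- (\<kappa> * t)\<bar> = \<kappa> * t" "\<bar>\<kappa> * t\<bar> = \<kappa> * t" "\<kappa> * t \<le> 3 * t"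
      using \<kappa>t t by linarith+
    let ?q0 = "P (- (\<kappa> * t)) 0" and ?q1 = "P (- (\<kappa> * t)) t"
    have \<rho>_diff: "\<bar>\<rho> (P a b) - \<rho> (P a' b') - (a - a') * (ne * ne)\<bar> \<le> \<kappa>' * (\<bar>a - a'\<bar> * ne + \<bar>b - b'\<bar> * n\<tau>)"
      if "\<bar>a\<bar> \<le> 3 * t" "0 \<le> b" "b \<le> t" "\<bar>a'\<bar> \<le> 3 * t" "0 \<le> b'" "b' \<le> t" for a b a' b'
    proof -
      have eq: "P a b - P a' b' = (a - a') *\<^sub>R e + (b - b') *\<^sub>R \<tau>" by (simp add: P_def algebra_simps)
      have "norm (P a b - P a' b') \<le> \<bar>a - a'\<bar> * ne + \<bar>b - b'\<bar> * n\<tau>"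
        unfolding eq ne_def n\<tau>_def using norm_triangle_ineq[of "(a - a') *\<^sub>R e" "(b - b') *\<^sub>R \<tau>"] by simp
      then have "\<kappa>' * norm (P a b - P a' b') \<le> \<kappa>' * (\<bar>a - a'\<bar> * ne + \<bar>b - b'\<bar> * n\<tau>)"
        using \<kappa>'0 by (intro mult_left_mono) auto
      moreover have "e \<bullet> (P a b - P a' b') = (a - a') * (ne * ne)"
        unfolding eq by (simp add: inner_add_right ee e\<tau>)
      moreover have "\<bar>\<rho> (P a b) - \<rho> (P a' b') - e \<bullet> (P a b - P a' b')\<bar> \<le> \<kappa>' * norm (P a b - P a' b')"
        by (intro R(3) near P_dist that)
      ultimately show ?thesis by simp
    qed
    have P0: "P 0 0 = x0" by (simp add: P_def)
    have decrease: "\<rho> (P a' b) < \<rho> (P a b)" if "a' < a" "\<bar>a\<bar> \<le> 3 * t" "\<bar>a'\<bar> \<le> 3 * t" "0 \<le> b" "b \<le> t" for a a' b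
    proof -
      have "\<rho> (P a' b) - \<rho> (P a b) \<le> (a' - a) * (ne * ne) + \<kappa>' * (\<bar>a' - a\<bar> * ne)"
        using \<rho>_diff[of a' b a b] that by simp
      also have "\<dots> = (a - a') * ne * (\<kappa>' - ne)" using that by (simp add: algebra_simps)
      also have "\<dots> < 0" using that ne \<kappa>'1 by (intro mult_pos_neg mult_pos_pos) auto
      finally show ?thesis by simp
    qed
    have mid: "\<rho> (P (- (\<kappa> * t)) b) < 0" if b: "0 \<le> b" "b \<le> t" for b
    proof -
      have "\<rho> (P (- (\<kappa> * t)) b) \<le> - (\<kappa> * t) * (ne * ne) + \<kappa>' * (\<kappa> * t * ne + b * n\<tau>)"
      proof -
        have "\<bar>\<rho> (P (- (\<kappa> * t)) b) - \<rho> (P 0 0) - (- (\<kappa> * t) - 0) * (ne * ne)\<bar>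
            \<le> \<kappa>' * (\<bar>- (\<kappa> * t) - 0\<bar> * ne + \<bar>b - 0\<bar> * n\<tau>)"
          by (rule \<rho>_diff) (use \<kappa>t_abs t b in auto)
        then show ?thesis unfolding P0 x0(2) diff_zero \<kappa>t_abs using b by simp
      qed
      also have "\<dots> \<le> - (\<kappa> * t) * (ne * ne) + \<kappa>' * (\<kappa> * t * ne + t * n\<tau>)"
        using b n\<tau> \<kappa>'0 by (intro add_left_mono mult_left_mono mult_right_mono) auto
      also have "\<dots> = t * (\<kappa>' * (\<kappa> * ne + n\<tau>) - \<kappa> * (ne * ne))" by (simp add: algebra_simps)
      also have "\<dots> < 0" using t \<kappa>'2 by (intro mult_pos_neg) auto
      finally show ?thesis .
    qed
    have top: "\<rho> (P (\<kappa> * t) t) > 0"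
    proof -
      have "\<rho> (P (\<kappa> * t) t) \<ge> \<kappa> * t * (ne * ne) - \<kappa>' * (\<kappa> * t * ne + t * n\<tau>)"
      proof -
        have "\<bar>\<rho> (P (\<kappa> * t) t) - \<rho> (P 0 0) - (\<kappa> * t - 0) * (ne * ne)\<bar>
            \<le> \<kappa>' * (\<bar>\<kappa> * t - 0\<bar> * ne + \<bar>t - 0\<bar> * n\<tau>)"
          by (rule \<rho>_diff) (use \<kappa>t_abs t in auto)
        then show ?thesis unfolding P0 x0(2) diff_zero \<kappa>t_abs using t by simp
      qed
      moreover have "\<kappa> * t * (ne * ne) - \<kappa>' * (\<kappa> * t * ne + t * n\<tau>) = t * (\<kappa> * (ne * ne) - \<kappa>' * (\<kappa> * ne + n\<tau>))"
        by (simp add: algebra_simps)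
      moreover have "t * (\<kappa> * (ne * ne) - \<kappa>' * (\<kappa> * ne + n\<tau>)) > 0" using t \<kappa>'2 by (intro mult_pos_pos) auto
      ultimately show ?thesis by linarith
    qed
    have a_bound: "\<bar>a\<bar> \<le> 3 * t" if "- (\<kappa> * t) \<le> a" "a \<le> \<kappa> * t" for a
      using that \<kappa>t(2) t(1) by linarith
    \<comment> \<open>above the end of the middle segment the boundary is reached at some height \<open>a\<close>\<close>
    have "\<exists>a. - (\<kappa> * t) \<le> a \<and> a \<le> \<kappa> * t \<and> \<rho> (P a t) = 0"
    proof (rule IVT')
      show "\<rho> (P (- (\<kappa> * t)) t) \<le> 0" using mid[of t] t by simp
      show "0 \<le> \<rho> (P (\<kappa> * t) t)" using top by simp
      show "- (\<kappa> * t) \<le> \<kappa> * t" using \<kappa>t by simp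
      show "continuous_on {- (\<kappa> * t)..\<kappa> * t} (\<lambda>a. \<rho> (P a t))"
      proof (rule continuous_on_compose2[OF C1_on_continuous_on[OF C1_on_regular_function[OF reg]]])
        show "continuous_on {- (\<kappa> * t)..\<kappa> * t} (\<lambda>a. P a t)" unfolding P_def by (intro continuous_intros)
        show "(\<lambda>a. P a t) ` {- (\<kappa> * t)..\<kappa> * t} \<subseteq> U"
          using t a_bound by (auto simp del: abs_le_iff intro!: near(2) P_dist)
      qed
    qed
    then obtain a where a: "- (\<kappa> * t) \<le> a" "a \<le> \<kappa> * t" "\<rho> (P a t) = 0" by blast
    let ?z = "P a t"
    have a_abs: "\<bar>a\<bar> \<le> 3 * t" using a_bound[OF a(1,2)] .
    have step: "norm (u (P a2 b2) - u (P a1 b1) - H x0 *v (P a2 b2 - P a1 b1)) \<le>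
        N * \<eta> * (\<bar>a2 - a1\<bar> * ne + \<bar>b2 - b1\<bar> * n\<tau>)"
      if ab: "\<bar>a1\<bar> \<le> 3 * t" "0 \<le> b1" "b1 \<le> t" "\<bar>a2\<bar> \<le> 3 * t" "0 \<le> b2" "b2 \<le> t"
        and ends: "\<rho> (P a1 b1) \<le> 0" "\<rho> (P a2 b2) \<le> 0"
        and inside: "\<And>s. 0 < s \<Longrightarrow> s < 1 \<Longrightarrow> P a1 b1 \<noteq> P a2 b2 \<Longrightarrow>
          \<rho> (P (a1 + s * (a2 - a1)) (b1 + s * (b2 - b1))) < 0"
      for a1 b1 a2 b2
    proof -
      let ?a = "P a1 b1" and ?b = "P a2 b2"
      have op: "norm (w - x0) \<le> t * L \<and> \<rho> w < 0" if w: "w \<in> open_segment ?a ?b" for w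
      proof -
        obtain s where s: "0 < s" "s < 1" "?a \<noteq> ?b" "w = (1 - s) *\<^sub>R ?a + s *\<^sub>R ?b"
          using w unfolding in_segment by blast
        have w_eq: "w = P (a1 + s * (a2 - a1)) (b1 + s * (b2 - b1))"
          unfolding s(4) P_def by (simp add: algebra_simps)
        have "w \<in> cball x0 (t * L)"
        proof -
          have "closed_segment ?a ?b \<subseteq> cball x0 (t * L)"
            using P_dist[of a1 b1] P_dist[of a2 b2] ab
            by (intro closed_segment_subset) (auto simp: dist_norm norm_minus_commute)
          then show ?thesis using w open_closed_segment by blast
        qed
        then show ?thesis using inside[OF s(1-3)] w_eq by (simp add: dist_norm norm_minus_commute)
      qed
      have in\<Omega>: "w \<in> \<Omega>" if "w \<in> closed_segment ?a ?b" for w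
      proof -
        have "w \<in> open_segment ?a ?b \<or> w = ?a \<or> w = ?b"
          using that by (auto simp: open_segment_def)
        then have "w \<in> U \<and> \<rho> w \<le> 0"
          using op near(2) P_dist[of a1 b1] P_dist[of a2 b2] ab ends by (metis less_imp_le)
        then show ?thesis by (intro mem_\<Omega>) blast+
      qed
      have "norm (u ?b - u ?a - H x0 *v (?b - ?a)) \<le> real CARD('n) * \<eta> * norm (?b - ?a)"
      proof (rule segment_increment_bound)
        show "continuous_on (closed_segment ?a ?b) u"
          by (rule continuous_on_subset[OF u_cont]) (use in\<Omega> in blast)
        show "(u has_derivative (\<lambda>h. H x *v h)) (at x)" if "x \<in> open_segment ?a ?b" for x
          using op[OF that] by (intro u_der mem_int near(2)) blast+
        show "norm (H x - H x0) \<le> \<eta>" if "x \<in> open_segment ?a ?b" for x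
          using op[OF that] H_near by (meson less_imp_le)
      qed
      also have "\<dots> \<le> N * \<eta> * (\<bar>a2 - a1\<bar> * ne + \<bar>b2 - b1\<bar> * n\<tau>)"
      proof -
        have eq: "?b - ?a = (a2 - a1) *\<^sub>R e + (b2 - b1) *\<^sub>R \<tau>" by (simp add: P_def algebra_simps)
        have "norm (?b - ?a) \<le> \<bar>a2 - a1\<bar> * ne + \<bar>b2 - b1\<bar> * n\<tau>"
          unfolding eq ne_def n\<tau>_def using norm_triangle_ineq[of "(a2 - a1) *\<^sub>R e" "(b2 - b1) *\<^sub>R \<tau>"] by simp
        then show ?thesis unfolding N_def using \<eta> by (intro mult_left_mono) auto
      qed
      finally show ?thesis .
    qed
    have s1: "norm (u ?q0 - u x0 - H x0 *v (?q0 - x0)) \<le> N * \<eta> * (\<kappa> * t * ne)"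
    proof -
      have "\<rho> (P (0 + s * (- (\<kappa> * t) - 0)) (0 + s * (0 - 0))) < 0" if "0 < s" "s < 1" for s
      proof -
        have "s * (\<kappa> * t) \<le> 1 * t" using that \<kappa>t by (intro mult_mono) auto
        moreover have "0 < s * (\<kappa> * t)" using that \<kappa>t by simp
        ultimately show ?thesis using decrease[of "- (s * (\<kappa> * t))" 0 0] x0(2) P0 t by simp
      qed
      then show ?thesis
        using step[of 0 0 "- (\<kappa> * t)" 0] mid[of 0] \<kappa>t t x0(2) P0 by simp
    qed
    have s2: "norm (u ?q1 - u ?q0 - H x0 *v (?q1 - ?q0)) \<le> N * \<eta> * (t * n\<tau>)"
    proof -
      have "\<rho> (P (- (\<kappa> * t) + s * (- (\<kappa> * t) - - (\<kappa> * t))) (0 + s * (t - 0))) < 0" if "0 < s" "s < 1" for s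
        using mid[of "s * t"] that t by (simp add: mult_left_le_one_le)
      then show ?thesis
        using step[of "- (\<kappa> * t)" 0 "- (\<kappa> * t)" t] mid[of 0] mid[of t] \<kappa>t t by simp
    qed
    have s3: "norm (u ?z - u ?q1 - H x0 *v (?z - ?q1)) \<le> N * \<eta> * (2 * \<kappa> * t * ne)"
    proof -
      have "\<rho> (P (- (\<kappa> * t) + s * (a - - (\<kappa> * t))) (t + s * (t - t))) < 0"
        if s: "0 < s" "s < 1" "?q1 \<noteq> ?z" for s
      proof -
        have "a \<noteq> - (\<kappa> * t)" using s(3) by auto
        then have pos: "a + \<kappa> * t > 0" using a by simp
        define m where "m = s * (a + \<kappa> * t)"
        have "s * (a + \<kappa> * t) < 1 * (a + \<kappa> * t)" using s pos by (intro mult_strict_right_mono) auto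
        then have m: "m < a + \<kappa> * t" by (simp add: m_def)
        have m0: "0 < m" using s pos by (simp add: m_def)
        have "\<rho> (P (- (\<kappa> * t) + m) t) < \<rho> (P a t)"
        proof (rule decrease)
          show "- (\<kappa> * t) + m < a" using m by linarith
          show "\<bar>- (\<kappa> * t) + m\<bar> \<le> 3 * t"
            by (rule a_bound) (use m m0 a in linarith)+
        qed (use a_abs t in auto)
        then show ?thesis using a(3) by (simp add: m_def)
      qed
      then have "norm (u ?z - u ?q1 - H x0 *v (?z - ?q1)) \<le> N * \<eta> * (\<bar>a - - (\<kappa> * t)\<bar> * ne + \<bar>t - t\<bar> * n\<tau>)"
        using step[of "- (\<kappa> * t)" t a t] mid[of t] \<kappa>t t a a_abs by simp
      also have "\<dots> \<le> N * \<eta> * (2 * \<kappa> * t * ne)"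
        using a ne N \<eta> by (intro mult_left_mono) (auto intro!: mult_right_mono)
      finally show ?thesis .
    qed
    have uz: "u ?z = 0" using on_M near(2)[OF P_dist[of a t]] a a_abs t by simp
    have ux0: "u x0 = 0" using on_M x0 by simp
    have "norm (H x0 *v (?z - x0)) \<le> N * \<eta> * (\<kappa> * t * ne) + N * \<eta> * (t * n\<tau>) + N * \<eta> * (2 * \<kappa> * t * ne)"
    proof -
      let ?v1 = "u ?q0 - u x0 - H x0 *v (?q0 - x0)"
      let ?v2 = "u ?q1 - u ?q0 - H x0 *v (?q1 - ?q0)"
      let ?v3 = "u ?z - u ?q1 - H x0 *v (?z - ?q1)"
      have "H x0 *v (?z - x0) = - (?v1 + ?v2 + ?v3)"
        using uz ux0 by (simp add: matrix_vector_mult_diff_distrib algebra_simps)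
      then have "norm (H x0 *v (?z - x0)) = norm (?v1 + ?v2 + ?v3)" by (metis norm_minus_cancel)
      also have "\<dots> \<le> norm ?v1 + norm ?v2 + norm ?v3" by (intro order_trans[OF norm_triangle_ineq] add_right_mono norm_triangle_ineq)
      finally show ?thesis using s1 s2 s3 by linarith
    qed
    also have "\<dots> = t * (N * \<eta> * (3 * (\<kappa> * ne) + n\<tau>))" by (simp add: algebra_simps)
    also have "\<dots> \<le> t * (N * \<eta> * (3 * ne + n\<tau>))"
      using \<kappa> ne t N \<eta> by (intro mult_left_mono add_right_mono) (auto intro: mult_left_le_one_le)
    finally have 1: "norm (H x0 *v (?z - x0)) \<le> t * (N * \<eta> * (3 * ne + n\<tau>))" .
    have "t *\<^sub>R (H x0 *v \<tau>) = H x0 *v (?z - x0) - a *\<^sub>R (H x0 *v e)"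
      by (simp add: P_def matrix_vector_right_distrib matrix_vector_mult_scaleR)
    then have "t * norm (H x0 *v \<tau>) = norm (H x0 *v (?z - x0) - a *\<^sub>R (H x0 *v e))"
      using t by (metis abs_of_pos norm_scaleR)
    also have "\<dots> \<le> norm (H x0 *v (?z - x0)) + norm (a *\<^sub>R (H x0 *v e))" by (rule norm_triangle_ineq4)
    also have "norm (a *\<^sub>R (H x0 *v e)) \<le> \<kappa> * t * (K * ne)"
    proof -
      have "norm (a *\<^sub>R (H x0 *v e)) = \<bar>a\<bar> * norm (H x0 *v e)" by simp
      also have "\<dots> \<le> \<kappa> * t * (K * ne)"
        using a norm_matrix_vector_le[of "H x0" e] \<kappa>t by (intro mult_mono) (auto simp: K_def N_def ne_def)
      finally show ?thesis .
    qed
    finally have "t * norm (H x0 *v \<tau>) \<le> t * (N * \<eta> * (3 * ne + n\<tau>) + \<kappa> * (K * ne))"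
      using 1 by (simp add: algebra_simps)
    then show ?thesis using t by simp
  qed
  define C where "C = N * (3 * ne + n\<tau>) + K * ne"
  have C: "C \<ge> 0" unfolding C_def using N ne n\<tau> K by simp
  have small: "norm (H x0 *v \<tau>) \<le> s * C" if "0 < s" "s \<le> 1" for s
    using claim[of s s] that by (simp add: C_def algebra_simps)
  have "norm (H x0 *v \<tau>) \<le> 0"
  proof (rule field_le_epsilon)
    fix \<epsilon> :: real assume \<epsilon>: "\<epsilon> > 0"
    let ?s = "min 1 (\<epsilon> / (C + 1))"
    have "norm (H x0 *v \<tau>) \<le> ?s * C" by (rule small) (use \<epsilon> C in auto)
    also have "\<dots> \<le> \<epsilon> / (C + 1) * (C + 1)" using \<epsilon> C by (intro mult_mono) auto
    also have "\<dots> = \<epsilon>" using C by simp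
    finally show "norm (H x0 *v \<tau>) \<le> 0 + \<epsilon>" by simp
  qed
  then show ?thesis by simp
qed

section \<open>Rank-one matrices and rotations\<close>

lemma tensor_mult_vector: "tensor a b *v v = (b \<bullet> v) *\<^sub>R a"
  by (simp add: tensor_def matrix_vector_mult_def inner_vec_def vec_eq_iff sum_distrib_left sum_distrib_right mult_ac)

lemma inner_tensor: "A \<bullet> tensor a b = a \<bullet> (A *v b)"
  by (simp add: tensor_def matrix_vector_mult_def inner_vec_def sum_distrib_left mult_ac)

text \<open>Hadamard's jump relation: a matrix that annihilates a hyperplane has rank at most one.\<close>

lemma matrix_eq_tensor:
  fixes A :: "real^'n^'n"
  assumes n: "norm n = 1" and tang: "\<And>\<tau>. n \<bullet> \<tau> = 0 \<Longrightarrow> A *v \<tau> = 0"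
  shows "A = tensor (A *v n) n"
  unfolding matrix_eq
proof
  fix v
  have nn: "n \<bullet> n = 1" using n by (simp add: norm_eq_1)
  have "A *v (v - (n \<bullet> v) *\<^sub>R n) = 0" by (rule tang) (simp add: inner_diff_right nn)
  then show "A *v v = tensor (A *v n) n *v v"
    by (simp add: tensor_mult_vector matrix_vector_mult_diff_distrib matrix_vector_mult_scaleR)
qed

text \<open>An orthogonal matrix that fixes a hyperplane pointwise is the identity or the reflection in it, and the
reflection has determinant \<open>-1\<close>.\<close>

lemma rotation_fixing_hyperplane:
  fixes Q :: "real^'n^'n"
  assumes Q: "rotation_matrix Q" and n: "norm n = 1" and tang: "\<And>\<tau>. n \<bullet> \<tau> = 0 \<Longrightarrow> (Q - mat 1) *v \<tau> = 0"
  shows "Q = mat 1"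
proof -
  define a where "a = (Q - mat 1) *v n"
  have nn: "n \<bullet> n = 1" using n by (simp add: norm_eq_1)
  have Qm: "Q - mat 1 = tensor a n" unfolding a_def by (rule matrix_eq_tensor[OF n tang])
  have Qv: "Q *v v = v + (n \<bullet> v) *\<^sub>R a" for v
  proof -
    have "Q *v v = (mat 1 + (Q - mat 1)) *v v" by simp
    also have "\<dots> = v + (n \<bullet> v) *\<^sub>R a"
      unfolding matrix_vector_mult_add_rdistrib unfolding Qm tensor_mult_vector by simp
    finally show ?thesis .
  qed
  have orth: "orthogonal_matrix Q" and det: "det Q = 1" using Q by (auto simp: rotation_matrix_def)
  have "orthogonal_transformation (\<lambda>v. Q *v v)"
    using orth by (simp add: orthogonal_transformation_matrix)
  then have inner: "(Q *v v) \<bullet> (Q *v w) = v \<bullet> w" for v w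
    by (simp add: orthogonal_transformation_def)
  define c where "c = a \<bullet> n"
  have "a = c *\<^sub>R n"
  proof -
    let ?\<tau> = "a - c *\<^sub>R n"
    have n\<tau>: "n \<bullet> ?\<tau> = 0" by (simp add: inner_diff_right nn c_def inner_commute)
    have "(Q *v n) \<bullet> (Q *v ?\<tau>) = 0" unfolding inner by (rule n\<tau>)
    then have "a \<bullet> ?\<tau> = 0" unfolding Qv n\<tau> using n\<tau> by (simp add: nn inner_add_left)
    then have "?\<tau> \<bullet> ?\<tau> = 0" using n\<tau> by (simp add: inner_diff_left[of a])
    then show ?thesis by simp
  qed
  moreover have "(1 + c) * (1 + c) = 1"
    using inner[of n n] \<open>a = c *\<^sub>R n\<close> unfolding Qv by (simp add: nn inner_add_left inner_add_right algebra_simps)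
  then have "c * (c + 2) = 0" by (simp add: algebra_simps)
  then have "c = 0 \<or> c = - 2" by auto
  moreover have "c \<noteq> - 2"
  proof
    assume c: "c = - 2"
    fix k :: 'n
    obtain B where B: "orthogonal_matrix B" "B *v (axis k 1) = n"
      using orthogonal_matrix_exists_basis[OF n] by blast
    have "orthogonal_transformation (\<lambda>v. B *v v)"
      using B(1) by (simp add: orthogonal_transformation_matrix)
    then have B_inner: "(B *v v) \<bullet> (B *v w) = v \<bullet> w" for v w
      by (simp add: orthogonal_transformation_def)
    have tB: "transpose B ** B = mat 1" using B(1) by (simp add: orthogonal_matrix)
    have tB': "transpose B *v (B *v v) = v" for v
      using tB by (simp add: matrix_vector_mul_assoc)
    let ?D = "transpose B ** Q ** B"
    have Dv: "?D *v v = v - (2 * (axis k 1 \<bullet> v)) *\<^sub>R axis k 1" for v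
    proof -
      have "?D *v v = transpose B *v (Q *v (B *v v))" by (simp add: matrix_vector_mul_assoc matrix_mul_assoc)
      also have "Q *v (B *v v) = B *v v - (2 * (n \<bullet> (B *v v))) *\<^sub>R n"
        unfolding Qv \<open>a = c *\<^sub>R n\<close> c by simp
      also have "n \<bullet> (B *v v) = axis k 1 \<bullet> v" using B_inner[of "axis k 1" v] B(2) by simp
      also have "B *v v - (2 * (axis k 1 \<bullet> v)) *\<^sub>R n = B *v (v - (2 * (axis k 1 \<bullet> v)) *\<^sub>R axis k 1)"
        using B(2) by (simp add: matrix_vector_mult_diff_distrib matrix_vector_mult_scaleR)
      finally show ?thesis unfolding tB' .
    qed
    have D_entry: "?D $ i $ j = (if i = j then (if i = k then - 1 else 1) else 0)" for i j
    proof -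
      have "?D $ i $ j = (?D *v axis j 1) $ i" by (simp add: matrix_vector_mult_basis column_def)
      also have "\<dots> = (if i = j then (if i = k then - 1 else 1) else 0)"
      proof -
        have "axis k 1 \<bullet> (axis j 1 :: real^'n) = (if k = j then 1 else 0)" by (simp add: inner_axis_axis)
        then show ?thesis unfolding Dv by (auto simp: axis_def)
      qed
      finally show ?thesis .
    qed
    have "det ?D = (\<Prod>i\<in>UNIV. ?D $ i $ i)" by (rule det_diagonal) (simp add: D_entry)
    also have "\<dots> = - 1" by (simp add: D_entry)
    finally have "det ?D = - 1" .
    moreover have "det ?D = det Q * (det B * det B)" by (simp add: det_mul)
    moreover have "det B * det B = 1"
      using det_orthogonal_matrix[OF B(1)] by auto
    ultimately show False using det by simp
  qed
  ultimately have "a = 0" by simp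
  then show ?thesis using Qm Qv by (simp add: matrix_eq)
qed

section \<open>Rigidity\<close>

lemma continuous_nonneg_integral_nonpos_imp_0:
  fixes f :: "'a::euclidean_space \<Rightarrow> real"
  assumes S: "open S" "bounded S" and f: "continuous_on S f" "\<And>x. x \<in> S \<Longrightarrow> 0 \<le> f x" "\<And>x. x \<in> S \<Longrightarrow> f x \<le> B"
    and le: "(\<integral>x. indicator S x * f x \<partial>lborel) \<le> 0" and x: "x \<in> S"
  shows "f x = 0"
proof (rule ccontr)
  assume "f x \<noteq> 0"
  then have pos: "f x > 0" using f(2)[OF x] by simp
  have int: "integrable lborel (\<lambda>x. indicator S x * f x)"
    by (rule integrable_continuous_bounded_on_open[OF S f(1)]) (use f in auto)
  have nonneg: "0 \<le> indicator S x * f x" for x using f(2) by (simp add: indicator_def)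
  have "(\<integral>x. indicator S x * f x \<partial>lborel) = 0"
    by (intro antisym le Bochner_Integration.integral_nonneg nonneg)
  then have "AE x in lborel. indicator S x * f x = 0"
    using integral_nonneg_eq_0_iff_AE[OF int] nonneg by simp
  moreover have op: "open (S \<inter> f -` {0<..})" by (rule continuous_open_preimage[OF f(1) S(1)]) auto
  ultimately have null: "S \<inter> f -` {0<..} \<in> null_sets lborel"
    by (intro AE_iff_null_sets[THEN iffD2]) (auto elim!: eventually_mono simp: indicator_def)
  obtain r where r: "r > 0" "ball x r \<subseteq> S \<inter> f -` {0<..}"
  proof -
    have "x \<in> S \<inter> f -` {0<..}" using x pos by simp
    then show ?thesis using that op unfolding open_contains_ball by blast
  qed
  have "ball x r \<in> null_sets lborel" by (rule null_sets_subset[OF null _ r(2)]) simp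
  then have "measure lborel (ball x r) = 0" by (simp add: null_sets_def measure_def)
  then show False using content_ball_pos[OF r(1), of x] by simp
qed

text \<open>The form \<open>T w u v = (G' w u) \<bullet> (G v)\<close> is symmetric in \<open>w\<close>, \<open>u\<close> because \<open>G\<close> is a gradient, and
antisymmetric in \<open>u\<close>, \<open>v\<close> because \<open>G\<close> preserves inner products. As for the Christoffel symbols of a flat
metric, the two symmetries force \<open>T = 0\<close>.\<close>

lemma (in smooth_deformation) derivative_G_eq_0_of_orthogonal:
  assumes orth: "\<And>x. x \<in> S \<Longrightarrow> orthogonal_matrix (G x)" and x: "x \<in> S"
  shows "frechet_derivative G (at x) w = 0"
proof -
  let ?G' = "frechet_derivative G (at x)"
  have dG: "(G has_derivative ?G') (at x)" by (rule C1_on_has_derivative[OF G_C1 x])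
  have inner: "(G z *v u) \<bullet> (G z *v v) = u \<bullet> v" if "z \<in> S" for z u v
  proof -
    have "orthogonal_transformation (\<lambda>v. G z *v v)"
      using orth[OF that] by (simp add: orthogonal_transformation_matrix)
    then show ?thesis by (simp add: orthogonal_transformation_def)
  qed
  define T where "T w u v = (?G' w *v u) \<bullet> (G x *v v)" for w u v
  have sym: "T w u v = T u w v" for w u v
    unfolding T_def using G_derivative_symmetric[OF x, of w u] by simp
  have anti: "T w u v = - T w v u" for w u v
  proof -
    have d: "((\<lambda>z. G z *v u) has_derivative (\<lambda>w. ?G' w *v u)) (at x)" for u
      using bounded_bilinear.FDERIV[OF bounded_bilinear_matrix_vector_mult dG has_derivative_const[of u]]
      by (simp add: matrix_vector_mult_0_right)
    have "((\<lambda>z. (G z *v u) \<bullet> (G z *v v)) has_derivative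
        (\<lambda>w. (G x *v u) \<bullet> (?G' w *v v) + (?G' w *v u) \<bullet> (G x *v v))) (at x)"
      by (rule has_derivative_inner[OF d d])
    moreover have "((\<lambda>z. (G z *v u) \<bullet> (G z *v v)) has_derivative (\<lambda>w. 0)) (at x)"
      by (rule has_derivative_transform_within_open[OF has_derivative_const[of "u \<bullet> v"] open_S x])
        (simp add: inner)
    ultimately have "(\<lambda>w. (G x *v u) \<bullet> (?G' w *v v) + (?G' w *v u) \<bullet> (G x *v v)) = (\<lambda>w. 0)"
      by (rule has_derivative_unique)
    from fun_cong[OF this, of w] show ?thesis by (simp add: T_def inner_commute)
  qed
  have T0: "T w u v = 0" for w u v
  proof -
    have "T w u v = - T w v u" by (rule anti)
    also have "\<dots> = - T v w u" by (simp only: sym[of w v u])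
    also have "\<dots> = T v u w" using anti[of v w u] by simp
    also have "\<dots> = T u v w" by (rule sym)
    also have "\<dots> = - T u w v" by (rule anti)
    also have "\<dots> = - T w u v" by (simp only: sym[of u w v])
    finally show ?thesis by simp
  qed
  have "?G' w *v u = 0" for u
  proof -
    have "G x *v (transpose (G x) *v (?G' w *v u)) = ?G' w *v u"
      using orth[OF x] by (simp add: matrix_vector_mul_assoc matrix_mul_assoc orthogonal_matrix_def)
    then have "(?G' w *v u) \<bullet> (?G' w *v u) = T w u (transpose (G x) *v (?G' w *v u))"
      by (simp add: T_def)
    then show ?thesis using T0 by simp
  qed
  then show ?thesis by (simp add: matrix_eq)
qed

lemma (in smooth_deformation) rigid_motion_on_connected:
  assumes orth: "\<And>x. x \<in> S \<Longrightarrow> orthogonal_matrix (G x)"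
    and C: "open C" "connected C" "C \<subseteq> S"
  obtains Q c where "\<And>x. x \<in> C \<Longrightarrow> G x = Q" "\<And>x. x \<in> C \<Longrightarrow> y x = Q *v x + c"
proof (cases "C = {}")
  case True
  then show ?thesis using that by blast
next
  case False
  then obtain p where p: "p \<in> C" by blast
  have G_eq: "G x = G p" if "x \<in> C" for x
  proof (rule has_derivative_zero_unique_connected[OF C(1,2) _ that p])
    fix z assume "z \<in> C"
    then have z: "z \<in> S" using C(3) by blast
    have "frechet_derivative G (at z) = (\<lambda>w. 0)"
      using derivative_G_eq_0_of_orthogonal[OF orth z] by blast
    then show "(G has_derivative (\<lambda>w. 0)) (at z)" using C1_on_has_derivative[OF G_C1 z] by simp
  qed
  have "y x - G p *v x = y p - G p *v p" if "x \<in> C" for x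
  proof (rule has_derivative_zero_unique_connected[OF C(1,2) _ that p])
    fix z assume z: "z \<in> C"
    then have "z \<in> S" using C(3) by blast
    from has_derivative_diff[OF y_has_derivative[OF this]
        bounded_linear_imp_has_derivative[OF matrix_vector_mul_bounded_linear[of "G p"]]]
    show "((\<lambda>x. y x - G p *v x) has_derivative (\<lambda>w. 0)) (at z)" using G_eq[OF z] by simp
  qed
  then have "y x = G p *v x + (y p - G p *v p)" if "x \<in> C" for x
    using that by (simp add: algebra_simps)
  then show ?thesis using that G_eq by blast
qed

section \<open>Boundary conditions and uniqueness\<close>

lemma smooth_boundary_chart_outward_normal:
  assumes "smooth_boundary_chart \<Omega> M U \<rho> g" "x \<in> U" "\<rho> x = 0"
  shows "outward_normal \<Omega> x (g x /\<^sub>R norm (g x))" "x \<in> M" "g x \<noteq> 0" "x \<in> \<Omega>"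
proof -
  have reg: "regular_function U \<rho> g" and \<Omega>U: "\<Omega> \<inter> U = {z \<in> U. \<rho> z \<le> 0}"
    and fr: "frontier \<Omega> \<inter> U = {z \<in> U. \<rho> z = 0}" "frontier \<Omega> \<inter> U \<subseteq> M"
    using assms(1) unfolding smooth_boundary_chart_def by blast+
  show "outward_normal \<Omega> x (g x /\<^sub>R norm (g x))"
    unfolding outward_normal_def by (intro exI[of _ U] exI[of _ \<rho>] exI[of _ g] conjI reg \<Omega>U assms refl)
  have "x \<in> frontier \<Omega> \<inter> U" unfolding fr(1) using assms by simp
  then show "x \<in> M" using fr(2) by blast
  show "g x \<noteq> 0" using reg assms(2) by (simp add: regular_function_def)
  have "x \<in> \<Omega> \<inter> U" unfolding \<Omega>U using assms by simp
  then show "x \<in> \<Omega>" by blast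
qed

lemma continuous_nonpos_nearly_nonpos:
  fixes f :: "'a::metric_space \<Rightarrow> real"
  assumes "open U" "continuous_on (A \<inter> U) f" "x \<in> A" "x \<in> U" "f x \<le> 0" "e > 0"
  shows "\<exists>d>0. \<forall>z\<in>A \<inter> ball x d. f z \<le> e"
proof -
  obtain r where r: "r > 0" "ball x r \<subseteq> U" using assms(1,4) open_contains_ball by metis
  obtain d where d: "d > 0" "\<And>z. z \<in> A \<inter> U \<Longrightarrow> dist z x < d \<Longrightarrow> dist (f z) (f x) < e"
    using assms(2-4,6) unfolding continuous_on_iff by (metis IntI)
  have "f z \<le> e" if z: "z \<in> A \<inter> ball x (min r d)" for z
  proof -
    have "dist (f z) (f x) < e" using z r by (intro d(2)) (auto simp: dist_commute)
    then show ?thesis using assms(5) by (simp add: dist_real_def)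
  qed
  then show ?thesis using r d by (intro exI[of _ "min r d"]) auto
qed

text \<open>The interior may be disconnected although the region is connected: components can touch at an edge. If
the whole smooth boundary of a component \<open>C\<close> belonged to \<open>\<L>\<close>, the position field restricted to \<open>C\<close> would
have nonpositive flux but divergence \<open>N\<close> on \<open>C\<close>, a contradiction.\<close>

lemma component_meets_displacement_boundary:
  fixes \<Omega> :: "(real^'n) set"
  assumes region: "partitioned_region \<Omega> \<D> \<L>"
    and inflow: "\<And>x n. x \<in> \<L> \<Longrightarrow> outward_normal \<Omega> x n \<Longrightarrow> x \<bullet> n \<le> 0"
    and C: "C \<in> components (interior \<Omega>)"
  obtains U \<rho> g x where "smooth_boundary_chart \<Omega> \<D> U \<rho> g" "x \<in> U" "\<rho> x = 0" "x \<in> closure C"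
proof (rule ccontr)
  assume contra: "\<not> thesis"
  note found = that
  \<comment> \<open>a chart point of \<open>\<D>\<close> in the closure of \<open>C\<close> would prove the claim\<close>
  have away: "x \<notin> closure C" if "smooth_boundary_chart \<Omega> \<D> U \<rho> g" "x \<in> U" "\<rho> x = 0" for U \<rho> g x
    using contra found[OF that] by blast
  let ?S = "interior \<Omega>"
  let ?P = "\<lambda>x. if x \<in> C then x else 0 :: real^'n"
  have \<Omega>: "compact \<Omega>" "closure ?S = \<Omega>" using region by (auto simp: partitioned_region_def)
  have opC: "open C" by (rule open_components[OF open_interior C])
  have CS: "C \<subseteq> ?S" using C by (rule in_components_subset)
  have Cne: "C \<noteq> {}" using C by (rule in_components_nonempty)
  have op_rest: "open (?S - C)"
  proof -
    have "?S - C = \<Union>(components ?S - {C})"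
    proof
      show "?S - C \<subseteq> \<Union>(components ?S - {C})"
      proof
        fix x assume x: "x \<in> ?S - C"
        then have "x \<in> \<Union>(components ?S)" using Union_components[of ?S] by simp
        then show "x \<in> \<Union>(components ?S - {C})" using x by blast
      qed
      show "\<Union>(components ?S - {C}) \<subseteq> ?S - C"
        using components_nonoverlap[OF _ C] in_components_subset[of _ ?S] by blast
    qed
    moreover have "open (\<Union>(components ?S - {C}))"
      by (intro open_Union ballI) (use open_components[OF open_interior[of \<Omega>]] in blast)
    ultimately show ?thesis by simp
  qed
  have der: "(?P has_derivative (\<lambda>h. if x \<in> C then h else 0)) (at x)" if x: "x \<in> ?S" for x
  proof (cases "x \<in> C")
    case True
    have "(?P has_derivative (\<lambda>h. h)) (at x)"
      by (rule has_derivative_transform_within_open[OF has_derivative_ident opC True]) simp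
    then show ?thesis using True by simp
  next
    case False
    have "(?P has_derivative (\<lambda>h. 0)) (at x)"
      by (rule has_derivative_transform_within_open[OF has_derivative_const[of 0] op_rest]) (use x False in auto)
    then show ?thesis using False by simp
  qed
  have div: "vdiv ?P x = (if x \<in> C then real CARD('n) else 0)" if "x \<in> ?S" for x
    by (subst vdiv_eqI[OF der[OF that]]) simp
  obtain B where B: "\<And>x. x \<in> \<Omega> \<Longrightarrow> norm x \<le> B" using compact_imp_bounded[OF \<Omega>(1)] unfolding bounded_iff by blast
  define M where "M = \<bar>B\<bar> + real CARD('n)"
  have bf: "bounded_field ?S ?P M"
  proof
    show "bounded ?S" using \<Omega>(1) compact_imp_bounded interior_subset bounded_subset by metis
    show "C1_on ?S ?P"
    proof (rule C1_onI[OF der])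
      fix v :: "real^'n"
      have "continuous_on C (\<lambda>x. if x \<in> C then v else 0)"
        by (rule continuous_on_eq[OF continuous_on_const[of _ v]]) simp
      moreover have "continuous_on (?S - C) (\<lambda>x. if x \<in> C then v else 0)"
        by (rule continuous_on_eq[OF continuous_on_const[of _ 0]]) simp
      ultimately have "continuous_on (C \<union> (?S - C)) (\<lambda>x. if x \<in> C then v else 0)"
        by (rule continuous_on_open_Un[OF opC op_rest])
      moreover have "C \<union> (?S - C) = ?S" using CS by blast
      ultimately show "continuous_on ?S (\<lambda>x. if x \<in> C then v else 0)" by simp
    qed
    fix x assume x: "x \<in> ?S"
    then show "norm (?P x) \<le> M" using B[of x] interior_subset[of \<Omega>] by (auto simp: M_def)
    show "\<bar>vdiv ?P x\<bar> \<le> M" unfolding div[OF x] by (simp add: M_def)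
  qed simp
  have "(\<integral>x. indicator ?S x * vdiv ?P x \<partial>lborel) \<le> 0"
  proof (rule integral_divergence_nonpos_partitioned[OF region bf])
    fix U \<rho> g x' and e :: real
    assume ch: "smooth_boundary_chart \<Omega> \<D> U \<rho> g \<or> smooth_boundary_chart \<Omega> \<L> U \<rho> g"
      and x': "x' \<in> U" "\<rho> x' = 0" and e: "e > 0"
    have opU: "open U" and g_cont: "continuous_on U g"
      using ch by (auto simp: smooth_boundary_chart_def regular_function_def)
    show "\<exists>d>0. \<forall>z\<in>?S \<inter> ball x' d. ?P z \<bullet> g z \<le> e"
      using ch
    proof
      assume "smooth_boundary_chart \<Omega> \<D> U \<rho> g"
      then have "x' \<in> - closure C" using away x' by blast
      then obtain d where d: "d > 0" "ball x' d \<subseteq> - closure C"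
        using open_contains_ball[of "- closure C"] by auto
      have "?P z \<bullet> g z \<le> e" if "z \<in> ?S \<inter> ball x' d" for z
      proof -
        have "z \<notin> C" using that d(2) closure_subset by blast
        then show ?thesis using e by simp
      qed
      then show ?thesis using d(1) by blast
    next
      assume ch: "smooth_boundary_chart \<Omega> \<L> U \<rho> g"
      note n = smooth_boundary_chart_outward_normal[OF ch x']
      have "x' \<bullet> g x' = norm (g x') * (x' \<bullet> (g x' /\<^sub>R norm (g x')))" using n(3) by simp
      also have "\<dots> \<le> 0" using inflow[OF n(2,1)] by (intro mult_nonneg_nonpos) auto
      finally have neg: "x' \<bullet> g x' \<le> 0" .
      have cont: "continuous_on (\<Omega> \<inter> U) (\<lambda>z. z \<bullet> g z)"
        by (intro continuous_on_inner continuous_on_id continuous_on_subset[OF g_cont]) auto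
      obtain d where d: "d > 0" "\<forall>z\<in>\<Omega> \<inter> ball x' d. z \<bullet> g z \<le> e"
        using continuous_nonpos_nearly_nonpos[OF opU cont n(4) x'(1) neg e] by blast
      have "?P z \<bullet> g z \<le> e" if "z \<in> ?S \<inter> ball x' d" for z
        using d(2) that interior_subset[of \<Omega>] e by (cases "z \<in> C") auto
      then show ?thesis using d(1) by blast
    qed
  qed
  moreover have "(\<lambda>x. indicator ?S x * vdiv ?P x) = (\<lambda>x. indicator C x * real CARD('n))"
    using div CS by (auto simp: indicator_def fun_eq_iff)
  ultimately have "(\<integral>x. indicator C x * real CARD('n) \<partial>lborel) \<le> 0" by simp
  moreover obtain p where p: "p \<in> C" using Cne by blast
  moreover have "bounded C" using \<Omega>(1) compact_imp_bounded interior_subset bounded_subset CS by (metis order_trans)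
  ultimately have "real CARD('n) = 0"
    using continuous_nonneg_integral_nonpos_imp_0[OF opC _ continuous_on_const[of C "real CARD('n)"], of "real CARD('n)" p]
    by simp
  then show False by simp
qed

text \<open>With \<open>G x = I + a \<otimes> n\<close> the flux factors as \<open>(x \<bullet> n) (W (G x) - W I - S \<bullet> (G x - I))\<close>, and the second
factor is the rank-one convexity inequality between \<open>G x\<close> and the identity.\<close>

lemma displacement_flux_nonpos:
  fixes W :: "real^'n^'n \<Rightarrow> real"
  assumes rank1: "rank_one_convex W" and G: "G x \<in> Lin_plus" "G x - mat 1 = tensor a n"
    and y: "y x = x" and xn: "x \<bullet> n \<ge> 0"
  shows "energy_flux W y G x \<bullet> n \<le> 0"
proof -
  let ?s = "a \<bullet> (stress W (G x) *v n)"
  have I: "mat 1 \<in> (Lin_plus :: (real^'n^'n) set)" by (simp add: Lin_plus_def)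
  have neg: "mat 1 - G x = tensor (- a) n"
    using arg_cong[OF G(2), of uminus] by (simp add: tensor_def vec_eq_iff)
  then have "W (mat 1) - W (G x) \<ge> stress W (G x) \<bullet> (mat 1 - G x)"
    using rank1 I G(1) unfolding rank_one_convex_def by blast
  then have r: "W (G x) - W (mat 1) - ?s \<le> 0" unfolding neg inner_tensor by simp
  have "y x - G x *v x = (mat 1 - G x) *v x"
    using y by (simp add: matrix_vector_mult_diff_rdistrib)
  also have "\<dots> = - ((n \<bullet> x) *\<^sub>R a)" unfolding neg tensor_mult_vector by simp
  finally have e: "y x - G x *v x = - ((n \<bullet> x) *\<^sub>R a)" .
  have "energy_flux W y G x \<bullet> n = (x \<bullet> n) * (W (G x) - W (mat 1) - ?s)"
    unfolding energy_flux_inner e by (simp add: algebra_simps inner_commute)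
  also have "\<dots> \<le> 0" using xn r by (rule mult_nonneg_nonpos)
  finally show ?thesis .
qed

text \<open>For a rotation \<open>F\<close> the hypothesis only speaks when there is a matrix that is not a rotation to compare
with; twice the identity is one.\<close>

lemma identity_minimizes_energy:
  fixes W :: "real^'n^'n \<Rightarrow> real"
  assumes min: "\<forall>F \<in> Lin_plus - Orth_plus. \<forall>R \<in> Orth_plus. W F > W R \<and> W R = W (mat 1)"
    and F: "F \<in> Lin_plus"
  shows "W (mat 1) \<le> W F"
proof -
  have I: "mat 1 \<in> (Orth_plus :: (real^'n^'n) set)"
    by (simp add: Orth_plus_def rotation_matrix_def orthogonal_matrix_def)
  have det2: "det (mat 2 :: real^'n^'n) = 2 ^ CARD('n)"
    by (subst det_diagonal) (auto simp: mat_def)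
  have "det (mat 2 :: real^'n^'n) > 1" unfolding det2 by (rule one_less_power) auto
  then have two: "mat 2 \<in> Lin_plus - (Orth_plus :: (real^'n^'n) set)"
    by (auto simp: Lin_plus_def Orth_plus_def rotation_matrix_def)
  show ?thesis
  proof (cases "F \<in> Orth_plus")
    case True
    then have "W F = W (mat 1)" using min two by blast
    then show ?thesis by simp
  next
    case False
    then have "W (mat 1) < W F" using min I F by blast
    then show ?thesis by simp
  qed
qed

text \<open>The flux of the energy-momentum field is nonpositive on both boundary parts, so the excess energy is
zero and the gradient is a rotation everywhere. On each component of the interior the deformation is
then rigid, and at a point where this component meets \<open>\<D>\<close> its rotation fixes the tangent hyperplane.\<close>

theorem equilibrium_is_identity:
  fixes W :: "real^'n^'n \<Rightarrow> real" and \<Omega> :: "(real^'n) set"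
  assumes region: "partitioned_region \<Omega> \<D> \<L>"
    and W_C2: "C2_on Lin_plus W"
    and partition: "partition_condition \<Omega> \<D> \<L>"
    and rank_one: "rank_one_convex W"
    and minimum: "\<forall>F \<in> Lin_plus - Orth_plus. \<forall>R \<in> Orth_plus. W F > W R \<and> W R = W (mat 1)"
    and equil: "classical_equilibrium W \<Omega> y"
    and y_D: "\<And>x. x \<in> \<D> \<Longrightarrow> y x = x"
    and traction: "\<And>x n. x \<in> \<L> \<Longrightarrow> outward_normal \<Omega> x n \<Longrightarrow>
        stress W (gradient_on \<Omega> y x) *v n = stress W (mat 1) *v n"
    and x: "x \<in> \<Omega>"
  shows "y x = x"
proof -
  define S where "S = interior \<Omega>"
  define G where "G = gradient_on \<Omega> y"
  have \<Omega>: "compact \<Omega>" "closure S = \<Omega>" using region by (auto simp: partitioned_region_def S_def)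
  have S\<Omega>: "S \<subseteq> \<Omega>" by (simp add: S_def interior_subset)
  have opS: "open S" by (simp add: S_def)
  have bS: "bounded S" using \<Omega>(1) compact_imp_bounded S\<Omega> bounded_subset by metis
  have y_cont: "continuous_on \<Omega> y" and G_cont: "continuous_on \<Omega> G"
    and G_Lin: "\<And>x. x \<in> \<Omega> \<Longrightarrow> G x \<in> Lin_plus"
    and div0: "\<And>x. x \<in> S \<Longrightarrow> divergence (\<lambda>z. stress W (G z)) x = 0"
    using equil by (auto simp: classical_equilibrium_def G_def S_def)
  interpret smooth_deformation W S y G
  proof unfold_locales
    show "C2_on S y" using equil by (simp add: classical_equilibrium_def S_def)
    show "G x = jacobian y (at x)" if "x \<in> S" for x using that by (simp add: G_def S_def gradient_on_def)
    show "G x \<in> Lin_plus" if "x \<in> S" for x using that S\<Omega> by (intro G_Lin) blast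
  qed (rule W_C2 opS)+
  have W_min: "W (mat 1) \<le> W F" if "F \<in> Lin_plus" for F
    by (rule identity_minimizes_energy[OF minimum that])
  have I: "mat 1 \<in> (Lin_plus :: (real^'n^'n) set)" by (simp add: Lin_plus_def)
  \<comment> \<open>the prescribed traction on \<open>\<L>\<close> is zero, as the identity is a critical point of the energy\<close>
  have stress_I: "stress W (mat 1) = 0" by (rule stress_eq_0_at_minimum[OF W_C1 I W_min])
  have WG_cont: "continuous_on \<Omega> (\<lambda>x. W (G x))"
    by (rule continuous_on_compose2[OF C1_on_continuous_on[OF W_C1] G_cont]) (use G_Lin in auto)
  have SG_cont: "continuous_on \<Omega> (\<lambda>x. stress W (G x))"
    by (rule continuous_on_compose2[OF C1_on_continuous_on[OF C1_on_stress[OF W_C2]] G_cont]) (use G_Lin in auto)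
  let ?P = "energy_flux W y G"
  let ?w = "\<lambda>x. W (G x) - W (mat 1)"
  have P_cont: "continuous_on \<Omega> ?P"
    unfolding energy_flux_def[abs_def]
    by (intro continuous_on_add continuous_on_scaleR continuous_on_diff continuous_on_const continuous_on_id
        bounded_bilinear.continuous_on[OF bounded_bilinear_vector_matrix_mult]
        bounded_bilinear.continuous_on[OF bounded_bilinear_matrix_vector_mult] WG_cont SG_cont y_cont G_cont)
  have w_cont: "continuous_on \<Omega> ?w" by (intro continuous_on_diff WG_cont continuous_on_const)
  have div_P: "vdiv ?P x = real CARD('n) * ?w x" if "x \<in> S" for x
    by (rule vdiv_energy_flux[OF that div0[OF that]])
  obtain B1 where B1: "\<And>x. x \<in> \<Omega> \<Longrightarrow> norm (?P x) \<le> B1"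
    using compact_imp_bounded[OF compact_continuous_image[OF P_cont \<Omega>(1)]] unfolding bounded_iff by blast
  obtain B2 where B2: "\<And>x. x \<in> \<Omega> \<Longrightarrow> norm (?w x) \<le> B2"
    using compact_imp_bounded[OF compact_continuous_image[OF w_cont \<Omega>(1)]] unfolding bounded_iff by blast
  have bf: "bounded_field S ?P (max B1 (real CARD('n) * B2))"
  proof
    fix x assume x: "x \<in> S"
    then have "x \<in> \<Omega>" using S\<Omega> by blast
    then show "norm (?P x) \<le> max B1 (real CARD('n) * B2)" using B1 by (simp add: le_max_iff_disj)
    have "\<bar>vdiv ?P x\<bar> \<le> real CARD('n) * B2"
      unfolding div_P[OF x] abs_mult using B2[OF \<open>x \<in> \<Omega>\<close>] by (intro mult_mono) auto
    then show "\<bar>vdiv ?P x\<bar> \<le> max B1 (real CARD('n) * B2)" by simp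
  qed (use opS bS energy_flux_C1 in auto)
  have D_trace: "(G x - mat 1) *v \<tau> = 0"
    if ch: "smooth_boundary_chart \<Omega> \<D> U \<rho> g" and x: "x \<in> U" "\<rho> x = 0" and \<tau>: "g x \<bullet> \<tau> = 0" for U \<rho> g x \<tau>
  proof (rule tangential_derivative_zero[OF ch x])
    show "continuous_on \<Omega> (\<lambda>x. y x - x)" by (intro continuous_on_diff y_cont continuous_on_id)
    show "y x - x = 0" if "x \<in> \<D>" for x using y_D[OF that] by simp
    show "((\<lambda>x. y x - x) has_derivative (\<lambda>h. (G x - mat 1) *v h)) (at x)" if "x \<in> interior \<Omega>" for x
      using has_derivative_diff[OF y_has_derivative has_derivative_ident, of x] that
      by (simp add: S_def matrix_vector_mult_diff_rdistrib)
    show "continuous_on \<Omega> (\<lambda>x. G x - mat 1)" by (intro continuous_on_diff G_cont continuous_on_const)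
  qed (rule \<tau>)
  have flux: "?P x \<bullet> g x \<le> 0"
    if ch: "smooth_boundary_chart \<Omega> \<D> U \<rho> g \<or> smooth_boundary_chart \<Omega> \<L> U \<rho> g" and x: "x \<in> U" "\<rho> x = 0"
    for U \<rho> g x
  proof -
    let ?n = "g x /\<^sub>R norm (g x)"
    have "g x \<noteq> 0" using ch smooth_boundary_chart_outward_normal(3)[where U=U and \<rho>=\<rho> and g=g and x=x] x by blast
    then have n1: "norm ?n = 1" and gn: "g x = norm (g x) *\<^sub>R ?n" by auto
    have "?P x \<bullet> ?n \<le> 0" using ch
    proof
      assume ch: "smooth_boundary_chart \<Omega> \<D> U \<rho> g"
      note n = smooth_boundary_chart_outward_normal[OF ch x]
      have T: "G x - mat 1 = tensor ((G x - mat 1) *v ?n) ?n"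
        by (rule matrix_eq_tensor[OF n1]) (use D_trace[OF ch x] n(3) in auto)
      have xn: "x \<bullet> ?n \<ge> 0" using partition n(1,2) unfolding partition_condition_def by blast
      show ?thesis
        by (rule displacement_flux_nonpos[where G=G and x=x and y=y,
              OF rank_one G_Lin[OF n(4)] T y_D[OF n(2)] xn])
    next
      assume ch: "smooth_boundary_chart \<Omega> \<L> U \<rho> g"
      note n = smooth_boundary_chart_outward_normal[OF ch x]
      have "stress W (G x) *v ?n = 0"
        using traction[OF n(2,1)] stress_I unfolding G_def by simp
      then have P_n: "?P x \<bullet> ?n = ?w x * (x \<bullet> ?n)" unfolding energy_flux_inner by simp
      have xn: "x \<bullet> ?n \<le> 0" using partition n(1,2) unfolding partition_condition_def by blast
      have "?w x \<ge> 0" using W_min[OF G_Lin[OF n(4)]] by simp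
      then show ?thesis unfolding P_n using xn by (rule mult_nonneg_nonpos)
    qed
    then have "norm (g x) * (?P x \<bullet> ?n) \<le> 0" by (intro mult_nonneg_nonpos) auto
    then show ?thesis by (subst gn) simp
  qed
  have "(\<integral>x. indicator S x * vdiv ?P x \<partial>lborel) \<le> 0"
    unfolding S_def
  proof (rule integral_divergence_nonpos_partitioned[OF region bf[unfolded S_def]])
    fix U \<rho> g x' and e :: real
    assume ch: "smooth_boundary_chart \<Omega> \<D> U \<rho> g \<or> smooth_boundary_chart \<Omega> \<L> U \<rho> g"
      and x': "x' \<in> U" "\<rho> x' = 0" and e: "e > 0"
    have opU: "open U" and g_cont: "continuous_on U g"
      using ch by (auto simp: smooth_boundary_chart_def regular_function_def)
    have x'\<Omega>: "x' \<in> \<Omega>"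
      using ch smooth_boundary_chart_outward_normal(4)[where U=U and \<rho>=\<rho> and g=g and x=x'] x' by blast
    have cont: "continuous_on (\<Omega> \<inter> U) (\<lambda>z. ?P z \<bullet> g z)"
      by (intro continuous_on_inner continuous_on_subset[OF P_cont] continuous_on_subset[OF g_cont]) auto
    have "\<exists>d>0. \<forall>z\<in>\<Omega> \<inter> ball x' d. ?P z \<bullet> g z \<le> e"
      by (rule continuous_nonpos_nearly_nonpos[where f="\<lambda>z. ?P z \<bullet> g z",
            OF opU cont x'\<Omega> x'(1) flux[OF ch x'] e])
    then show "\<exists>d>0. \<forall>z\<in>interior \<Omega> \<inter> ball x' d. ?P z \<bullet> g z \<le> e"
      using S\<Omega> unfolding S_def by blast
  qed
  moreover have "(\<lambda>x. indicator S x * vdiv ?P x) = (\<lambda>x. indicator S x * (real CARD('n) * ?w x))"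
    using div_P by (auto simp: indicator_def fun_eq_iff)
  ultimately have int_le: "(\<integral>x. indicator S x * (real CARD('n) * ?w x) \<partial>lborel) \<le> 0" by simp
  have w0: "?w x = 0" if x: "x \<in> S" for x
  proof -
    have "real CARD('n) * ?w x = 0"
    proof (rule continuous_nonneg_integral_nonpos_imp_0[OF opS bS _ _ _ int_le x])
      show "continuous_on S (\<lambda>x. real CARD('n) * ?w x)"
        by (intro continuous_on_mult continuous_on_const continuous_on_subset[OF w_cont S\<Omega>])
      show "0 \<le> real CARD('n) * ?w z" if "z \<in> S" for z
        using W_min[OF G_Lin_plus[OF that]] by (intro mult_nonneg_nonneg) auto
      show "real CARD('n) * ?w z \<le> real CARD('n) * B2" if "z \<in> S" for z
        using B2[of z] S\<Omega> that by (intro mult_left_mono) auto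
    qed
    then show ?thesis by simp
  qed
  have rot: "rotation_matrix (G x)" if x: "x \<in> S" for x
  proof (rule ccontr)
    assume "\<not> rotation_matrix (G x)"
    then have "G x \<in> Lin_plus - Orth_plus" using G_Lin_plus[OF x] by (simp add: Orth_plus_def)
    moreover have "mat 1 \<in> (Orth_plus :: (real^'n^'n) set)"
      by (simp add: Orth_plus_def rotation_matrix_def orthogonal_matrix_def)
    ultimately have "W (G x) > W (mat 1)" using minimum by blast
    then show False using w0[OF x] by simp
  qed
  have orth: "orthogonal_matrix (G x)" if "x \<in> S" for x
    using rot[OF that] by (simp add: rotation_matrix_def)
  have y_S: "y x = x" if x: "x \<in> S" for x
  proof -
    obtain C where C: "C \<in> components S" "x \<in> C" using x Union_components by blast
    have opC: "open C" by (rule open_components[OF opS C(1)])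
    have CS: "C \<subseteq> S" by (rule in_components_subset[OF C(1)])
    obtain Q c where Q: "\<And>x. x \<in> C \<Longrightarrow> G x = Q" "\<And>x. x \<in> C \<Longrightarrow> y x = Q *v x + c"
      using rigid_motion_on_connected[OF orth opC in_components_connected[OF C(1)] CS] by blast
    have clC: "closure C \<subseteq> \<Omega>" using closure_mono[OF CS] \<Omega>(2) by simp
    obtain U \<rho> g p where p: "smooth_boundary_chart \<Omega> \<D> U \<rho> g" "p \<in> U" "\<rho> p = 0" "p \<in> closure C"
    proof (rule component_meets_displacement_boundary[OF region])
      show "x \<bullet> n \<le> 0" if "x \<in> \<L>" "outward_normal \<Omega> x n" for x n
        using partition that unfolding partition_condition_def by blast
      show "C \<in> components (interior \<Omega>)" using C(1) by (simp add: S_def)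
    qed
    note n = smooth_boundary_chart_outward_normal[OF p(1-3)]
    \<comment> \<open>\<open>p\<close> is only in the closure of \<open>C\<close>: gradient and deformation extend there by continuity\<close>
    have Gp: "G p = Q"
      by (rule continuous_constant_on_closure[OF continuous_on_subset[OF G_cont clC] _ p(4)]) (rule Q(1))
    have "y p - (Q *v p + c) = 0"
    proof (rule continuous_constant_on_closure[OF _ _ p(4)])
      show "continuous_on (closure C) (\<lambda>x. y x - (Q *v x + c))"
        by (intro continuous_on_diff continuous_on_add continuous_on_const continuous_on_subset[OF y_cont clC]
            bounded_linear.continuous_on[OF matrix_vector_mul_bounded_linear] continuous_on_id)
      show "y x - (Q *v x + c) = 0" if "x \<in> C" for x using Q(2)[OF that] by simp
    qed
    then have yp: "p = Q *v p + c" using y_D[OF n(2)] by simp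
    have "Q = mat 1"
    proof (rule rotation_fixing_hyperplane[where n = "g p /\<^sub>R norm (g p)"])
      show "rotation_matrix Q" using rot[of x] Q(1)[OF C(2)] CS C(2) by auto
      show "norm (g p /\<^sub>R norm (g p)) = 1" using n(3) by simp
      show "(Q - mat 1) *v \<tau> = 0" if "(g p /\<^sub>R norm (g p)) \<bullet> \<tau> = 0" for \<tau>
        using D_trace[OF p(1-3)] that n(3) unfolding Gp by auto
    qed
    then have "c = 0" using yp by simp
    then show "y x = x" using Q(2)[OF C(2)] \<open>Q = mat 1\<close> by simp
  qed
  have "y x - x = 0"
  proof (rule continuous_constant_on_closure[of S "\<lambda>x. y x - x"])
    show "continuous_on (closure S) (\<lambda>x. y x - x)"
      unfolding \<Omega>(2) by (intro continuous_on_diff y_cont continuous_on_id)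
  qed (use y_S x \<Omega>(2) in auto)
  then show ?thesis by simp
qed

text \<open>On the boundary the gradient is a limit from the interior; the limit is determined because \<open>\<Omega>\<close> is the
closure of its interior.\<close>

lemma identity_gradient_on:
  fixes \<Omega> :: "(real^'n) set"
  assumes \<Omega>: "\<Omega> \<subseteq> closure (interior \<Omega>)" and y: "\<forall>x\<in>\<Omega>. y x = x" and x: "x \<in> \<Omega>"
  shows "gradient_on \<Omega> y x = mat 1"
proof -
  have jac: "jacobian y (at z) = mat 1" if z: "z \<in> interior \<Omega>" for z
  proof -
    have "(y has_derivative (\<lambda>h. h)) (at z)"
      by (rule has_derivative_transform_within_open[OF has_derivative_ident open_interior z])
        (use y interior_subset in force)
    then have "frechet_derivative y (at z) = (\<lambda>h. h)" by (rule frechet_derivative_at[symmetric])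
    then show ?thesis by (simp add: jacobian_def matrix_def mat_def axis_def vec_eq_iff)
  qed
  show ?thesis
  proof (cases "x \<in> interior \<Omega>")
    case True
    then show ?thesis by (simp add: gradient_on_def jac)
  next
    case False
    have nt: "\<not> trivial_limit (at x within interior \<Omega>)"
      using \<Omega> x False by (auto simp: trivial_limit_within closure_def)
    have "((\<lambda>z. jacobian y (at z)) \<longlongrightarrow> mat 1) (at x within interior \<Omega>)"
      by (rule tendsto_eventually) (auto simp: eventually_at_filter jac)
    then have "Lim (at x within interior \<Omega>) (\<lambda>z. jacobian y (at z)) = mat 1"
      by (rule tendsto_Lim[OF nt])
    then show ?thesis using False by (simp add: gradient_on_def)
  qed
qed

lemma identity_classical_equilibrium:
  fixes \<Omega> :: "(real^'n) set"
  assumes \<Omega>: "\<Omega> \<subseteq> closure (interior \<Omega>)" and y: "\<forall>x\<in>\<Omega>. y x = x"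
  shows "classical_equilibrium W \<Omega> y"
proof -
  note grad = identity_gradient_on[OF \<Omega> y]
  have int: "x \<in> \<Omega>" if "x \<in> interior \<Omega>" for x using that interior_subset by blast
  have "C2_on (interior \<Omega>) y"
    unfolding C2_on_def
  proof (intro exI[of _ "\<lambda>_. id_blinfun"] conjI ballI)
    fix x assume x: "x \<in> interior \<Omega>"
    have "(y has_derivative (\<lambda>h. h)) (at x)"
      by (rule has_derivative_transform_within_open[OF has_derivative_ident open_interior x])
        (use y int in force)
    then show "(y has_derivative blinfun_apply id_blinfun) (at x)" by (simp add: id_blinfun.rep_eq id_def)
  qed (rule C1_on_const)
  moreover have "continuous_on \<Omega> y"
    by (rule continuous_on_eq[OF continuous_on_id]) (simp add: y)
  moreover have "continuous_on \<Omega> (gradient_on \<Omega> y)"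
    by (rule continuous_on_eq[OF continuous_on_const[of _ "mat 1"]]) (simp add: grad)
  moreover have "gradient_on \<Omega> y x \<in> Lin_plus" if "x \<in> \<Omega>" for x
    using grad[OF that] by (simp add: Lin_plus_def)
  moreover have "divergence (\<lambda>z. stress W (gradient_on \<Omega> y z)) x = 0" if x: "x \<in> interior \<Omega>" for x
  proof -
    have "((\<lambda>z. stress W (gradient_on \<Omega> y z)) has_derivative (\<lambda>h. 0)) (at x)"
      by (rule has_derivative_transform_within_open[OF has_derivative_const[of "stress W (mat 1)"] open_interior x])
        (simp add: grad int)
    then have "frechet_derivative (\<lambda>z. stress W (gradient_on \<Omega> y z)) (at x) = (\<lambda>h. 0)"
      by (rule frechet_derivative_at[symmetric])
    then show ?thesis by (simp add: divergence_def vec_eq_iff)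
  qed
  ultimately show ?thesis unfolding classical_equilibrium_def by blast
qed

theorem proposition3p5:
  fixes W :: "real^'n^'n \<Rightarrow> real"
    and \<Omega> \<D> \<L> :: "(real^'n) set"
  assumes region: "partitioned_region \<Omega> \<D> \<L>"
    and W_C2: "C2_on Lin_plus W"
    and partition: "partition_condition \<Omega> \<D> \<L>"
    and rank_one: "rank_one_convex W"
    and minimum: "\<forall>F \<in> Lin_plus - Orth_plus. \<forall>R \<in> Orth_plus. W F > W R \<and> W R = W (mat 1)"
  shows "\<forall>y :: real^'n \<Rightarrow> real^'n.
    (classical_equilibrium W \<Omega> y \<and> (\<forall>x\<in>\<D>. y x = x) \<and>
     (\<forall>x\<in>\<L>. \<forall>n. outward_normal \<Omega> x n \<longrightarrow>
        stress W (gradient_on \<Omega> y x) *v n = stress W (mat 1) *v n))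
    \<longleftrightarrow> (\<forall>x\<in>\<Omega>. y x = x)"
proof (intro allI iffI)
  fix y :: "real^'n \<Rightarrow> real^'n"
  assume A: "classical_equilibrium W \<Omega> y \<and> (\<forall>x\<in>\<D>. y x = x) \<and>
     (\<forall>x\<in>\<L>. \<forall>n. outward_normal \<Omega> x n \<longrightarrow>
        stress W (gradient_on \<Omega> y x) *v n = stress W (mat 1) *v n)"
  show "\<forall>x\<in>\<Omega>. y x = x"
  proof
    fix x assume "x \<in> \<Omega>"
    then show "y x = x"
      by (rule equilibrium_is_identity[OF assms, rotated 3]) (use A in blast)+
  qed
next
  fix y :: "real^'n \<Rightarrow> real^'n"
  assume A: "\<forall>x\<in>\<Omega>. y x = x"
  have \<Omega>: "\<Omega> \<subseteq> closure (interior \<Omega>)" and cl: "closed \<Omega>" and fr: "frontier \<Omega> = \<D> \<union> \<L>"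
    using region compact_imp_closed unfolding partitioned_region_def by auto
  have sub: "\<D> \<subseteq> \<Omega>" "\<L> \<subseteq> \<Omega>" using frontier_subset_closed[OF cl] fr by auto
  have "\<forall>x\<in>\<L>. \<forall>n. outward_normal \<Omega> x n \<longrightarrow>
        stress W (gradient_on \<Omega> y x) *v n = stress W (mat 1) *v n"
    using identity_gradient_on[OF \<Omega> A] sub(2) by (metis subsetD)
  then show "classical_equilibrium W \<Omega> y \<and> (\<forall>x\<in>\<D>. y x = x) \<and>
     (\<forall>x\<in>\<L>. \<forall>n. outward_normal \<Omega> x n \<longrightarrow>
        stress W (gradient_on \<Omega> y x) *v n = stress W (mat 1) *v n)"
    using identity_classical_equilibrium[OF \<Omega> A] A sub(1) by blast
qed

end
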